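(* Suppose that $f=A^{-1}C:I_1\times I_2\to\mathcal{Z}$ is a regular umbilic-free Legendre map with one family of spherical curvature lines, where $A$ is the spherical evolution map along $L:I_2\to\mathcal{S}$ based at $v_0\in I_2$ and $C:I_1\to\mathcal{Z}$ is a Legendre curve in $L_0^\perp$, with $L_0:=L(v_0)$. Then $f$ is Lie applicable if and only if either the other family of curvature lines is also spherical, or $L$ lies in a constant $4$-dimensional space $L_0\oplus_\perp W_0$ and $C$ is a constrained elastic curve with respect to $W_0$.
   Context: Let $\mathbb{R}^{4,2}$ be $\mathbb{R}^6$ with a symmetric bilinear form $(\cdot,\cdot)$ of signature $(4,2)$, $\mathcal{L}$ its light cone, $\mathcal{Z}$ the Grassmannian of totally isotropic 2-planes, and $\wedge^2\mathbb{R}^{4,2}\cong\mathfrak{o}(4,2)$ via $(a\wedge b)c=(a,c)b-(b,c)a$. $I_1,I_2$ are open intervals and $\Sigma=I_1\times I_2$ with coordinates $(u,v)$. A smooth map $f:\Sigma\to\mathcal{Z}$ is identified with a rank 2 null subbundle of $\Sigma\times\mathbb{R}^{4,2}$; $f^{(1)}$ is the set of sections of $f$ and derivatives of sections of $f$. $f$ is a Legendre map if $f^{(1)}\le f^\perp$ and, for any $x$, if $X\in T_x\Sigma$ satisfies $d\sigma(X)\in f$ for all $\sigma\in\Gamma f$, then $X=0$. A Legendre curve in $L_0^\perp\cong\mathbb{R}^{3,2}$ is a map from an interval into the isotropic 2-planes of $L_0^\perp$ satisfying the same conditions within $L_0^\perp$. $f$ is umbilic-free if there are two curvature sphere congruences,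 rank 1 subbundles $s_1,s_2\le f$ with $s_1\cap s_2=\{0\}$, and rank 1 curvature subbundles $T_1,T_2$ with $d_X\sigma_i\in\Gamma f$ for $\sigma_i\in\Gamma s_i$, $X\in\Gamma T_i$; leaves of $T_1,T_2$ are the curvature lines. Here $(u,v)$ are curvature line coordinates, $\partial_u\in\Gamma T_1$, $\partial_v\in\Gamma T_2$, and the $u$-lines are the given spherical family. $f$ is regular if $s_1,s_2:\Sigma\to\mathbb{P}(\mathcal{L})$ are immersions. The leaves of $T_i$ are spherical curvature lines if some spacelike rank 1 subbundle of $f^\perp$ is constant along the leaves of $T_i$ (the Lie-invariant form of: in any conformal Riemannian subgeometry they lie on spheres meeting the surface transversally). $\mathcal{S}$ is the Grassmannian of spacelike lines in $\mathbb{R}^{4,2}$. For $L:I_2\to\mathcal{S}$ write $d=\mathcal{D}^L+\mathcal{N}^L$, with $\mathcal{D}^L$ the sum of the induced connections on $L$ and $L^\perp$ and $\mathcal{N}^L\in\Omega^1(L\wedge L^\perp)$; the spherical evolution map along $L$ based at $v_0$ is $A:I_2\to\mathrm{O}(4,2)$ with $A\circ\mathcal{D}^L\circ A^{-1}=d$, $A(v_0)=\mathrm{id}$. $f=A^{-1}C$ means $f(u,v)=A^{-1}(v)C(u)$. $f$ is Lie applicable if there is $\eta\in\Omega^1(f\wedge f^\perp)$ with $d\eta=[\eta\wedge\eta]=0$ such that $\mathcal{Q}^\eta(X,Y)=\mathrm{tr}(f\to f:\sigma\mapsto\eta(X)d_Y\sigma)$ is non-zero. Constrained elastic with respect to $W_0$: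 $W_0\le L_0^\perp\cong\mathbb{R}^{3,2}$ is a 3-dimensional subspace. All in $L_0^\perp$: for $\xi\in\Omega^1(C\wedge C^\perp)$ put $\mathcal{Q}^\xi(X,Y)=\mathrm{tr}(C\to C:\sigma\mapsto\xi(X)d_Y\sigma)$; if $\mathcal{Q}^\xi\ne0$, the gauge orbit $[\xi]=\{\xi-d\tau:\tau\in\Gamma(\wedge^2C)\}$ is a polarisation of $C$. A linear conserved quantity of $d+t\xi$ is $p(t)=p_0+tp_1$ with $p_0$ a section of the trivial $L_0^\perp$-bundle, $p_1\in\Gamma C$ and $(d+t\xi)p(t)=0$ for all $t\in\mathbb{R}$. $C$ is a constrained elastic curve with respect to $W_0$ if there is a polarisation $[\xi]$ of $C$ such that $d+t\xi$ admits a 3-dimensional space $W$ of linear conserved quantities with $W(0):=\{p(0):p\in W\}=W_0$. *)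

theory Defs
  imports "HOL-Analysis.Analysis"
begin

section \<open>Smooth maps and bundles over open sets\<close>

definition open_interval :: "real set \<Rightarrow> bool" where
  "open_interval I \<longleftrightarrow> open I \<and> is_interval I \<and> I \<noteq> {}"

abbreviation D :: "('a::real_normed_vector \<Rightarrow> 'b::real_normed_vector) \<Rightarrow> 'a \<Rightarrow> 'a \<Rightarrow> 'b" where
  "D \<sigma> p X \<equiv> frechet_derivative \<sigma> (at p) X"

text \<open>Only used for open \<open>S\<close> in finite-dimensional domains, where \<open>C\<^sup>k\<close> in the usual sense is
  the same as having continuous iterated directional derivatives up to order \<open>k\<close>.\<close>

primrec Ck_on :: "nat \<Rightarrow> 'a set \<Rightarrow> ('a::real_normed_vector \<Rightarrow> 'b::real_normed_vector) \<Rightarrow> bool" where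
  "Ck_on 0 S f \<longleftrightarrow> continuous_on S f"
| "Ck_on (Suc k) S f \<longleftrightarrow>
     (\<forall>x\<in>S. f differentiable (at x)) \<and> (\<forall>X. Ck_on k S (\<lambda>x. D f x X))"

definition smooth_on :: "'a set \<Rightarrow> ('a::real_normed_vector \<Rightarrow> 'b::real_normed_vector) \<Rightarrow> bool" where
  "smooth_on S f \<longleftrightarrow> (\<forall>k. Ck_on k S f)"

text \<open>A bundle over \<open>S\<close> (a subbundle of a trivial bundle) is a map from points to sets of vectors.
  Equivalently, a subbundle of rank \<open>k\<close> is a smooth map from \<open>S\<close> to a Grassmannian.
  Values outside \<open>S\<close> are irrelevant throughout.\<close>

definition subbundle :: "nat \<Rightarrow> 'a set \<Rightarrow> ('a::real_normed_vector \<Rightarrow> 'b::euclidean_space set) \<Rightarrow> bool" where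
  "subbundle k S F \<longleftrightarrow>
     (\<forall>p\<in>S. subspace (F p) \<and> dim (F p) = k) \<and>
     (\<forall>p\<in>S. \<exists>U e. open U \<and> p \<in> U \<and> U \<subseteq> S \<and>
        (\<forall>i<k. smooth_on U (e i)) \<and> (\<forall>q\<in>U. F q = span ((\<lambda>i::nat. e i q) ` {..<k})))"

definition sections :: "'a set \<Rightarrow> ('a::real_normed_vector \<Rightarrow> 'b::real_normed_vector set) \<Rightarrow> ('a \<Rightarrow> 'b) set" where
  "sections S F = {\<sigma>. smooth_on S \<sigma> \<and> (\<forall>p\<in>S. \<sigma> p \<in> F p)}"

text \<open>\<open>F\<^sup>(\<^sup>1\<^sup>)\<close>\<close>

definition derived_bundle ::
  "'a set \<Rightarrow> ('a::real_normed_vector \<Rightarrow> 'b::real_normed_vector set) \<Rightarrow> 'a \<Rightarrow> 'b set" where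
  "derived_bundle S F p =
     {\<sigma> p |\<sigma>. \<sigma> \<in> sections S F} \<union> {D \<sigma> p X |\<sigma> X. \<sigma> \<in> sections S F}"

text \<open>The tangent space of a Grassmannian at \<open>V\<close> is \<open>Hom(V, \<real>\<^sup>n/V)\<close>, and the differential of
  \<open>F\<close> sends \<open>X\<close> to \<open>\<sigma> \<mapsto> d\<sigma>(X) mod F\<close>. Hence this is the immersion condition for \<open>F\<close>
  as a map to the Grassmannian; for rank 1 it is immersion into projective space.\<close>

definition immersed :: "'a set \<Rightarrow> ('a::real_normed_vector \<Rightarrow> 'b::real_normed_vector set) \<Rightarrow> bool" where
  "immersed S F \<longleftrightarrow>
     (\<forall>p\<in>S. \<forall>X. (\<forall>\<sigma>\<in>sections S F. D \<sigma> p X \<in> F p) \<longrightarrow> X = 0)"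

text \<open>Leaves are traced out by curves tangent to \<open>T\<close>.\<close>

definition constant_along_leaves ::
  "'a set \<Rightarrow> ('a::real_normed_vector \<Rightarrow> 'a set) \<Rightarrow> ('a \<Rightarrow> 'b set) \<Rightarrow> bool" where
  "constant_along_leaves S T F \<longleftrightarrow>
     (\<forall>J \<gamma>. open_interval J \<and> smooth_on J \<gamma> \<and>
        (\<forall>t\<in>J. \<gamma> t \<in> S \<and> vector_derivative \<gamma> (at t) \<in> T (\<gamma> t)) \<longrightarrow>
        (\<forall>s\<in>J. \<forall>t\<in>J. F (\<gamma> s) = F (\<gamma> t)))"

text \<open>Curvature sphere congruences \<open>s1\<close>, \<open>s2\<close> of \<open>f\<close> with curvature subbundles \<open>T1\<close>, \<open>T2\<close> of
  the tangent bundle; \<open>f\<close> is umbilic-free if such data exist.\<close>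

definition curvature_data ::
  "'a set \<Rightarrow> ('a::euclidean_space \<Rightarrow> 'b::euclidean_space set) \<Rightarrow>
   ('a \<Rightarrow> 'b set) \<Rightarrow> ('a \<Rightarrow> 'b set) \<Rightarrow> ('a \<Rightarrow> 'a set) \<Rightarrow> ('a \<Rightarrow> 'a set) \<Rightarrow> bool" where
  "curvature_data S f s1 s2 T1 T2 \<longleftrightarrow>
     subbundle 1 S s1 \<and> subbundle 1 S s2 \<and> subbundle 1 S T1 \<and> subbundle 1 S T2 \<and>
     (\<forall>p\<in>S. s1 p \<subseteq> f p \<and> s2 p \<subseteq> f p \<and> s1 p \<inter> s2 p = {0}) \<and>
     (\<forall>\<sigma>\<in>sections S s1. \<forall>X\<in>sections S T1. (\<lambda>p. D \<sigma> p (X p)) \<in> sections S f) \<and>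
     (\<forall>\<sigma>\<in>sections S s2. \<forall>X\<in>sections S T2. (\<lambda>p. D \<sigma> p (X p)) \<in> sections S f)"

section \<open>One-forms with values in matrices\<close>

definition one_forms ::
  "'a set \<Rightarrow> ('a::real_normed_vector \<Rightarrow> 'b::real_normed_vector set) \<Rightarrow> ('a \<Rightarrow> 'a \<Rightarrow> 'b) set" where
  "one_forms S F =
     {\<eta>. (\<forall>p\<in>S. linear (\<eta> p)) \<and> (\<forall>X. (\<lambda>p. \<eta> p X) \<in> sections S F)}"

definition ext_deriv ::
  "('a::real_normed_vector \<Rightarrow> 'a \<Rightarrow> 'b::real_normed_vector) \<Rightarrow> 'a \<Rightarrow> 'a \<Rightarrow> 'a \<Rightarrow> 'b" where
  "ext_deriv \<eta> p X Y = D (\<lambda>q. \<eta> q Y) p X - D (\<lambda>q. \<eta> q X) p Y"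

definition commutator :: "real^'n^'n \<Rightarrow> real^'n^'n \<Rightarrow> real^'n^'n" where
  "commutator M N = M ** N - N ** M"

definition bracket_wedge ::
  "('a \<Rightarrow> 'a \<Rightarrow> real^'n^'n) \<Rightarrow> ('a \<Rightarrow> 'a \<Rightarrow> real^'n^'n) \<Rightarrow> 'a \<Rightarrow> 'a \<Rightarrow> 'a \<Rightarrow> real^'n^'n" where
  "bracket_wedge \<omega> \<eta> p X Y = commutator (\<omega> p X) (\<eta> p Y) - commutator (\<omega> p Y) (\<eta> p X)"

text \<open>Trace of an endomorphism \<open>E\<close> of the subspace \<open>V\<close>.\<close>

definition trace_on :: "'b::euclidean_space set \<Rightarrow> ('b \<Rightarrow> 'b) \<Rightarrow> real" where
  "trace_on V E =
     (let b = (SOME b. independent b \<and> span b = V) in \<Sum>x\<in>b. representation b (E x) x)"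

text \<open>\<open>Q\<^sup>\<eta>(X,Y) = tr(\<sigma> \<mapsto> \<eta>(X) d\<^sub>Y\<sigma>)\<close>. When \<open>\<eta>\<close> takes values in \<open>f \<and> f\<^sup>\<bottom>\<close>, it annihilates
  \<open>f\<close>, so the value at \<open>p\<close> depends on \<open>\<sigma>\<close> only through \<open>\<sigma> p = x\<close>, and any extension of \<open>x\<close>
  to a section can be used.\<close>

definition quad ::
  "'a set \<Rightarrow> ('a::real_normed_vector \<Rightarrow> (real^'n) set) \<Rightarrow> ('a \<Rightarrow> 'a \<Rightarrow> real^'n^'n) \<Rightarrow> 'a \<Rightarrow> 'a \<Rightarrow> 'a \<Rightarrow> real" where
  "quad S f \<eta> p X Y =
     trace_on (f p) (\<lambda>x. \<eta> p X *v D (SOME \<sigma>. \<sigma> \<in> sections S f \<and> \<sigma> p = x) p Y)"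

text \<open>As a section, i.e. not identically zero.\<close>

definition quad_nonzero ::
  "'a set \<Rightarrow> ('a::real_normed_vector \<Rightarrow> (real^'n) set) \<Rightarrow> ('a \<Rightarrow> 'a \<Rightarrow> real^'n^'n) \<Rightarrow> bool" where
  "quad_nonzero S f \<eta> \<longleftrightarrow> (\<exists>p\<in>S. \<exists>X Y. quad S f \<eta> p X Y \<noteq> 0)"

section \<open>Lie sphere geometry\<close>

definition has_signature :: "('b::euclidean_space \<Rightarrow> 'b \<Rightarrow> real) \<Rightarrow> nat \<Rightarrow> nat \<Rightarrow> bool" where
  "has_signature B m n \<longleftrightarrow>
     bilinear B \<and> (\<forall>x y. B x y = B y x) \<and> DIM('b) = m + n \<and>
     (\<exists>P N. subspace P \<and> dim P = m \<and> subspace N \<and> dim N = n \<and>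
        (\<forall>x\<in>P. \<forall>y\<in>N. B x y = 0) \<and>
        (\<forall>x\<in>P. x \<noteq> 0 \<longrightarrow> B x x > 0) \<and> (\<forall>y\<in>N. y \<noteq> 0 \<longrightarrow> B y y < 0))"

text \<open>\<open>B\<close> is the form of signature \<open>(4,2)\<close>. The subspace \<open>E\<close> below is the ambient space: all of
  \<open>\<real>\<^sup>4\<^sup>,\<^sup>2\<close> for surfaces, and \<open>L\<^sub>0\<^sup>\<bottom>\<close> for curves.\<close>

context
  fixes B :: "real^6 \<Rightarrow> real^6 \<Rightarrow> real"
begin

definition perp_in :: "(real^6) set \<Rightarrow> (real^6) set \<Rightarrow> (real^6) set" where
  "perp_in E V = {x\<in>E. \<forall>y\<in>V. B x y = 0}"

abbreviation perp :: "(real^6) set \<Rightarrow> (real^6) set" where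
  "perp \<equiv> perp_in UNIV"

text \<open>Elements of \<open>\<and>\<^sup>2\<real>\<^sup>4\<^sup>,\<^sup>2\<close> are represented by the corresponding matrices in \<open>o(4,2)\<close>.\<close>

definition wedge :: "real^6 \<Rightarrow> real^6 \<Rightarrow> real^6^6" where
  "wedge a b = matrix (\<lambda>c. B a c *\<^sub>R b - B b c *\<^sub>R a)"

definition wedge_space :: "(real^6) set \<Rightarrow> (real^6) set \<Rightarrow> (real^6^6) set" where
  "wedge_space V W = span {wedge a b |a b. a \<in> V \<and> b \<in> W}"

definition spacelike :: "(real^6) set \<Rightarrow> bool" where
  "spacelike V \<longleftrightarrow> (\<forall>x\<in>V. x \<noteq> 0 \<longrightarrow> B x x > 0)"

definition totally_isotropic :: "(real^6) set \<Rightarrow> bool" where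
  "totally_isotropic V \<longleftrightarrow> (\<forall>x\<in>V. \<forall>y\<in>V. B x y = 0)"

definition legendre_map ::
  "(real^6) set \<Rightarrow> 'a set \<Rightarrow> ('a::real_normed_vector \<Rightarrow> (real^6) set) \<Rightarrow> bool" where
  "legendre_map E S f \<longleftrightarrow>
     subbundle 2 S f \<and>
     (\<forall>p\<in>S. f p \<subseteq> E \<and> totally_isotropic (f p) \<and> derived_bundle S f p \<subseteq> perp_in E (f p)) \<and>
     immersed S f"

definition spherical_leaves ::
  "'a set \<Rightarrow> ('a::real_normed_vector \<Rightarrow> (real^6) set) \<Rightarrow> ('a \<Rightarrow> 'a set) \<Rightarrow> bool" where
  "spherical_leaves S f T \<longleftrightarrow>
     (\<exists>M. subbundle 1 S M \<and> (\<forall>p\<in>S. spacelike (M p) \<and> M p \<subseteq> perp (f p)) \<and>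
          constant_along_leaves S T M)"

definition f_wedge_f_perp ::
  "(real^6) set \<Rightarrow> ('a \<Rightarrow> (real^6) set) \<Rightarrow> 'a \<Rightarrow> (real^6^6) set" where
  "f_wedge_f_perp E f p = wedge_space (f p) (perp_in E (f p))"

definition lie_applicable ::
  "'a set \<Rightarrow> ('a::real_normed_vector \<Rightarrow> (real^6) set) \<Rightarrow> bool" where
  "lie_applicable S f \<longleftrightarrow>
     (\<exists>\<eta>\<in>one_forms S (f_wedge_f_perp UNIV f).
        (\<forall>p\<in>S. \<forall>X Y. ext_deriv \<eta> p X Y = 0 \<and> bracket_wedge \<eta> \<eta> p X Y = 0) \<and>
        quad_nonzero S f \<eta>)"

subsection \<open>Spherical evolution maps\<close>

definition spacelike_line_map :: "real set \<Rightarrow> (real \<Rightarrow> (real^6) set) \<Rightarrow> bool" where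
  "spacelike_line_map I L \<longleftrightarrow> subbundle 1 I L \<and> (\<forall>v\<in>I. spacelike (L v))"

text \<open>Orthogonal projection onto a subspace \<open>V\<close> on which \<open>B\<close> is non-degenerate.\<close>

definition proj :: "(real^6) set \<Rightarrow> real^6 \<Rightarrow> real^6" where
  "proj V x = (THE y. y \<in> V \<and> x - y \<in> perp V)"

text \<open>\<open>\<D>\<^sup>L\<close> (in direction \<open>\<partial>\<^sub>v\<close>): the sum of the connections induced by \<open>d\<close> on \<open>L\<close> and \<open>L\<^sup>\<bottom>\<close>.\<close>

definition split_connection ::
  "(real \<Rightarrow> (real^6) set) \<Rightarrow> (real \<Rightarrow> real^6) \<Rightarrow> real \<Rightarrow> real^6" where
  "split_connection L \<sigma> v =
     proj (L v) (vector_derivative (\<lambda>w. proj (L w) (\<sigma> w)) (at v)) +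
     proj (perp (L v)) (vector_derivative (\<lambda>w. proj (perp (L w)) (\<sigma> w)) (at v))"

definition orthogonal_group :: "(real^6^6) set" where
  "orthogonal_group = {M. \<forall>x y. B (M *v x) (M *v y) = B x y}"

definition spherical_evolution_map ::
  "real set \<Rightarrow> (real \<Rightarrow> (real^6) set) \<Rightarrow> real \<Rightarrow> (real \<Rightarrow> real^6^6) \<Rightarrow> bool" where
  "spherical_evolution_map I L v0 A \<longleftrightarrow>
     smooth_on I A \<and> (\<forall>v\<in>I. A v \<in> orthogonal_group) \<and> A v0 = mat 1 \<and>
     (\<forall>\<sigma>. smooth_on I \<sigma> \<longrightarrow>
        (\<forall>v\<in>I. A v *v split_connection L (\<lambda>w. matrix_inv (A w) *v \<sigma> w) v
                = vector_derivative \<sigma> (at v)))"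

subsection \<open>Constrained elastic curves\<close>

definition gauge_orbit ::
  "real set \<Rightarrow> (real \<Rightarrow> (real^6) set) \<Rightarrow> (real \<Rightarrow> real \<Rightarrow> real^6^6) \<Rightarrow> (real \<Rightarrow> real \<Rightarrow> real^6^6) set" where
  "gauge_orbit I C \<xi> =
     {\<xi>'. \<exists>\<tau>\<in>sections I (\<lambda>u. wedge_space (C u) (C u)). \<forall>u\<in>I. \<forall>X. \<xi>' u X = \<xi> u X - D \<tau> u X}"

definition polarisation ::
  "(real^6) set \<Rightarrow> real set \<Rightarrow> (real \<Rightarrow> (real^6) set) \<Rightarrow> (real \<Rightarrow> real \<Rightarrow> real^6^6) set \<Rightarrow> bool" where
  "polarisation E I C P \<longleftrightarrow>
     (\<exists>\<xi>\<in>one_forms I (f_wedge_f_perp E C). quad_nonzero I C \<xi> \<and> P = gauge_orbit I C \<xi>)"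

text \<open>\<open>p(t) = p0 + t p1\<close> is a linear conserved quantity of \<open>d + t\<xi>\<close>.\<close>

definition linear_conserved_quantity ::
  "(real^6) set \<Rightarrow> real set \<Rightarrow> (real \<Rightarrow> (real^6) set) \<Rightarrow> (real \<Rightarrow> real \<Rightarrow> real^6^6) \<Rightarrow>
   (real \<Rightarrow> real^6) \<Rightarrow> (real \<Rightarrow> real^6) \<Rightarrow> bool" where
  "linear_conserved_quantity E I C \<xi> p0 p1 \<longleftrightarrow>
     p0 \<in> sections I (\<lambda>_. E) \<and> p1 \<in> sections I C \<and>
     (\<forall>t. \<forall>u\<in>I. \<forall>X. D (\<lambda>w. p0 w + t *\<^sub>R p1 w) u X +
                       t *\<^sub>R (\<xi> u X *v (p0 u + t *\<^sub>R p1 u)) = 0)"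

text \<open>The 3-dimensional space \<open>W\<close> of linear conserved quantities is given by a basis
  \<open>p0 i + t p1 i\<close>, \<open>i < 3\<close>, independent as polynomials in \<open>t\<close> with coefficients functions on \<open>I\<close>;
  \<open>W(0)\<close> is spanned by the (automatically constant) sections \<open>p0 i\<close>.\<close>

definition constrained_elastic ::
  "(real^6) set \<Rightarrow> real set \<Rightarrow> (real \<Rightarrow> (real^6) set) \<Rightarrow> (real^6) set \<Rightarrow> bool" where
  "constrained_elastic E I C W0 \<longleftrightarrow>
     subspace W0 \<and> dim W0 = 3 \<and> W0 \<subseteq> E \<and>
     (\<exists>P \<xi>. polarisation E I C P \<and> \<xi> \<in> P \<and>
        (\<exists>p0 p1 :: nat \<Rightarrow> real \<Rightarrow> real^6.
           (\<forall>i<3. linear_conserved_quantity E I C \<xi> (p0 i) (p1 i)) \<and>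
           (\<forall>a :: nat \<Rightarrow> real.
              (\<forall>u\<in>I. (\<Sum>i<3. a i *\<^sub>R p0 i u) = 0 \<and> (\<Sum>i<3. a i *\<^sub>R p1 i u) = 0) \<longrightarrow>
              (\<forall>i<3. a i = 0)) \<and>
           (\<forall>u\<in>I. {\<Sum>i<3. a i *\<^sub>R p0 i u |a :: nat \<Rightarrow> real. True} = W0)))"

end

end

theory Submission
  imports Defs
begin

text \<open>
  Write \<open>\<Psi> = A\<^sup>-\<^sup>1\<close>, let \<open>l = \<Psi> l0\<close> be the unit section of \<open>L\<close> through a unit vector \<open>l0\<close> of \<open>L\<^sub>0\<close>,
  and put \<open>m = A l'\<close>, a curve in \<open>L\<^sub>0\<^sup>\<bottom>\<close>. The evolution equation becomes \<open>\<Psi>' = \<Psi> (l0 \<and> m)\<close>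
  (\<open>Psi_derivative\<close>), so for \<open>\<sigma>(u) \<in> C(u)\<close> the section \<open>\<Psi> \<sigma>\<close> of \<open>f = \<Psi> C\<close> has \<open>v\<close>-derivative
  \<open>- (m, \<sigma>) l\<close>. Hence \<open>s2 = \<Psi> (C \<inter> m\<^sup>\<bottom>)\<close>, while \<open>s1 = \<Psi> s\<close> with \<open>s\<close> the curvature sphere of \<open>C\<close>.
  Since \<open>s2\<close> is immersed, \<open>e1 = m(v0)\<close> and \<open>e2 = m'(v0)\<close> restrict to a basis of the dual of every
  \<open>C(u)\<close>. The dual basis is a global frame \<open>\<epsilon>1, \<epsilon>2\<close> of \<open>C\<close>, with \<open>\<epsilon>2' = \<nu>\<close> spacelike,
  \<open>\<epsilon>1' = h \<nu>\<close>, and \<open>h' \<noteq> 0\<close> because \<open>s1\<close> is immersed. Everything is computed in the basis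
  \<open>l0, e1, e2, \<epsilon>1, \<epsilon>2, \<nu>\<close>.

  \<^item> The second family is spherical iff all \<open>m(v)\<close> are orthogonal to all \<open>\<nu>(u)\<close>
    (\<open>spherical_T2_iff\<close>), and \<open>L\<close> lies in \<open>L\<^sub>0 \<oplus> W\<close> iff all \<open>m(v)\<close> lie in \<open>W\<close> (\<open>L_in_sum_iff\<close>).

  \<^item> Let \<open>\<xi>\<close> be a form along \<open>C\<close> with values in \<open>C \<and> C\<^sup>\<bottom>\<close> and let \<open>c(u, v) \<in> C(u)\<close> solve
    \<open>c\<^sub>u = - \<xi> m(v)\<close>, which says that \<open>m(v) + t c(u, v)\<close> is a linear conserved quantity of
    \<open>d + t \<xi>\<close> for each \<open>v\<close>. Then \<open>\<Psi> (\<xi> du + (l0 \<and> c) dv) A\<close> is a closed form, and it makes \<open>f\<close> Lie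
    applicable if \<open>\<Q>\<^sup>\<xi> \<noteq> 0\<close> (\<open>lie_applicable_of_curve_form\<close>). If the second family is spherical, take
    \<open>\<xi> = \<epsilon>2 \<and> \<nu>\<close> and \<open>c = - (m, \<epsilon>2) \<epsilon>2\<close>. If \<open>C\<close> is constrained elastic with respect to \<open>W\<close> and
    all \<open>m(v) \<in> W\<close>, then \<open>c\<close> is the corresponding combination of the given conserved quantities, after
    undoing the gauge.

  \<^item> Conversely, closedness forces every form with values in \<open>f \<and> f\<^sup>\<bottom>\<close> to have this shape after a gauge
    transformation (locale \<open>closed_form\<close>). Eliminating \<open>c\<close> gives a curve \<open>w(u)\<close> orthogonal to all
    \<open>m(v)\<close>, and \<open>w\<close> does not stay in a line (\<open>dim_m_le_3\<close>), so the span \<open>U\<close> of all \<open>m(v)\<close> has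
    dimension at most 3. If the dimension is 2 then \<open>U = \<langle>e1, e2\<rangle>\<close> is orthogonal to \<open>\<nu>\<close> and the second
    family is spherical; if it is 3 then \<open>C\<close> is constrained elastic with respect to \<open>U\<close>.
\<close>

section \<open>Calculus of smooth maps\<close>

lemma Ck_on_cong:
  assumes "open S" "\<And>x. x \<in> S \<Longrightarrow> f x = g x"
  shows "Ck_on k S f \<longleftrightarrow> Ck_on k S g"
proof -
  have "Ck_on k S g" if "Ck_on k S f" "\<And>x. x \<in> S \<Longrightarrow> f x = g x" for f g :: "'a \<Rightarrow> 'b"
    using that
  proof (induction k arbitrary: f g)
    case 0
    then show ?case by (auto cong: continuous_on_cong)
  next
    case (Suc k)
    have D: "(g has_derivative frechet_derivative f (at x)) (at x)" if "x \<in> S" for x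
    proof (rule has_derivative_transform_within_open[OF _ assms(1) that])
      show "(f has_derivative frechet_derivative f (at x)) (at x)"
        using Suc.prems(1) that by (simp add: frechet_derivative_works)
    qed (use Suc.prems in auto)
    have "D f x X = D g x X" if "x \<in> S" for x X
      using frechet_derivative_at[OF D[OF that]] by simp
    then have "Ck_on k S (\<lambda>x. D g x X)" for X
      using Suc.IH[of "\<lambda>x. D f x X" "\<lambda>x. D g x X"] Suc.prems by simp
    then show ?case
      using D unfolding Ck_on.simps differentiable_def by blast
  qed
  then show ?thesis using assms(2) by metis
qed

lemma smooth_on_cong:
  assumes "open S" "\<And>x. x \<in> S \<Longrightarrow> f x = g x"
  shows "smooth_on S f \<longleftrightarrow> smooth_on S g"
  unfolding smooth_on_def using Ck_on_cong[OF assms(1), of f g] assms(2) by simp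

lemma Ck_on_Suc_imp: "Ck_on (Suc k) S f \<Longrightarrow> Ck_on k S f"
proof (induction k arbitrary: f)
  case 0
  then show ?case
    by (auto intro!: continuous_at_imp_continuous_on differentiable_imp_continuous_within)
next
  case (Suc k)
  then show ?case by auto
qed

lemma Ck_on_subset: "Ck_on k S f \<Longrightarrow> T \<subseteq> S \<Longrightarrow> Ck_on k T f"
  by (induction k arbitrary: f) (auto intro: continuous_on_subset)

lemma smooth_on_subset: "smooth_on S f \<Longrightarrow> T \<subseteq> S \<Longrightarrow> smooth_on T f"
  unfolding smooth_on_def using Ck_on_subset by blast

lemma smooth_on_local:
  assumes "\<And>p. p \<in> S \<Longrightarrow> \<exists>U. open U \<and> p \<in> U \<and> smooth_on U f"
  shows "smooth_on S f"
proof -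
  have "Ck_on k S f" if "\<And>p. p \<in> S \<Longrightarrow> \<exists>U. open U \<and> p \<in> U \<and> Ck_on k U f" for k and f :: "'a \<Rightarrow> 'b"
    using that
  proof (induction k arbitrary: f)
    case 0
    then show ?case
      by (metis Ck_on.simps(1) continuous_at_imp_continuous_on continuous_on_eq_continuous_at)
  next
    case (Suc k)
    have "Ck_on k S (\<lambda>x. D f x X)" for X
      by (rule Suc.IH) (use Suc.prems in fastforce)
    then show ?case using Suc.prems by fastforce
  qed
  then show ?thesis using assms unfolding smooth_on_def by meson
qed

lemma smooth_on_imp_has_derivative:
  "smooth_on S f \<Longrightarrow> x \<in> S \<Longrightarrow> (f has_derivative (\<lambda>X. D f x X)) (at x)"
  unfolding smooth_on_def by (metis Ck_on.simps(2) frechet_derivative_works)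

lemma smooth_on_D: "smooth_on S f \<Longrightarrow> smooth_on S (\<lambda>x. D f x X)"
  unfolding smooth_on_def by (metis Ck_on.simps(2))

lemma smooth_on_imp_continuous_on: "smooth_on S f \<Longrightarrow> continuous_on S f"
  unfolding smooth_on_def by (metis Ck_on.simps(1))

lemma D_eq: "(f has_derivative f') (at x) \<Longrightarrow> D f x X = f' X"
  using frechet_derivative_at by metis

lemma Ck_on_const: "Ck_on k S (\<lambda>_. c)"
proof (induction k arbitrary: c)
  case (Suc k)
  show ?case using Suc[of 0] by simp
qed simp

lemma smooth_on_const [simp, intro]: "smooth_on S (\<lambda>_. c)"
  unfolding smooth_on_def using Ck_on_const by blast

lemma Ck_on_linear:
  assumes "bounded_linear f" shows "Ck_on k S f"
proof (cases k)
  case 0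
  then show ?thesis using linear_continuous_on[OF assms] by simp
next
  case (Suc j)
  have "(\<lambda>x. D f x X) = (\<lambda>_. f X)" for X
    using D_eq[OF bounded_linear_imp_has_derivative[OF assms]] by auto
  then show ?thesis using Suc Ck_on_const bounded_linear_imp_differentiable[OF assms] by auto
qed

lemma smooth_on_linear: "bounded_linear f \<Longrightarrow> smooth_on S f"
  unfolding smooth_on_def using Ck_on_linear by blast

lemma Ck_on_add:
  assumes "open S" "Ck_on k S f" "Ck_on k S g"
  shows "Ck_on k S (\<lambda>x. f x + g x)"
  using assms(2,3)
proof (induction k arbitrary: f g)
  case (Suc k)
  have D: "((\<lambda>x. f x + g x) has_derivative (\<lambda>X. D f x X + D g x X)) (at x)" if "x \<in> S" for x
    using Suc.prems that by (auto intro!: derivative_intros simp: frechet_derivative_works)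
  have "Ck_on k S (\<lambda>x. D (\<lambda>x. f x + g x) x X)" for X
    using Suc.IH[of "\<lambda>x. D f x X" "\<lambda>x. D g x X"] Suc.prems D_eq[OF D]
      Ck_on_cong[OF assms(1), of "\<lambda>x. D (\<lambda>x. f x + g x) x X"] by auto
  then show ?case using D by (auto simp: differentiable_def)
qed (auto intro: continuous_on_add)

lemma Ck_on_bilinear:
  assumes "bounded_bilinear b" "open S" "Ck_on k S f" "Ck_on k S g"
  shows "Ck_on k S (\<lambda>x. b (f x) (g x))"
  using assms(3,4)
proof (induction k arbitrary: f g)
  case 0
  then show ?case using bounded_bilinear.continuous_on[OF assms(1)] by auto
next
  case (Suc k)
  have D: "((\<lambda>x. b (f x) (g x)) has_derivative (\<lambda>X. b (f x) (D g x X) + b (D f x X) (g x))) (at x)"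
    if "x \<in> S" for x
    using Suc.prems that
    by (auto intro!: bounded_bilinear.FDERIV[OF assms(1)] simp: frechet_derivative_works)
  have "Ck_on k S (\<lambda>x. b (f x) (D g x X) + b (D f x X) (g x))" for X
    using Suc.prems Ck_on_Suc_imp[OF Suc.prems(1)] Ck_on_Suc_imp[OF Suc.prems(2)]
    by (intro Ck_on_add[OF assms(2)] Suc.IH) auto
  then have "Ck_on k S (\<lambda>x. D (\<lambda>x. b (f x) (g x)) x X)" for X
    using D_eq[OF D] Ck_on_cong[OF assms(2), of "\<lambda>x. D (\<lambda>x. b (f x) (g x)) x X"] by auto
  then show ?case using D by (auto simp: differentiable_def)
qed

lemma Ck_on_sum:
  assumes "open S" "finite I" "\<And>i. i \<in> I \<Longrightarrow> Ck_on k S (f i)"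
  shows "Ck_on k S (\<lambda>x. \<Sum>i\<in>I. f i x)"
  using assms(2,3)
  by (induction I rule: finite_induct) (auto intro!: Ck_on_add assms(1) Ck_on_const)

lemma Ck_on_compose:
  fixes f :: "'a::real_normed_vector \<Rightarrow> 'b::euclidean_space"
  assumes "open S" "Ck_on k S f" "Ck_on k T g" "f ` S \<subseteq> T"
  shows "Ck_on k S (\<lambda>x. g (f x))"
  using assms(2,3)
proof (induction k arbitrary: g)
  case 0
  then show ?case using assms(4) by (auto intro: continuous_on_compose2)
next
  case (Suc k)
  have D: "((\<lambda>x. g (f x)) has_derivative (\<lambda>X. D g (f x) (D f x X))) (at x)" if "x \<in> S" for x
    using has_derivative_compose[of f "\<lambda>X. D f x X" x UNIV g "\<lambda>X. D g (f x) X"]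
      Suc.prems that assms(4) by (auto simp: frechet_derivative_works)
  have sum: "D g (f x) (D f x X) = (\<Sum>b\<in>Basis. (D f x X \<bullet> b) *\<^sub>R D g (f x) b)"
    if "x \<in> S" for x X
  proof -
    have "linear (\<lambda>X. D g (f x) X)"
      using Suc.prems that assms(4) by (auto intro!: linear_frechet_derivative)
    then show ?thesis
      by (subst euclidean_representation[symmetric]) (simp add: linear_sum linear_cmul)
  qed
  have "Ck_on k S (\<lambda>x. \<Sum>b\<in>Basis. (D f x X \<bullet> b) *\<^sub>R D g (f x) b)" for X
  proof (intro Ck_on_sum Ck_on_bilinear[OF bounded_bilinear_scaleR] assms(1)
      Ck_on_bilinear[OF bounded_bilinear_inner] Ck_on_const)
    show "Ck_on k S (\<lambda>x. D f x X)" using Suc.prems(1) by simp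
    show "Ck_on k S (\<lambda>x. D g (f x) b)" for b
      using Suc.IH[of "\<lambda>y. D g y b"] Suc.prems Ck_on_Suc_imp[OF Suc.prems(1)] by simp
  qed simp
  then have "Ck_on k S (\<lambda>x. D (\<lambda>x. g (f x)) x X)" for X
    using D_eq[OF D] sum Ck_on_cong[OF assms(1), of "\<lambda>x. D (\<lambda>x. g (f x)) x X"] by auto
  then show ?case using D by (auto simp: differentiable_def)
qed

lemma smooth_on_add:
  "open S \<Longrightarrow> smooth_on S f \<Longrightarrow> smooth_on S g \<Longrightarrow> smooth_on S (\<lambda>x. f x + g x)"
  unfolding smooth_on_def using Ck_on_add by blast

lemma smooth_on_bilinear:
  "bounded_bilinear b \<Longrightarrow> open S \<Longrightarrow> smooth_on S f \<Longrightarrow> smooth_on S g \<Longrightarrow>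
    smooth_on S (\<lambda>x. b (f x) (g x))"
  unfolding smooth_on_def using Ck_on_bilinear by blast

lemma smooth_on_sum:
  "open S \<Longrightarrow> finite I \<Longrightarrow> (\<And>i. i \<in> I \<Longrightarrow> smooth_on S (f i)) \<Longrightarrow> smooth_on S (\<lambda>x. \<Sum>i\<in>I. f i x)"
  unfolding smooth_on_def using Ck_on_sum by blast

lemma smooth_on_compose:
  fixes f :: "'a::real_normed_vector \<Rightarrow> 'b::euclidean_space"
  shows "open S \<Longrightarrow> smooth_on T g \<Longrightarrow> smooth_on S f \<Longrightarrow> f ` S \<subseteq> T \<Longrightarrow> smooth_on S (\<lambda>x. g (f x))"
  unfolding smooth_on_def using Ck_on_compose by blast

lemma smooth_on_linear_compose:
  assumes "bounded_linear h" "open S" "smooth_on S f"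
  shows "smooth_on S (\<lambda>x. h (f x))"
proof -
  have "Ck_on k S (\<lambda>x. h (f x))" if "Ck_on k S f" for k f
    using that
  proof (induction k arbitrary: f)
    case 0
    then show ?case using bounded_linear.continuous_on[OF assms(1)] by auto
  next
    case (Suc k)
    have D: "((\<lambda>x. h (f x)) has_derivative (\<lambda>X. h (D f x X))) (at x)" if "x \<in> S" for x
      using Suc.prems that
      by (auto intro!: bounded_linear.has_derivative[OF assms(1)] simp: frechet_derivative_works)
    have "Ck_on k S (\<lambda>x. D (\<lambda>x. h (f x)) x X)" for X
      using Suc.IH[of "\<lambda>x. D f x X"] Suc.prems D_eq[OF D]
        Ck_on_cong[OF assms(2), of "\<lambda>x. D (\<lambda>x. h (f x)) x X"] by auto
    then show ?case using D by (auto simp: differentiable_def)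
  qed
  then show ?thesis using assms(3) unfolding smooth_on_def by blast
qed

lemma smooth_on_scaleR:
  "open S \<Longrightarrow> smooth_on S f \<Longrightarrow> smooth_on S g \<Longrightarrow> smooth_on S (\<lambda>x. f x *\<^sub>R g x)"
  using smooth_on_bilinear[OF bounded_bilinear_scaleR] .

lemma smooth_on_mult:
  "open S \<Longrightarrow> smooth_on S f \<Longrightarrow> smooth_on S g \<Longrightarrow> smooth_on S (\<lambda>x. f x * g x :: real)"
  using smooth_on_bilinear[OF bounded_bilinear_mult] .

lemma smooth_on_minus:
  "open S \<Longrightarrow> smooth_on S f \<Longrightarrow> smooth_on S (\<lambda>x. - f x)"
  using smooth_on_linear_compose[OF bounded_linear_minus[OF bounded_linear_ident]] .

lemma smooth_on_diff:
  "open S \<Longrightarrow> smooth_on S f \<Longrightarrow> smooth_on S g \<Longrightarrow> smooth_on S (\<lambda>x. f x - g x)"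
  using smooth_on_add[of S f "\<lambda>x. - g x"] smooth_on_minus by auto

lemma smooth_on_inverse:
  fixes f :: "'a::real_normed_vector \<Rightarrow> real"
  assumes "open S" "smooth_on S f" "\<And>x. x \<in> S \<Longrightarrow> f x \<noteq> 0"
  shows "smooth_on S (\<lambda>x. inverse (f x))"
proof -
  have "Ck_on k S (\<lambda>x. inverse (f x))" for k
  proof (induction k)
    case 0
    then show ?case using smooth_on_imp_continuous_on[OF assms(2)] assms(3)
      by (auto intro: continuous_on_inverse)
  next
    case (Suc k)
    have D: "((\<lambda>x. inverse (f x)) has_derivative (\<lambda>X. - (inverse (f x) * D f x X * inverse (f x)))) (at x)"
      if "x \<in> S" for x
      using Deriv.has_derivative_inverse[OF assms(3)[OF that] smooth_on_imp_has_derivative[OF assms(2) that]] .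
    have "Ck_on k S (\<lambda>x. D f x X)" for X
      using assms(2) smooth_on_D unfolding smooth_on_def by blast
    then have "Ck_on k S (\<lambda>x. (-1) * (inverse (f x) * D f x X * inverse (f x)))" for X
      by (intro Ck_on_bilinear[OF bounded_bilinear_mult assms(1)] Suc Ck_on_const)
    then have "Ck_on k S (\<lambda>x. D (\<lambda>x. inverse (f x)) x X)" for X
      using D_eq[OF D] Ck_on_cong[OF assms(1), of "\<lambda>x. D (\<lambda>x. inverse (f x)) x X"] by auto
    then show ?case using D by (auto simp: differentiable_def)
  qed
  then show ?thesis unfolding smooth_on_def by blast
qed

lemma smooth_on_divide:
  fixes f :: "'a::real_normed_vector \<Rightarrow> real"
  assumes "open S" "smooth_on S f" "smooth_on S g" "\<And>x. x \<in> S \<Longrightarrow> g x \<noteq> 0"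
  shows "smooth_on S (\<lambda>x. f x / g x)"
  unfolding divide_inverse using assms by (intro smooth_on_mult smooth_on_inverse)

lemma D_cong:
  assumes "open S" "p \<in> S" "\<And>q. q \<in> S \<Longrightarrow> f q = g q" "f differentiable (at p)"
  shows "D f p X = D g p X"
  using frechet_derivative_transform_within_open[OF assms(4,1,2,3)] by simp

section \<open>Curves and partial derivatives\<close>

lemma open_interval_imp:
  assumes "open_interval I"
  shows "open I" "convex I" "connected I" "I \<noteq> {}"
  using assms is_interval_convex is_interval_connected by (auto simp: open_interval_def)

lemma smooth_on_curve_derivative:
  fixes g :: "real \<Rightarrow> 'b::real_normed_vector"
  assumes "smooth_on I g" "t \<in> I"
  shows "(g has_vector_derivative D g t 1) (at t)"
proof -
  have "D g t X = X *\<^sub>R D g t 1" for X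
    using linear_cmul[OF has_derivative_linear[OF smooth_on_imp_has_derivative[OF assms]], of X 1]
    by simp
  then show ?thesis
    unfolding has_vector_derivative_def
    by (intro has_derivative_eq_rhs[OF smooth_on_imp_has_derivative[OF assms]]) blast
qed

lemmas scaleR_has_vector_derivative = bounded_bilinear.has_vector_derivative[OF bounded_bilinear_scaleR]
  and scaleR_right_has_vector_derivative = bounded_linear.has_vector_derivative[OF bounded_linear_scaleR_right]

lemma derivative_zero_if_constant:
  assumes "(a has_vector_derivative a') (at t)" "open I" "t \<in> I" "\<And>s. s \<in> I \<Longrightarrow> a s = k"
  shows "a' = 0"
proof -
  have "((\<lambda>_. k) has_vector_derivative a') (at t)"
    by (rule has_vector_derivative_transform_within_open[OF assms])
  then show ?thesis using vector_derivative_unique_at has_vector_derivative_const by blast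
qed

lemma D_curve:
  fixes g :: "real \<Rightarrow> 'b::real_normed_vector"
  assumes "(g has_vector_derivative g') (at t)"
  shows "D g t X = X *\<^sub>R g'"
  using D_eq assms unfolding has_vector_derivative_def by blast

lemma smooth_on_slices:
  fixes F :: "real \<times> real \<Rightarrow> 'b::real_normed_vector"
  assumes "smooth_on (I \<times> J) F" "open I" "open J"
  shows "v \<in> J \<Longrightarrow> smooth_on I (\<lambda>u. F (u, v))" "u \<in> I \<Longrightarrow> smooth_on J (\<lambda>v. F (u, v))"
proof -
  have "smooth_on I (\<lambda>u. (u, 0::real) + (0, v))"
    by (intro smooth_on_add assms smooth_on_linear smooth_on_const
        bounded_linear_Pair bounded_linear_ident bounded_linear_zero)
  from smooth_on_compose[OF assms(2,1) this] show "smooth_on I (\<lambda>u. F (u, v))" if "v \<in> J"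
    using that by auto
  have "smooth_on J (\<lambda>v. (0::real, v) + (u, 0))"
    by (intro smooth_on_add assms smooth_on_linear smooth_on_const
        bounded_linear_Pair bounded_linear_ident bounded_linear_zero)
  from smooth_on_compose[OF assms(3,1) this] show "smooth_on J (\<lambda>v. F (u, v))" if "u \<in> I"
    using that by auto
qed

lemma smooth_on_fst:
  fixes g :: "real \<Rightarrow> 'b::real_normed_vector"
  assumes "smooth_on I g" "open I" "open J"
  shows "smooth_on (I \<times> J) (\<lambda>p. g (fst p))"
  using smooth_on_compose[OF open_Times[OF assms(2,3)] assms(1) smooth_on_linear[OF bounded_linear_fst]]
  by auto

lemma smooth_on_snd:
  fixes g :: "real \<Rightarrow> 'b::real_normed_vector"
  assumes "smooth_on J g" "open I" "open J"
  shows "smooth_on (I \<times> J) (\<lambda>p. g (snd p))"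
  using smooth_on_compose[OF open_Times[OF assms(2,3)] assms(1) smooth_on_linear[OF bounded_linear_snd]]
  by auto

lemma D_plane:
  fixes F :: "real \<times> real \<Rightarrow> 'b::real_normed_vector"
  assumes "smooth_on S F" "p \<in> S"
  shows "D F p X = fst X *\<^sub>R D F p (1, 0) + snd X *\<^sub>R D F p (0, 1)"
proof -
  have lin: "linear (\<lambda>X. D F p X)"
    using has_derivative_linear[OF smooth_on_imp_has_derivative[OF assms]] .
  have "X = fst X *\<^sub>R (1, 0) + snd X *\<^sub>R (0, 1)" by (simp add: prod_eq_iff)
  then have "D F p X = D F p (fst X *\<^sub>R (1, 0) + snd X *\<^sub>R (0, 1))" by (rule arg_cong)
  also have "\<dots> = fst X *\<^sub>R D F p (1, 0) + snd X *\<^sub>R D F p (0, 1)"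
    by (rule trans[OF linear_add[OF lin]]) (intro arg_cong2[where f = "(+)"] linear_cmul[OF lin])
  finally show ?thesis .
qed

lemma partial_derivatives:
  fixes F :: "real \<times> real \<Rightarrow> 'b::real_normed_vector"
  assumes "smooth_on S F" "(u, v) \<in> S"
  shows "((\<lambda>u. F (u, v)) has_vector_derivative D F (u, v) (1, 0)) (at u)"
    and "((\<lambda>v. F (u, v)) has_vector_derivative D F (u, v) (0, 1)) (at v)"
proof -
  note F = smooth_on_imp_has_derivative[OF assms]
  have lin: "linear (\<lambda>X. D F (u, v) X)" using has_derivative_linear[OF F] .
  have "((\<lambda>u. (u, v)) has_derivative (\<lambda>X. (X, 0))) (at u)"
    by (auto intro!: derivative_eq_intros)
  note has_derivative_compose[OF this F]
  then show "((\<lambda>u. F (u, v)) has_vector_derivative D F (u, v) (1, 0)) (at u)"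
    unfolding has_vector_derivative_def
    by (elim has_derivative_eq_rhs, intro ext)
      (rule linear_cmul[OF lin, of _ "(1, 0)", unfolded scaleR_Pair real_scaleR_def mult_1_right mult_zero_right])
  have "((\<lambda>v. (u, v)) has_derivative (\<lambda>X. (0, X))) (at v)"
    by (auto intro!: derivative_eq_intros)
  note has_derivative_compose[OF this F]
  then show "((\<lambda>v. F (u, v)) has_vector_derivative D F (u, v) (0, 1)) (at v)"
    unfolding has_vector_derivative_def
    by (elim has_derivative_eq_rhs, intro ext)
      (rule linear_cmul[OF lin, of _ "(0, 1)", unfolded scaleR_Pair real_scaleR_def mult_1_right mult_zero_right])
qed

lemma derivative_in_subspace:
  fixes g :: "real \<Rightarrow> 'b::euclidean_space"
  assumes "subspace V" "open I" "t \<in> I" "\<And>s. s \<in> I \<Longrightarrow> g s \<in> V"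
    and "(g has_vector_derivative g') (at t)"
  shows "g' \<in> V"
proof -
  have "y \<bullet> g' = 0" if "y \<in> orthogonal_comp V" for y
  proof -
    have "((\<lambda>s. y \<bullet> g s) has_vector_derivative y \<bullet> g') (at t)"
      using assms(5) by (rule bounded_linear.has_vector_derivative[OF bounded_linear_inner_right])
    moreover have "y \<bullet> g s = 0" if "s \<in> I" for s
      using assms(4)[OF that] \<open>y \<in> orthogonal_comp V\<close>
      by (auto simp: orthogonal_comp_def orthogonal_def inner_commute)
    ultimately show ?thesis by (rule derivative_zero_if_constant[OF _ assms(2,3)])
  qed
  then have "g' \<in> orthogonal_comp (orthogonal_comp V)"
    by (auto simp: orthogonal_comp_def orthogonal_def)
  then show ?thesis using assms(1) by (simp add: orthogonal_comp_self)
qed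

lemma increment_in_subspace:
  fixes g :: "real \<Rightarrow> 'b::euclidean_space"
  assumes "subspace V" "convex I" "s \<in> I" "t \<in> I"
    and "\<And>t. t \<in> I \<Longrightarrow> (g has_vector_derivative g' t) (at t)" "\<And>t. t \<in> I \<Longrightarrow> g' t \<in> V"
  shows "g t - g s \<in> V"
proof -
  have "y \<bullet> g t = y \<bullet> g s" if "y \<in> orthogonal_comp V" for y
  proof -
    have "((\<lambda>s. y \<bullet> g s) has_vector_derivative 0) (at t within I)" if "t \<in> I" for t
    proof -
      have "y \<bullet> g' t = 0"
        using assms(6)[OF that] \<open>y \<in> orthogonal_comp V\<close>
        by (auto simp: orthogonal_comp_def orthogonal_def inner_commute)
      moreover have "((\<lambda>s. y \<bullet> g s) has_vector_derivative y \<bullet> g' t) (at t within I)"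
        using bounded_linear.has_vector_derivative[OF bounded_linear_inner_right]
          has_vector_derivative_at_within assms(5)[OF that] by blast
      ultimately show ?thesis by simp
    qed
    then obtain c where "\<And>t. t \<in> I \<Longrightarrow> y \<bullet> g t = c"
      using has_vector_derivative_zero_constant[OF assms(2)] by metis
    then show ?thesis using assms(3,4) by simp
  qed
  then have "g t - g s \<in> orthogonal_comp (orthogonal_comp V)"
    by (auto simp: orthogonal_comp_def orthogonal_def inner_diff_right)
  then show ?thesis using assms(1) by (simp add: orthogonal_comp_self)
qed

lemma zero_derivative_constant:
  fixes g :: "real \<Rightarrow> 'b::euclidean_space"
  assumes "convex I" "s \<in> I" "t \<in> I" "\<And>t. t \<in> I \<Longrightarrow> (g has_vector_derivative 0) (at t)"
  shows "g t = g s"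
  using increment_in_subspace[of "{0}" I s t g "\<lambda>_. 0"] assms by simp

text \<open>If \<open>b\<^sub>v = a\<close> and \<open>a\<^sub>u = \<alpha>\<^sub>v\<close> then \<open>\<alpha> - b\<^sub>u\<close> does not depend on \<open>v\<close>: differentiate
  \<open>b(u, v) - b(u, w) = \<integral>\<^sub>w\<^sup>v a(u, s) ds\<close> under the integral sign.\<close>

lemma cross_derivative_constant:
  fixes a b \<alpha> :: "real \<times> real \<Rightarrow> real"
  assumes I: "open_interval I" and J: "open_interval J"
    and sm: "smooth_on (I \<times> J) a" "smooth_on (I \<times> J) b" "smooth_on (I \<times> J) \<alpha>"
    and b: "\<And>p. p \<in> I \<times> J \<Longrightarrow> D b p (0, 1) = a p"
    and \<alpha>: "\<And>p. p \<in> I \<times> J \<Longrightarrow> D \<alpha> p (0, 1) = D a p (1, 0)"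
    and uvw: "u \<in> I" "v \<in> J" "w \<in> J"
  shows "\<alpha> (u, v) - D b (u, v) (1, 0) = \<alpha> (u, w) - D b (u, w) (1, 0)"
proof -
  have main: "\<alpha> (u, v) - D b (u, v) (1, 0) = \<alpha> (u, w) - D b (u, w) (1, 0)"
    if "v \<in> J" "w \<in> J" "w \<le> v" for v w
  proof -
    note op = open_interval_imp[OF I] open_interval_imp[OF J]
    have seg: "{w..v} \<subseteq> J"
      using op(6) that unfolding convex_contains_segment by (fastforce simp: closed_segment_eq_real_ivl)
    have ftc: "integral {w..v} (\<lambda>s. a (x, s)) = b (x, v) - b (x, w)" if "x \<in> I" for x
    proof (rule integral_unique, rule fundamental_theorem_of_calculus[OF \<open>w \<le> v\<close>])
      fix s assume "s \<in> {w..v}"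
      then have "s \<in> J" using seg by blast
      then show "((\<lambda>s. b (x, s)) has_vector_derivative a (x, s)) (at s within {w..v})"
        using partial_derivatives(2)[OF sm(2), of x s] b[of "(x, s)"] seg that
        by (auto intro: has_vector_derivative_at_within)
    qed
    have "((\<lambda>x. integral (cbox w v) (\<lambda>s. a (x, s))) has_vector_derivative
        integral (cbox w v) (\<lambda>s. D a (u, s) (1, 0))) (at u within I)"
    proof (rule leibniz_rule_vector_derivative[where fx = "\<lambda>x s. D a (x, s) (1, 0)"])
      show "((\<lambda>x. a (x, s)) has_vector_derivative D a (x, s) (1, 0)) (at x within I)"
        if "x \<in> I" "s \<in> cbox w v" for x s
        using partial_derivatives(1)[OF sm(1), of x s] that subsetD[OF seg, of s]
        by (auto intro: has_vector_derivative_at_within)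
      show "(\<lambda>s. a (x, s)) integrable_on cbox w v" if "x \<in> I" for x
        using continuous_on_subset[OF smooth_on_imp_continuous_on[OF
            smooth_on_slices(2)[OF sm(1) op(1,5) that]] seg]
        by (simp add: integrable_continuous_real)
      show "continuous_on (I \<times> cbox w v) (\<lambda>(x, s). D a (x, s) (1, 0))"
        using continuous_on_subset[OF smooth_on_imp_continuous_on[OF smooth_on_D[OF sm(1)]],
            of "I \<times> cbox w v" "(1, 0)"] Sigma_mono[OF subset_refl[of I] seg]
        by (simp add: split_beta)
    qed (use uvw op in auto)
    moreover have "integral (cbox w v) (\<lambda>s. D a (u, s) (1, 0)) = \<alpha> (u, v) - \<alpha> (u, w)"
      unfolding cbox_interval
    proof (rule integral_unique, rule fundamental_theorem_of_calculus[OF \<open>w \<le> v\<close>])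
      fix s assume "s \<in> {w..v}"
      then have "s \<in> J" using seg by blast
      then show "((\<lambda>s. \<alpha> (u, s)) has_vector_derivative D a (u, s) (1, 0)) (at s within {w..v})"
        using partial_derivatives(2)[OF sm(3), of u s] \<alpha>[of "(u, s)"] seg uvw
        by (auto intro: has_vector_derivative_at_within)
    qed
    ultimately have "((\<lambda>x. integral {w..v} (\<lambda>s. a (x, s))) has_vector_derivative
        \<alpha> (u, v) - \<alpha> (u, w)) (at u)"
      unfolding cbox_interval at_within_open[OF uvw(1) op(1)] by (simp only:)
    then have "((\<lambda>x. b (x, v) - b (x, w)) has_vector_derivative \<alpha> (u, v) - \<alpha> (u, w)) (at u)"
      by (rule has_vector_derivative_transform_within_open[OF _ op(1) uvw(1)]) (rule ftc)
    moreover have "((\<lambda>x. b (x, v) - b (x, w)) has_vector_derivative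
        D b (u, v) (1, 0) - D b (u, w) (1, 0)) (at u)"
      using that uvw by (intro has_vector_derivative_diff partial_derivatives(1)[OF sm(2)]) auto
    ultimately have "\<alpha> (u, v) - \<alpha> (u, w) = D b (u, v) (1, 0) - D b (u, w) (1, 0)"
      using vector_derivative_unique_at by blast
    then show ?thesis by simp
  qed
  show ?thesis using main[of v w] main[of w v] uvw by (cases "w \<le> v") auto
qed

section \<open>Traces\<close>

lemma trace_on_eq_sum:
  assumes b: "independent b" "span b = V" and E: "E ` V \<subseteq> V"
    and lin: "\<And>x y. x \<in> V \<Longrightarrow> y \<in> V \<Longrightarrow> E (x + y) = E x + E y"
      "\<And>r x. x \<in> V \<Longrightarrow> E (r *\<^sub>R x) = r *\<^sub>R E x"
  shows "trace_on V E = (\<Sum>x\<in>b. representation b (E x) x)"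
proof -
  define b' where "b' = (SOME b. independent b \<and> span b = V)"
  have b': "independent b'" "span b' = V"
    using someI[of "\<lambda>b. independent b \<and> span b = V" b] b unfolding b'_def by auto
  have fin: "finite b" "finite b'" using b b' independent_imp_finite by auto
  have V: "subspace V" using b(2) subspace_span by metis
  have E_sum: "E (\<Sum>i\<in>I. r i *\<^sub>R g i) = (\<Sum>i\<in>I. r i *\<^sub>R E (g i))"
    if "finite I" "\<And>i. i \<in> I \<Longrightarrow> g i \<in> V" for I r and g :: "_ \<Rightarrow> 'a"
    using that
  proof (induction I rule: finite_induct)
    case empty
    then show ?case using lin(2)[OF subspace_0[OF V], of 0] by simp
  next
    case (insert i I)
    then show ?case
      by (simp add: lin V subspace_scale subspace_sum)
  qed
  have rep_sum: "representation B' (\<Sum>i\<in>I. r i *\<^sub>R g i) z = (\<Sum>i\<in>I. r i * representation B' (g i) z)"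
    if "independent B'" "finite I" "\<And>i. i \<in> I \<Longrightarrow> g i \<in> span B'"
    for B' I r z and g :: "_ \<Rightarrow> 'a"
    using that by (simp add: real_vector.representation_sum real_vector.representation_scale
        span_scale)
  have bV: "x \<in> V" if "x \<in> b" for x using that b(2) span_base by auto
  have b'V: "x \<in> V" if "x \<in> b'" for x using that b'(2) span_base by auto
  have "(\<Sum>x\<in>b. representation b (E x) x) =
      (\<Sum>x\<in>b. \<Sum>y\<in>b'. representation b' (E x) y * representation b y x)"
  proof (rule sum.cong[OF refl])
    fix x assume x: "x \<in> b"
    have "E x = (\<Sum>y\<in>b'. representation b' (E x) y *\<^sub>R y)"
      using real_vector.sum_representation_eq[OF b'(1) _ fin(2) subset_refl, of "E x"] b' E bV[OF x]
      by auto
    then have "representation b (E x) x = representation b (\<Sum>y\<in>b'. representation b' (E x) y *\<^sub>R y) x"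
      by simp
    then show "representation b (E x) x = (\<Sum>y\<in>b'. representation b' (E x) y * representation b y x)"
      by (subst (asm) rep_sum[OF b(1) fin(2)]) (use b b'V in auto)
  qed
  also have "\<dots> = (\<Sum>y\<in>b'. \<Sum>x\<in>b. representation b y x * representation b' (E x) y)"
    by (subst sum.swap) (simp add: mult.commute)
  also have "\<dots> = (\<Sum>y\<in>b'. representation b' (E y) y)"
  proof (rule sum.cong[OF refl])
    fix y assume y: "y \<in> b'"
    have "y = (\<Sum>x\<in>b. representation b y x *\<^sub>R x)"
      using real_vector.sum_representation_eq[OF b(1) _ fin(1) subset_refl, of y] b b'V[OF y] by auto
    then have "E y = (\<Sum>x\<in>b. representation b y x *\<^sub>R E x)"
      using E_sum[OF fin(1), of "\<lambda>x. x" "representation b y"] bV by simp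
    then have "representation b' (E y) y = representation b' (\<Sum>x\<in>b. representation b y x *\<^sub>R E x) y"
      by simp
    then show "(\<Sum>x\<in>b. representation b y x * representation b' (E x) y) = representation b' (E y) y"
      by (subst (asm) rep_sum[OF b'(1) fin(1)]) (use E bV b' in auto)
  qed
  finally show ?thesis unfolding trace_on_def Let_def b'_def[symmetric] by simp
qed

text \<open>Trace in terms of a basis \<open>a, b\<close> of a plane and its dual basis \<open>\<phi>, \<psi>\<close>.\<close>

lemma trace_on_plane:
  fixes a b :: "'b::euclidean_space"
  assumes V: "V = span {a, b}"
    and \<phi>: "linear \<phi>" "\<phi> a = 1" "\<phi> b = 0" and \<psi>: "linear \<psi>" "\<psi> a = 0" "\<psi> b = (1::real)"
    and E: "\<And>x. x \<in> V \<Longrightarrow> E x = \<phi> x *\<^sub>R p + \<psi> x *\<^sub>R q" "p \<in> V" "q \<in> V"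
  shows "trace_on V E = \<phi> p + \<psi> q"
proof -
  have ab: "a \<noteq> b" using \<phi> by auto
  have rep: "representation {a, b} x a = \<phi> x \<and> representation {a, b} x b = \<psi> x"
    and ind: "independent {a, b}" if "x \<in> V" for x
  proof -
    show ind: "independent {a, b}"
    proof (rule independent_if_scalars_zero)
      fix f x assume *: "(\<Sum>x\<in>{a, b}. f x *\<^sub>R x) = 0" "x \<in> {a, b}"
      then have "f a *\<^sub>R a + f b *\<^sub>R b = 0" using ab by simp
      then have "\<phi> (f a *\<^sub>R a + f b *\<^sub>R b) = 0 \<and> \<psi> (f a *\<^sub>R a + f b *\<^sub>R b) = 0"
        using linear_0[OF \<phi>(1)] linear_0[OF \<psi>(1)] by simp
      then show "f x = 0" using * \<phi> \<psi> by (auto simp: linear_add linear_cmul)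
    qed simp
    have "x = (\<Sum>y\<in>{a, b}. representation {a, b} x y *\<^sub>R y)"
      using real_vector.sum_representation_eq[OF ind, of x "{a, b}"] that V by auto
    then have "x = representation {a, b} x a *\<^sub>R a + representation {a, b} x b *\<^sub>R b"
      using ab by simp
    then have "\<phi> x = \<phi> (representation {a, b} x a *\<^sub>R a + representation {a, b} x b *\<^sub>R b)"
      "\<psi> x = \<psi> (representation {a, b} x a *\<^sub>R a + representation {a, b} x b *\<^sub>R b)" by auto
    then show "representation {a, b} x a = \<phi> x \<and> representation {a, b} x b = \<psi> x"
      using \<phi> \<psi> by (simp add: linear_add linear_cmul)
  qed
  have sub: "subspace V" using V by simp
  have aV: "a \<in> V" "b \<in> V" unfolding V by (auto intro: span_base)
  have "trace_on V E = (\<Sum>x\<in>{a, b}. representation {a, b} (E x) x)"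
  proof (rule trace_on_eq_sum)
    show "independent {a, b}" using ind[OF aV(1)] .
    show "E ` V \<subseteq> V"
      using E sub by (auto intro!: subspace_add subspace_scale)
    show "E (x + y) = E x + E y" if "x \<in> V" "y \<in> V" for x y
      using that sub E(1) \<phi>(1) \<psi>(1)
      by (simp add: subspace_add linear_add algebra_simps)
    show "E (r *\<^sub>R x) = r *\<^sub>R E x" if "x \<in> V" for r x
      using that sub E(1) \<phi>(1) \<psi>(1)
      by (simp add: subspace_scale linear_cmul algebra_simps)
  qed (use V in simp)
  also have "\<dots> = \<phi> p + \<psi> q"
    using ab rep E aV \<phi> \<psi> by simp
  finally show ?thesis .
qed

section \<open>Line bundles and planes\<close>

lemma line_bundle_frame:
  assumes "subbundle 1 S s" "p \<in> S"
  obtains U e where "open U" "p \<in> U" "U \<subseteq> S" "smooth_on U e"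
    "\<And>q. q \<in> U \<Longrightarrow> s q = span {e q}" "\<And>q. q \<in> U \<Longrightarrow> e q \<noteq> 0"
proof -
  have "\<exists>U e. open U \<and> p \<in> U \<and> U \<subseteq> S \<and> (\<forall>i<1. smooth_on U (e i)) \<and>
      (\<forall>q\<in>U. s q = span ((\<lambda>i::nat. e i q) ` {..<1}))"
    using assms unfolding subbundle_def by blast
  then obtain U and e :: "nat \<Rightarrow> 'a \<Rightarrow> 'b" where U: "open U" "p \<in> U" "U \<subseteq> S" "smooth_on U (e 0)"
    and "\<forall>q\<in>U. s q = span ((\<lambda>i. e i q) ` {..<1})" by auto
  then have s: "s q = span {e 0 q}" if "q \<in> U" for q
    using that by (simp add: lessThan_Suc)
  have "e 0 q \<noteq> 0" if "q \<in> U" for q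
  proof
    assume "e 0 q = 0"
    then have "dim (s q) = 0" using s[OF that] by simp
    moreover have "dim (s q) = 1"
      using assms(1) subsetD[OF U(3) that] unfolding subbundle_def by blast
    ultimately show False by simp
  qed
  then show ?thesis using that[of U "e 0"] U s by blast
qed

lemma line_bundle_eq_span:
  assumes "subbundle 1 S s" "p \<in> S" "x \<in> s p" "x \<noteq> 0"
  shows "s p = span {x}"
proof -
  obtain U e where U: "p \<in> U" "\<And>q. q \<in> U \<Longrightarrow> s q = span {e q}"
    by (rule line_bundle_frame[OF assms(1,2)]) (rule that)
  obtain k where k: "x = k *\<^sub>R e p" using assms(3) U by (auto simp: span_singleton)
  then have "k \<noteq> 0" using assms(4) by auto
  then have "span {e p} = span {x}" using span_image_scale[of "{e p}" "\<lambda>_. k"] k by simp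
  then show ?thesis using U by simp
qed

text \<open>An immersed line bundle has a global section that does not vanish at a given point: a section
  vanishing at \<open>p\<close> is locally \<open>g e\<close> with \<open>g(p) = 0\<close>, so its derivative at \<open>p\<close> lies in the bundle.\<close>

lemma nonzero_section:
  fixes s :: "'a::real_normed_vector \<Rightarrow> 'b::euclidean_space set"
  assumes "subbundle 1 S s" "immersed S s" "p \<in> S" "(X :: 'a) \<noteq> 0"
  shows "\<exists>\<phi>\<in>sections S s. \<phi> p \<noteq> 0"
proof (rule ccontr)
  assume zero: "\<not> ?thesis"
  obtain \<phi> where \<phi>: "\<phi> \<in> sections S s" "D \<phi> p X \<notin> s p"
    using assms(2-4) unfolding immersed_def by blast
  have \<phi>0: "\<phi> p = 0" using zero \<phi>(1) by blast
  obtain U e where U: "open U" "p \<in> U" "U \<subseteq> S" "smooth_on U e"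
    and s: "\<And>q. q \<in> U \<Longrightarrow> s q = span {e q}" and e0: "\<And>q. q \<in> U \<Longrightarrow> e q \<noteq> 0"
    by (rule line_bundle_frame[OF assms(1,3)]) (rule that)
  define g where "g q = (\<phi> q \<bullet> e q) / (e q \<bullet> e q)" for q
  have sm: "smooth_on U \<phi>" using \<phi>(1) U(3) smooth_on_subset unfolding sections_def by blast
  have smg: "smooth_on U g"
    unfolding g_def using e0
    by (intro smooth_on_divide smooth_on_bilinear[OF bounded_bilinear_inner] U sm) auto
  have \<phi>g: "\<phi> q = g q *\<^sub>R e q" if "q \<in> U" for q
  proof -
    have "\<phi> q \<in> span {e q}" using \<phi>(1) s that U(3) by (auto simp: sections_def)
    then obtain k where "\<phi> q = k *\<^sub>R e q" by (auto simp: span_singleton)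
    then show ?thesis using e0[OF that] by (simp add: g_def)
  qed
  have "g p = 0" using \<phi>0 by (simp add: g_def)
  have "((\<lambda>q. g q *\<^sub>R e q) has_derivative
      (\<lambda>X. g p *\<^sub>R D e p X + D g p X *\<^sub>R e p)) (at p)"
    by (intro bounded_bilinear.FDERIV[OF bounded_bilinear_scaleR]
        smooth_on_imp_has_derivative[OF smg U(2)] smooth_on_imp_has_derivative[OF U(4,2)])
  then have "(\<phi> has_derivative (\<lambda>X. g p *\<^sub>R D e p X + D g p X *\<^sub>R e p)) (at p)"
    by (rule has_derivative_transform_within_open[OF _ U(1,2)]) (simp add: \<phi>g)
  then have "D \<phi> p X = D g p X *\<^sub>R e p"
    using D_eq \<open>g p = 0\<close> by fastforce
  then show False using \<phi>(2) s[OF U(2)] by (simp add: span_base span_scale)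
qed

lemma plane_eq_span:
  fixes V :: "'b::euclidean_space set"
  assumes "subspace V" "dim V = 2" "x \<in> V" "y \<in> V" "x \<notin> span {y}" "y \<noteq> 0"
  shows "V = span {x, y}"
proof -
  have "independent {x, y}" using assms(5,6) by (simp add: independent_insert)
  moreover have "card {x, y} = 2" using assms(5) by (auto simp: span_base card_insert_if)
  ultimately show ?thesis
    using card_eq_dim[of "{x, y}" V] assms(1-4) span_minimal[of "{x, y}" V] by auto
qed

text \<open>Three vectors spanning a 3-dimensional space have a dual family of functionals, linear on the
  whole ambient space.\<close>

lemma coordinates_on_subspace:
  fixes q :: "nat \<Rightarrow> real^6"
  assumes W: "W = {\<Sum>i<3. a i *\<^sub>R q i |a :: nat \<Rightarrow> real. True}" "dim W = 3"
  obtains \<phi> where "\<And>i. linear (\<phi> i)" "\<And>x. x \<in> W \<Longrightarrow> x = (\<Sum>i<3. \<phi> i x *\<^sub>R q i)"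
proof -
  have sub: "W \<subseteq> span (q ` {..<3})"
  proof -
    have "(\<Sum>i<3. a i *\<^sub>R q i) \<in> span (q ` {..<3})" for a
      by (intro span_sum span_scale span_base imageI)
    then show ?thesis unfolding W(1) by blast
  qed
  have "dim W \<le> card (q ` {..<3})" using dim_le_card[OF sub] by simp
  moreover have "card (q ` {..<3}) \<le> 3" using card_image_le[of "{..<3::nat}" q] by simp
  ultimately have card: "card (q ` {..<3}) = 3" using W(2) by simp
  then have inj: "inj_on q {..<3}" by (simp add: eq_card_imp_inj_on)
  have qW: "q i \<in> W" if "i < 3" for i
  proof -
    have "q i = (\<Sum>j<3. (if j = i then 1 else 0) *\<^sub>R q j)"
      using that by (simp add: if_distrib[of "\<lambda>c. c *\<^sub>R _"] cong: if_cong)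
    then show ?thesis
      unfolding W(1) by (intro CollectI exI[of _ "\<lambda>j. if j = i then 1 else 0"] conjI TrueI)
  qed
  have ind: "independent (q ` {..<3})"
    using qW sub card W(2) by (intro card_le_dim_spanning[of _ W]) auto
  have "\<exists>\<phi>. linear \<phi> \<and> (\<forall>x\<in>q ` {..<3}. \<phi> x = (if x = q i then 1 else 0 :: real))" for i
    using linear_independent_extend[OF ind, of "\<lambda>x. if x = q i then 1 else 0 :: real"] by simp
  then obtain \<phi> where \<phi>: "\<And>i. linear (\<phi> i)"
    "\<And>i x. x \<in> q ` {..<3} \<Longrightarrow> \<phi> i x = (if x = q i then 1 else 0 :: real)" by metis
  have "x = (\<Sum>i<3. \<phi> i x *\<^sub>R q i)" if x: "x \<in> W" for x
  proof -
    obtain a where a: "x = (\<Sum>i<3. a i *\<^sub>R q i)" using x W(1) by blast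
    have "\<phi> i x = a i" if i: "i < 3" for i
    proof -
      have "\<phi> i x = (\<Sum>j<3. a j * \<phi> i (q j))"
        unfolding a by (simp add: linear_sum[OF \<phi>(1)] linear_cmul[OF \<phi>(1)])
      also have "\<dots> = (\<Sum>j<3. a j * (if j = i then 1 else 0))"
        using \<phi>(2) inj i by (intro sum.cong) (auto simp: inj_on_def)
      also have "\<dots> = a i" using i by (simp add: if_distrib[of "\<lambda>r. a _ * r"] cong: if_cong)
      finally show ?thesis .
    qed
    then show ?thesis by (subst a) (auto intro!: sum.cong)
  qed
  then show ?thesis using that \<phi>(1) by blast
qed

section \<open>The form of signature (4,2)\<close>

locale lie_form =
  fixes B :: "real^6 \<Rightarrow> real^6 \<Rightarrow> real"
  assumes signature: "has_signature B 4 2"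
begin

lemma bounded_bilinear_B: "bounded_bilinear B"
  using signature by (simp add: has_signature_def bilinear_conv_bounded_bilinear)

lemmas B_add_left = bounded_bilinear.add_left[OF bounded_bilinear_B]
  and B_add_right = bounded_bilinear.add_right[OF bounded_bilinear_B]
  and B_diff_left = bounded_bilinear.diff_left[OF bounded_bilinear_B]
  and B_diff_right = bounded_bilinear.diff_right[OF bounded_bilinear_B]
  and B_minus_left = bounded_bilinear.minus_left[OF bounded_bilinear_B]
  and B_minus_right = bounded_bilinear.minus_right[OF bounded_bilinear_B]
  and B_zero_left = bounded_bilinear.zero_left[OF bounded_bilinear_B]
  and B_zero_right = bounded_bilinear.zero_right[OF bounded_bilinear_B]
  and B_scaleR_left' = bounded_bilinear.scaleR_left[OF bounded_bilinear_B]
  and B_scaleR_right' = bounded_bilinear.scaleR_right[OF bounded_bilinear_B]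
  and B_sum_left = bounded_bilinear.sum_left[OF bounded_bilinear_B]

lemmas B_scaleR_left = B_scaleR_left'[unfolded real_scaleR_def]
  and B_scaleR_right = B_scaleR_right'[unfolded real_scaleR_def]

lemmas B_simps = B_add_left B_add_right B_diff_left B_diff_right B_minus_left B_minus_right
  B_zero_left B_zero_right B_scaleR_left B_scaleR_right

lemma B_sym: "B x y = B y x"
  using signature by (simp add: has_signature_def)

lemmas B_has_vector_derivative = bounded_bilinear.has_vector_derivative[OF bounded_bilinear_B]

lemma smooth_on_B:
  "open S \<Longrightarrow> smooth_on S f \<Longrightarrow> smooth_on S g \<Longrightarrow> smooth_on S (\<lambda>x. B (f x) (g x))"
  using smooth_on_bilinear[OF bounded_bilinear_B] .

lemma linear_B_right: "linear (B x)"
  by (rule linearI) (simp_all add: B_simps)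

lemma B_nondegenerate:
  assumes "\<And>y. B x y = 0" shows "x = 0"
proof -
  obtain P N where PN: "subspace P" "dim P = 4" "subspace N" "dim N = 2"
    "\<And>x y. x \<in> P \<Longrightarrow> y \<in> N \<Longrightarrow> B x y = 0" "\<And>x. x \<in> P \<Longrightarrow> x \<noteq> 0 \<Longrightarrow> B x x > 0"
    "\<And>y. y \<in> N \<Longrightarrow> y \<noteq> 0 \<Longrightarrow> B y y < 0"
    using signature unfolding has_signature_def by (elim conjE exE) (rule that, auto)
  have "x = 0" if "x \<in> P" "x \<in> N" for x
    using PN(6)[OF that(1)] PN(7)[OF that(2)] by force
  then have "P \<inter> N = {0}" using subspace_0[OF PN(1)] subspace_0[OF PN(3)] by blast
  then have "dim {x + y |x y. x \<in> P \<and> y \<in> N} = DIM(real^6)"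
    using dim_sums_Int[OF PN(1,3)] PN(2,4) by simp
  then have "span {x + y |x y. x \<in> P \<and> y \<in> N} = UNIV"
    by (simp only: dim_eq_full)
  then have "{x + y |x y. x \<in> P \<and> y \<in> N} = UNIV"
    by (simp only: span_eq_iff[THEN iffD2, OF subspace_sums[OF PN(1,3)]])
  then have "x \<in> {x + y |x y. x \<in> P \<and> y \<in> N}" by (simp only: UNIV_I)
  then obtain p n where pn: "x = p + n" "p \<in> P" "n \<in> N" by blast
  have "B x p = B p p" "B x n = B n n"
    using PN(5)[OF pn(2,3)] pn(1) B_sym[of n p] by (simp_all add: B_simps)
  then have "p = 0 \<and> n = 0" using assms PN(6)[OF pn(2)] PN(7)[OF pn(3)] by force
  then show ?thesis using pn by simp
qed

text \<open>A subspace on which the form is non-positive has dimension at most 2, since it meets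
  a positive definite 4-space trivially.\<close>

lemma positive_vector_in_3_space:
  assumes "subspace S" "dim S \<ge> 3"
  shows "\<exists>x\<in>S. B x x > 0"
proof -
  obtain P where P: "subspace P" "dim P = 4" "\<And>x. x \<in> P \<Longrightarrow> x \<noteq> 0 \<Longrightarrow> B x x > 0"
    using signature unfolding has_signature_def by metis
  have "dim {x + y |x y. x \<in> S \<and> y \<in> P} \<le> 6"
    using dim_subset_UNIV[of "{x + y |x y. x \<in> S \<and> y \<in> P}"] by simp
  then have "dim (S \<inter> P) \<noteq> 0"
    using dim_sums_Int[OF assms(1) P(1)] assms(2) P(2) by linarith
  then obtain x where "x \<in> S \<inter> P" "x \<noteq> 0"
    by (metis dim_eq_0 subset_iff singletonI)
  then show ?thesis using P(3) by blast
qed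

text \<open>For a totally isotropic plane \<open>V\<close> the form is positive definite on \<open>V\<^sup>\<bottom> / V\<close>.\<close>

lemma positive_off_null_plane:
  assumes "a \<notin> span {b}" "b \<noteq> 0" "x \<notin> span {a, b}"
    and "B a a = 0" "B b b = 0" "B a b = 0" "B x a = 0" "B x b = 0"
  shows "B x x > 0"
proof (rule ccontr)
  assume neg: "\<not> B x x > 0"
  have "independent {x, a, b}"
    using assms(1-3) by (simp add: independent_insert span_superset)
  moreover have "card {x, a, b} = 3"
    using assms(1-3) by (auto simp: span_base card_insert_if)
  ultimately have "dim (span {x, a, b}) = 3"
    using dim_span_eq_card_independent by metis
  then obtain y where y: "y \<in> span {x, a, b}" "B y y > 0"
    using positive_vector_in_3_space[of "span {x, a, b}"] by auto
  obtain r s t where "y = r *\<^sub>R x + s *\<^sub>R a + t *\<^sub>R b"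
    using y(1) by (auto simp: span_breakdown_eq algebra_simps)
  then have "B y y = r * r * B x x"
    using assms(4-8) B_sym[of a x] B_sym[of b x] B_sym[of b a] by (simp add: B_simps)
  then show False
    using y(2) neg by (metis mult_nonneg_nonpos not_le zero_le_square)
qed

text \<open>The form is the Euclidean inner product composed with an invertible linear map.\<close>

lemma gram_operator:
  obtains g where "linear g" "inj g" "surj g" "\<And>x y. B x y = x \<bullet> g y"
proof -
  define g where "g y = (\<Sum>b\<in>Basis. B b y *\<^sub>R b)" for y
  have lin: "linear g"
    unfolding g_def by (rule linearI) (simp_all add: B_simps algebra_simps sum.distrib scaleR_sum_right)
  have eq: "B x y = x \<bullet> g y" for x y
  proof -
    have "B x y = B (\<Sum>b\<in>Basis. (x \<bullet> b) *\<^sub>R b) y" by (simp add: euclidean_representation)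
    also have "\<dots> = (\<Sum>b\<in>Basis. (x \<bullet> b) * B b y)"
      by (simp only: B_sum_left B_scaleR_left)
    finally show ?thesis by (simp add: g_def inner_sum_right mult.commute)
  qed
  have "inj g"
    unfolding linear_injective_0[OF lin] using eq B_nondegenerate B_sym by (metis inner_zero_right)
  then show ?thesis using that lin eq linear_injective_imp_surjective by blast
qed

lemma subspace_perp: "subspace E \<Longrightarrow> subspace (perp_in B E V)"
  unfolding perp_in_def subspace_def by (auto simp: B_simps)

lemma dim_perp:
  assumes "subspace V"
  shows "dim (perp B V) + dim V = 6"
proof -
  obtain g where g: "linear g" "inj g" "\<And>x y. B x y = x \<bullet> g y" using gram_operator by metis
  have sub: "subspace (g ` V)" using linear_subspace_image[OF g(1) assms] .
  have "perp B V = {x \<in> UNIV. \<forall>y \<in> g ` V. orthogonal y x}"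
    using g(3) by (auto simp: perp_in_def orthogonal_def inner_commute)
  then have "dim (perp B V) + dim (g ` V) = dim (UNIV :: (real^6) set)"
    using dim_subspace_orthogonal_to_vectors[OF sub subspace_UNIV] by simp
  moreover have "dim (g ` V) = dim V"
    using dim_image_eq[OF g(1)] g(2) inj_on_subset by blast
  ultimately show ?thesis by simp
qed

subsection \<open>Decomposable skew maps\<close>

lemma wedge_apply: "wedge B a b *v c = B a c *\<^sub>R b - B b c *\<^sub>R a"
proof -
  have "linear (\<lambda>c. B a c *\<^sub>R b - B b c *\<^sub>R a)"
    by (rule linearI) (simp_all add: B_simps algebra_simps)
  then show ?thesis
    unfolding wedge_def by (intro matrix_works) (simp add: linear_matrix_vector_mul_eq)
qed

lemma matrix_eqI:
  fixes M N :: "real^6^6" assumes "\<And>x. M *v x = N *v x" shows "M = N"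
  using assms matrix_eq by blast

lemma bounded_bilinear_wedge: "bounded_bilinear (wedge B)"
proof -
  have "bilinear (wedge B)"
    unfolding bilinear_def
    by (intro conjI allI linearI matrix_eqI)
      (simp_all add: wedge_apply B_simps algebra_simps matrix_vector_mult_add_rdistrib
        scaleR_matrix_vector_assoc[symmetric])
  then show ?thesis by (simp add: bilinear_conv_bounded_bilinear)
qed

lemma bounded_bilinear_mv: "bounded_bilinear ((*v) :: real^6^6 \<Rightarrow> _)"
proof -
  have "bilinear ((*v) :: real^6^6 \<Rightarrow> _)"
    unfolding bilinear_def
    by (intro conjI allI linearI)
      (simp_all add: matrix_vector_mult_add_rdistrib matrix_vector_right_distrib
        scaleR_matrix_vector_assoc[symmetric] matrix_vector_mult_scaleR)
  then show ?thesis by (simp add: bilinear_conv_bounded_bilinear)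
qed

lemma bounded_bilinear_mm: "bounded_bilinear ((**) :: real^6^6 \<Rightarrow> real^6^6 \<Rightarrow> _)"
proof -
  have "bilinear ((**) :: real^6^6 \<Rightarrow> real^6^6 \<Rightarrow> _)"
    unfolding bilinear_def
    by (intro conjI allI linearI matrix_eqI)
      (simp_all add: matrix_vector_mul_assoc[symmetric] matrix_vector_mult_add_rdistrib
        matrix_vector_right_distrib scaleR_matrix_vector_assoc[symmetric] matrix_vector_mult_scaleR)
  then show ?thesis by (simp add: bilinear_conv_bounded_bilinear)
qed

lemmas mv_simps = matrix_vector_right_distrib matrix_vector_mult_diff_distrib
  matrix_vector_mult_scaleR matrix_vector_mult_add_rdistrib matrix_vector_mult_diff_rdistrib
  scaleR_matrix_vector_assoc[symmetric]
  bounded_bilinear.minus_left[OF bounded_bilinear_mv] bounded_bilinear.minus_right[OF bounded_bilinear_mv]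

lemmas mm_simps = bounded_bilinear.zero_left[OF bounded_bilinear_mm]
  bounded_bilinear.zero_right[OF bounded_bilinear_mm] bounded_bilinear.add_left[OF bounded_bilinear_mm]
  bounded_bilinear.add_right[OF bounded_bilinear_mm] bounded_bilinear.diff_left[OF bounded_bilinear_mm]
  bounded_bilinear.diff_right[OF bounded_bilinear_mm] bounded_bilinear.minus_right[OF bounded_bilinear_mm]
  bounded_bilinear.scaleR_left[OF bounded_bilinear_mm] bounded_bilinear.scaleR_right[OF bounded_bilinear_mm]

lemmas mv_has_vector_derivative = bounded_bilinear.has_vector_derivative[OF bounded_bilinear_mv]
lemmas mm_has_vector_derivative = bounded_bilinear.has_vector_derivative[OF bounded_bilinear_mm]
lemmas smooth_on_wedge = smooth_on_bilinear[OF bounded_bilinear_wedge]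
lemmas smooth_on_mv = smooth_on_bilinear[OF bounded_bilinear_mv]
lemmas smooth_on_mm = smooth_on_bilinear[OF bounded_bilinear_mm]

text \<open>Elements of \<open>V \<and> W\<close> with \<open>W \<le> V\<^sup>\<bottom>\<close> are skew and map \<open>V\<^sup>\<bottom>\<close> into \<open>V\<close>; if \<open>V\<close> is isotropic they
  annihilate \<open>V\<close>.\<close>

lemma wedge_space_props:
  assumes "K \<in> wedge_space B V W" "subspace V" "\<And>x y. x \<in> V \<Longrightarrow> y \<in> W \<Longrightarrow> B x y = 0"
  shows "B (K *v x) y = - B x (K *v y)"
    and "(\<And>y z. y \<in> V \<Longrightarrow> z \<in> V \<Longrightarrow> B y z = 0) \<Longrightarrow> x \<in> V \<Longrightarrow> K *v x = 0"
    and "(\<And>y. y \<in> V \<Longrightarrow> B x y = 0) \<Longrightarrow> K *v x \<in> V"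
proof -
  have K: "K \<in> span {wedge B a b |a b. a \<in> V \<and> b \<in> W}"
    using assms(1) by (simp add: wedge_space_def)
  show "B (K *v x) y = - B x (K *v y)"
    using K
  proof (induction rule: span_induct_alt)
    case (step c M N)
    then show ?case by (auto simp: mv_simps B_simps wedge_apply B_sym algebra_simps)
  qed (simp add: B_simps)
  show "K *v x = 0" if V: "\<And>y z. y \<in> V \<Longrightarrow> z \<in> V \<Longrightarrow> B y z = 0" "x \<in> V"
    using K
  proof (induction rule: span_induct_alt)
    case (step c M N)
    then obtain a b where M: "M = wedge B a b" "a \<in> V" "b \<in> W" by blast
    have "M *v x = 0"
      using V(1)[OF M(2) V(2)] assms(3)[OF V(2) M(3)] B_sym[of b x] by (simp add: M(1) wedge_apply)
    then show ?case using step by (simp add: mv_simps)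
  qed simp
  show "K *v x \<in> V" if x: "\<And>y. y \<in> V \<Longrightarrow> B x y = 0"
    using K
  proof (induction rule: span_induct_alt)
    case base
    then show ?case using assms(2) by (simp add: subspace_0)
  next
    case (step c M N)
    then obtain a b where M: "M = wedge B a b" "a \<in> V" "b \<in> W" by blast
    have "M *v x = (- B b x) *\<^sub>R a" using M x[of a] B_sym[of a x] by (simp add: wedge_apply)
    then show ?case using step M(2) assms(2)
      by (auto simp: mv_simps intro!: subspace_add subspace_scale subspace_neg subspace_diff)
  qed
qed

lemma wedge_space_range:
  assumes "K \<in> wedge_space B V W" "subspace U" "V \<subseteq> U" "W \<subseteq> U"
  shows "K *v x \<in> U"
  using assms(1) unfolding wedge_space_def
proof (induction rule: span_induct_alt)
  case base
  then show ?case using subspace_0[OF assms(2)] by simp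
next
  case (step c M N)
  then obtain a b where M: "M = wedge B a b" "a \<in> V" "b \<in> W" by blast
  have "M *v x \<in> U"
    unfolding M wedge_apply using M assms(2-4) by (intro subspace_diff subspace_scale) auto
  then show ?case
    using step assms(2)
    by (simp add: mv_simps
        subspace_add subspace_scale)
qed

lemma wedge_space_intros:
  "a \<in> V \<Longrightarrow> b \<in> W \<Longrightarrow> wedge B a b \<in> wedge_space B V W" "subspace (wedge_space B V W)"
  unfolding wedge_space_def by (auto intro: span_base)

subsection \<open>The orthogonal group\<close>

lemma orthogonal_group_inv:
  assumes "A \<in> orthogonal_group B"
  shows "A ** matrix_inv A = mat 1" "matrix_inv A ** A = mat 1"
    "A *v (matrix_inv A *v x) = x" "matrix_inv A *v (A *v x) = x"
proof -
  have AB: "B (A *v x) (A *v y) = B x y" for x y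
    using assms by (auto simp: orthogonal_group_def)
  have "x = 0" if "A *v x = 0" for x
    using that AB[of x] B_nondegenerate B_zero_left by metis
  then have "invertible A"
    unfolding invertible_left_inverse matrix_left_invertible_ker by blast
  then show *: "A ** matrix_inv A = mat 1" "matrix_inv A ** A = mat 1"
    unfolding invertible_def matrix_inv_def
    by (metis (mono_tags, lifting) someI_ex)+
  show "A *v (matrix_inv A *v x) = x" "matrix_inv A *v (A *v x) = x"
    using * by (simp_all add: matrix_vector_mul_assoc)
qed

lemma orthogonal_group_B:
  assumes "A \<in> orthogonal_group B"
  shows "B (A *v x) (A *v y) = B x y" "B (matrix_inv A *v x) (matrix_inv A *v y) = B x y"
    "B (A *v x) y = B x (matrix_inv A *v y)"
proof -
  show AB: "B (A *v x) (A *v y) = B x y" for x y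
    using assms by (auto simp: orthogonal_group_def)
  show "B (matrix_inv A *v x) (matrix_inv A *v y) = B x y" "B (A *v x) y = B x (matrix_inv A *v y)"
    using AB[of "matrix_inv A *v x" "matrix_inv A *v y"] AB[of x "matrix_inv A *v y"]
      orthogonal_group_inv(3)[OF assms] by auto
qed

text \<open>The inverse of an orthogonal matrix is conjugate to its transpose by the Gram matrix, hence
  depends linearly on it.\<close>

lemma smooth_on_matrix_inv:
  assumes "open S" "smooth_on S A" "\<And>v. v \<in> S \<Longrightarrow> A v \<in> orthogonal_group B"
  shows "smooth_on S (\<lambda>v. matrix_inv (A v))"
proof -
  obtain g where g: "linear g" "inj g" "\<And>x y. B x y = x \<bullet> g y" using gram_operator by metis
  obtain h where h: "linear h" "\<And>x. h (g x) = x"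
    using linear_injective_left_inverse[OF g(1,2)] by (auto simp: fun_eq_iff)
  define H where "H = matrix h"
  define G where "G = matrix g"
  have eq: "matrix_inv M = (H ** transpose M) ** G" if "M \<in> orthogonal_group B" for M
  proof (rule matrix_eqI)
    fix y
    have "x \<bullet> g (matrix_inv M *v y) = x \<bullet> (transpose M *v g y)" for x
      using orthogonal_group_B(3)[OF that, of x y] g(3)
      by (metis dot_lmul_matrix inner_commute transpose_matrix_vector)
    then have "g (matrix_inv M *v y) = transpose M *v g y"
      using vector_eq_ldot by blast
    then have "matrix_inv M *v y = h (transpose M *v g y)" using h(2) by metis
    then show "matrix_inv M *v y = (H ** transpose M) ** G *v y"
      unfolding H_def G_def using g(1) h(1)
      by (simp add: matrix_vector_mul_assoc[symmetric] matrix_works linear_matrix_vector_mul_eq)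
  qed
  have "linear (transpose :: real^6^6 \<Rightarrow> real^6^6)"
    by (rule linearI) (simp_all add: transpose_def vec_eq_iff)
  then have "bounded_linear (transpose :: real^6^6 \<Rightarrow> real^6^6)"
    by (rule linear_conv_bounded_linear[THEN iffD1])
  then have "smooth_on S (\<lambda>v. (H ** transpose (A v)) ** G)"
    by (intro smooth_on_mm assms(1) smooth_on_const smooth_on_linear_compose[of transpose] assms(2))
  then show ?thesis
    using smooth_on_cong[OF assms(1)] eq assms(3)
    by (metis (mono_tags, lifting))
qed

lemma wedge_conj:
  assumes "A \<in> orthogonal_group B"
  shows "matrix_inv A ** wedge B a b ** A = wedge B (matrix_inv A *v a) (matrix_inv A *v b)"
  by (rule matrix_eqI)
    (simp add: matrix_vector_mul_assoc[symmetric] wedge_apply mv_simps orthogonal_group_B(3)[OF assms] B_sym[of _ "A *v _"] B_sym[of "_ :: real^6" "matrix_inv A *v _"])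

lemma wedge_space_conj:
  assumes "A \<in> orthogonal_group B" "K \<in> wedge_space B V W" "W \<subseteq> W'"
  shows "matrix_inv A ** K ** A \<in> wedge_space B ((*v) (matrix_inv A) ` V) ((*v) (matrix_inv A) ` W')"
  using assms(2) unfolding wedge_space_def[of B V W]
proof (induction rule: span_induct_alt)
  case base
  then show ?case
    using subspace_0[OF wedge_space_intros(2)] mm_simps by simp
next
  case (step c M N)
  then obtain a b where M: "M = wedge B a b" "a \<in> V" "b \<in> W" by blast
  have "matrix_inv A ** M ** A \<in> wedge_space B ((*v) (matrix_inv A) ` V) ((*v) (matrix_inv A) ` W')"
    unfolding M wedge_conj[OF assms(1)] using M assms(3) by (intro wedge_space_intros) auto
  moreover have "matrix_inv A ** (c *\<^sub>R M + N) ** A =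
      c *\<^sub>R (matrix_inv A ** M ** A) + matrix_inv A ** N ** A"
    by (simp add: mm_simps)
  ultimately show ?case
    using step by (simp add: subspace_add subspace_scale wedge_space_intros(2))
qed

subsection \<open>Orthogonal projections and the induced connection\<close>

lemma proj_line:
  assumes "B e e \<noteq> 0"
  shows "proj B (span {e}) x = (B x e / B e e) *\<^sub>R e"
    and "proj B (perp B (span {e})) x = x - (B x e / B e e) *\<^sub>R e"
proof -
  have perp: "perp B (span {e}) = {y. B y e = 0}"
    by (auto simp: perp_in_def span_singleton B_simps intro: exI[of _ 1])
  show "proj B (span {e}) x = (B x e / B e e) *\<^sub>R e"
    unfolding proj_def
  proof (rule the_equality)
    show "(B x e / B e e) *\<^sub>R e \<in> span {e} \<and> x - (B x e / B e e) *\<^sub>R e \<in> perp B (span {e})"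
      using assms by (simp add: perp B_simps span_base span_scale)
    fix y assume y: "y \<in> span {e} \<and> x - y \<in> perp B (span {e})"
    then obtain k where "y = k *\<^sub>R e" by (auto simp: span_singleton)
    then show "y = (B x e / B e e) *\<^sub>R e"
      using y assms by (simp add: perp B_simps field_simps)
  qed
  show "proj B (perp B (span {e})) x = x - (B x e / B e e) *\<^sub>R e"
    unfolding proj_def
  proof (rule the_equality)
    show "x - (B x e / B e e) *\<^sub>R e \<in> perp B (span {e}) \<and>
        x - (x - (B x e / B e e) *\<^sub>R e) \<in> perp B (perp B (span {e}))"
    proof
      show "x - (B x e / B e e) *\<^sub>R e \<in> perp B (span {e})"
        using assms by (simp add: perp B_simps)
      have "B e y = 0" if "y \<in> perp B (span {e})" for y using that perp B_sym[of e y] by simp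
      then show "x - (x - (B x e / B e e) *\<^sub>R e) \<in> perp B (perp B (span {e}))"
        unfolding perp_in_def[of B UNIV "perp B (span {e})"] by (simp add: B_simps)
    qed
    fix y assume y: "y \<in> perp B (span {e}) \<and> x - y \<in> perp B (perp B (span {e}))"
    define z where "z = y - (x - (B x e / B e e) *\<^sub>R e)"
    have ze: "B z e = 0" using y assms by (simp add: z_def perp B_simps)
    have zp: "B z w = 0" if "B w e = 0" for w
    proof -
      have "w \<in> perp B (span {e})" using that perp by simp
      then have "B (x - y) w = 0" using y unfolding perp_in_def[of B UNIV "perp B (span {e})"] by blast
      then show ?thesis using that B_sym[of e w] by (simp add: z_def B_simps)
    qed
    have "B z w = 0" for w
      using zp[of "w - (B w e / B e e) *\<^sub>R e"] ze assms by (simp add: B_simps)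
    then show "y = x - (B x e / B e e) *\<^sub>R e" using B_nondegenerate[of z] by (simp add: z_def)
  qed
qed

text \<open>The \<open>L\<close>-component of \<open>\<sigma>\<close> is \<open>\<phi> e\<close>; the two summands are the projections of \<open>(\<phi> e)'\<close> to \<open>L\<close> and
  of \<open>(\<sigma> - \<phi> e)'\<close> to \<open>L\<^sup>\<bottom>\<close>.\<close>

lemma split_connection_frame:
  assumes U: "open U" "v \<in> U" and L: "\<And>w. w \<in> U \<Longrightarrow> L w = span {e w}"
    and e: "\<And>w. w \<in> U \<Longrightarrow> B (e w) (e w) \<noteq> 0"
    and \<phi>: "\<And>w. w \<in> U \<Longrightarrow> \<phi> w = B (\<sigma> w) (e w) / B (e w) (e w)"
    and der: "(e has_vector_derivative e') (at v)" "(\<sigma> has_vector_derivative \<sigma>') (at v)"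
      "(\<phi> has_vector_derivative \<phi>') (at v)"
  defines "w \<equiv> \<sigma>' - \<phi>' *\<^sub>R e v - \<phi> v *\<^sub>R e'"
  shows "split_connection B L \<sigma> v = (\<phi>' + \<phi> v * B e' (e v) / B (e v) (e v)) *\<^sub>R e v
    + (w - (B w (e v) / B (e v) (e v)) *\<^sub>R e v)"
proof -
  have d: "((\<lambda>w. \<phi> w *\<^sub>R e w) has_vector_derivative \<phi> v *\<^sub>R e' + \<phi>' *\<^sub>R e v) (at v)"
    using scaleR_has_vector_derivative[OF der(3,1)] .
  have d1: "((\<lambda>w. proj B (L w) (\<sigma> w)) has_vector_derivative \<phi> v *\<^sub>R e' + \<phi>' *\<^sub>R e v) (at v)"
    by (rule has_vector_derivative_transform_within_open[OF d U]) (simp add: L e \<phi> proj_line)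
  have d2: "((\<lambda>w. proj B (perp B (L w)) (\<sigma> w)) has_vector_derivative
      \<sigma>' - (\<phi> v *\<^sub>R e' + \<phi>' *\<^sub>R e v)) (at v)"
    by (rule has_vector_derivative_transform_within_open[OF has_vector_derivative_diff[OF der(2) d] U])
      (simp add: L e \<phi> proj_line)
  have ev: "B (e v) (e v) \<noteq> 0" using e U(2) by simp
  show ?thesis
    unfolding split_connection_def vector_derivative_at[OF d1] vector_derivative_at[OF d2]
      L[OF U(2)] proj_line[OF ev] w_def
    using ev by (simp add: B_simps algebra_simps add_divide_distrib diff_divide_distrib)
qed

end

section \<open>The spherical evolution map\<close>

text \<open>The surface \<open>f = A\<^sup>-\<^sup>1 C\<close> with its curvature spheres \<open>s1, s2\<close> and the spherical evolution map \<open>A\<close>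
  along \<open>L\<close>. Sphericity of the \<open>u\<close>-lines is a consequence of these data.\<close>

locale evolved_surface = lie_form B for B +
  fixes I1 I2 :: "real set" and v0 :: real
    and f s1 s2 :: "real \<times> real \<Rightarrow> (real^6) set"
    and T1 T2 :: "real \<times> real \<Rightarrow> (real \<times> real) set"
    and L C :: "real \<Rightarrow> (real^6) set"
    and A :: "real \<Rightarrow> real^6^6"
  assumes I1: "open_interval I1" and I2: "open_interval I2" and v0: "v0 \<in> I2"
    and legendre: "legendre_map B UNIV (I1 \<times> I2) f"
    and umbilic_free: "curvature_data (I1 \<times> I2) f s1 s2 T1 T2"
    and coordinates: "(\<lambda>_. (1, 0)) \<in> sections (I1 \<times> I2) T1" "(\<lambda>_. (0, 1)) \<in> sections (I1 \<times> I2) T2"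
    and regular: "immersed (I1 \<times> I2) s1" "immersed (I1 \<times> I2) s2"
    and spacelike_L: "spacelike_line_map B I2 L"
    and evolution: "spherical_evolution_map B I2 L v0 A"
    and legendre_C: "legendre_map B (perp_in B UNIV (L v0)) I1 C"
    and f_eq: "\<And>u v. u \<in> I1 \<Longrightarrow> v \<in> I2 \<Longrightarrow> f (u, v) = (\<lambda>x. matrix_inv (A v) *v x) ` C u"
begin

abbreviation \<Psi> where "\<Psi> v \<equiv> matrix_inv (A v)"

lemmas op1 = open_interval_imp(1)[OF I1] and op2 = open_interval_imp(1)[OF I2]
lemma opS: "open (I1 \<times> I2)" using op1 op2 by (rule open_Times)

lemma A_orthogonal: "v \<in> I2 \<Longrightarrow> A v \<in> orthogonal_group B"
  and smooth_A: "smooth_on I2 A" and A_v0: "A v0 = mat 1"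
  using evolution by (auto simp: spherical_evolution_map_def)

lemmas A_inv = orthogonal_group_inv[OF A_orthogonal]
  and A_B = orthogonal_group_B[OF A_orthogonal]

lemma Psi_v0: "\<Psi> v0 = mat 1"
  using A_inv(1)[OF v0] A_v0 by (simp add: matrix_mul_lid)

lemma smooth_Psi: "smooth_on I2 \<Psi>"
  using smooth_on_matrix_inv[OF op2 smooth_A A_orthogonal] .

lemma smooth_Psi_x: "smooth_on I2 (\<lambda>v. \<Psi> v *v x)"
  by (intro smooth_on_mv op2 smooth_Psi smooth_on_const)

lemma split_connection_Psi:
  assumes "v \<in> I2" shows "split_connection B L (\<lambda>w. \<Psi> w *v x) v = 0"
proof -
  have "A v *v split_connection B L (\<lambda>w. \<Psi> w *v x) v = vector_derivative (\<lambda>_. x) (at v)"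
    using evolution assms smooth_on_const[of I2 x] unfolding spherical_evolution_map_def by blast
  then have "A v *v split_connection B L (\<lambda>w. \<Psi> w *v x) v = 0" by simp
  then show ?thesis using A_inv(4)[OF assms] by (metis matrix_vector_mult_0_right)
qed

lemma L_frame:
  assumes "v \<in> I2"
  obtains U e where "open U" "v \<in> U" "U \<subseteq> I2" "smooth_on U e"
    "\<And>w. w \<in> U \<Longrightarrow> L w = span {e w}" "\<And>w. w \<in> U \<Longrightarrow> B (e w) (e w) > 0"
proof -
  have L: "subbundle 1 I2 L" "\<And>v. v \<in> I2 \<Longrightarrow> spacelike B (L v)"
    using spacelike_L by (auto simp: spacelike_line_map_def)
  obtain U e where U: "open U" "v \<in> U" "U \<subseteq> I2" "smooth_on U e"
    and s: "\<And>q. q \<in> U \<Longrightarrow> L q = span {e q}" and e0: "\<And>q. q \<in> U \<Longrightarrow> e q \<noteq> 0"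
    by (rule line_bundle_frame[OF L(1) assms]) (rule that)
  have "B (e w) (e w) > 0" if "w \<in> U" for w
    using L(2)[OF subsetD[OF U(3) that]] e0[OF that] s[OF that]
    unfolding spacelike_def by (simp add: span_base)
  then show ?thesis using that[OF U s] by blast
qed

text \<open>The squared length of the \<open>L\<close>-component of a \<open>\<D>\<^sup>L\<close>-parallel section is constant. As \<open>L\<close> is
  spacelike, a section that starts in \<open>L\<^sub>0\<^sup>\<bottom>\<close> stays in \<open>L\<^sup>\<bottom>\<close>.\<close>

lemma Psi_preserves_perp:
  assumes "v \<in> I2" "\<And>y. y \<in> L v0 \<Longrightarrow> B x y = 0" "y \<in> L v"
  shows "B (\<Psi> v *v x) y = 0"
proof -
  define q where "q v = B (proj B (L v) (\<Psi> v *v x)) (proj B (L v) (\<Psi> v *v x))" for v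
  have "(q has_vector_derivative 0) (at v)" if v: "v \<in> I2" for v
  proof -
    obtain U e where U: "open U" "v \<in> U" "U \<subseteq> I2" "smooth_on U e"
      and e: "\<And>w. w \<in> U \<Longrightarrow> L w = span {e w}" "\<And>w. w \<in> U \<Longrightarrow> B (e w) (e w) > 0"
      by (rule L_frame[OF v]) (rule that)
    have e0: "B (e w) (e w) \<noteq> 0" if "w \<in> U" for w using e(2)[OF that] by simp
    define \<phi> where "\<phi> w = B (\<Psi> w *v x) (e w) / B (e w) (e w)" for w
    have sm: "smooth_on U (\<lambda>v. \<Psi> v *v x)" using smooth_on_subset[OF smooth_Psi_x U(3)] .
    have smphi: "smooth_on U \<phi>"
      unfolding \<phi>_def using e0 by (intro smooth_on_divide smooth_on_B U sm)
    define e' where "e' = D e v 1"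
    define \<phi>' where "\<phi>' = D \<phi> v 1"
    have d: "(e has_vector_derivative e') (at v)" "(\<phi> has_vector_derivative \<phi>') (at v)"
      unfolding e'_def \<phi>'_def using smooth_on_curve_derivative U smphi by blast+
    define n where "n = B (e v) (e v)"
    have n: "n \<noteq> 0" using e0[OF U(2)] by (simp add: n_def)
    define w where "w = D (\<lambda>v. \<Psi> v *v x) v 1 - \<phi>' *\<^sub>R e v - \<phi> v *\<^sub>R e'"
    have "split_connection B L (\<lambda>w. \<Psi> w *v x) v =
        (\<phi>' + \<phi> v * B e' (e v) / n) *\<^sub>R e v + (w - (B w (e v) / n) *\<^sub>R e v)"
      unfolding n_def w_def
      by (rule split_connection_frame[OF U(1,2) e(1) e0 \<phi>_def d(1)
            smooth_on_curve_derivative[OF sm U(2)] d(2)])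
    then have "B 0 (e v) = B ((\<phi>' + \<phi> v * B e' (e v) / n) *\<^sub>R e v + (w - (B w (e v) / n) *\<^sub>R e v)) (e v)"
      using split_connection_Psi[OF v, of x] by simp
    also have "\<dots> = (\<phi>' + \<phi> v * B e' (e v) / n) * n"
      using n by (simp add: B_simps n_def[symmetric])
    finally have "B 0 (e v) = (\<phi>' + \<phi> v * B e' (e v) / n) * n" .
    then have zero: "\<phi>' * n + \<phi> v * B e' (e v) = 0" using n by (simp add: B_simps distrib_right)
    have dd: "((\<lambda>w. \<phi> w *\<^sub>R e w) has_vector_derivative \<phi> v *\<^sub>R e' + \<phi>' *\<^sub>R e v) (at v)"
      using scaleR_has_vector_derivative[OF d(2,1)] .
    have "((\<lambda>w. B (\<phi> w *\<^sub>R e w) (\<phi> w *\<^sub>R e w)) has_vector_derivative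
        2 * \<phi> v * (\<phi>' * n + \<phi> v * B e' (e v))) (at v)"
      by (rule has_vector_derivative_eq_rhs[OF B_has_vector_derivative[OF dd dd]])
        (simp add: B_simps n_def B_sym[of "e v" e'] algebra_simps)
    then have "((\<lambda>w. B (\<phi> w *\<^sub>R e w) (\<phi> w *\<^sub>R e w)) has_vector_derivative 0) (at v)"
      by (simp add: zero)
    then show ?thesis
      by (rule has_vector_derivative_transform_within_open[OF _ U(1,2)])
        (simp add: q_def e(1) e0 proj_line \<phi>_def)
  qed
  then have const: "q v = q v0"
    using zero_derivative_constant open_interval_imp(2)[OF I2] v0 assms(1) by blast
  obtain U0 e0 where e0: "v0 \<in> U0" "\<And>w. w \<in> U0 \<Longrightarrow> L w = span {e0 w}"
    "\<And>w. w \<in> U0 \<Longrightarrow> B (e0 w) (e0 w) > 0" using L_frame[OF v0] by metis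
  have "B x (e0 v0) = 0" using assms(2) e0(1,2) by (simp add: span_base)
  then have "q v0 = 0"
    using proj_line(1)[of "e0 v0"] e0(3)[OF e0(1)] by (simp add: q_def e0 Psi_v0 B_simps)
  obtain U e where e: "v \<in> U" "\<And>w. w \<in> U \<Longrightarrow> L w = span {e w}"
    "\<And>w. w \<in> U \<Longrightarrow> B (e w) (e w) > 0" using L_frame[OF assms(1)] by metis
  have ev: "B (e v) (e v) \<noteq> 0" using e(3)[OF e(1)] by simp
  have "proj B (L v) (\<Psi> v *v x) = (B (\<Psi> v *v x) (e v) / B (e v) (e v)) *\<^sub>R e v"
    unfolding e(2)[OF e(1)] by (rule proj_line(1)[OF ev])
  then have "(B (\<Psi> v *v x) (e v) / B (e v) (e v)) * (B (\<Psi> v *v x) (e v) / B (e v) (e v)) * B (e v) (e v) = 0"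
    using const unfolding \<open>q v0 = 0\<close> unfolding q_def by (simp only: B_simps mult.assoc)
  then have "B (\<Psi> v *v x) (e v) = 0" using ev by simp
  then show ?thesis using assms(3) e(1,2) by (auto simp: span_singleton B_simps)
qed

text \<open>A unit vector of \<open>L\<^sub>0\<close>, its parallel transport (a unit section of \<open>L\<close>), and the derivative of
  that section, transported back into \<open>L\<^sub>0\<^sup>\<bottom>\<close>.\<close>

definition l0 where "l0 = (SOME x. L v0 = span {x} \<and> B x x = 1)"
definition l where "l v = \<Psi> v *v l0"
definition m where "m v = A v *v D l v 1"

lemma l0: "L v0 = span {l0}" "B l0 l0 = 1"
proof -
  obtain U e where e: "v0 \<in> U" "\<And>w. w \<in> U \<Longrightarrow> L w = span {e w}"
    "\<And>w. w \<in> U \<Longrightarrow> B (e w) (e w) > 0" using L_frame[OF v0] by metis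
  define r where "r = inverse (sqrt (B (e v0) (e v0)))"
  have r: "r \<noteq> 0" "r * r * B (e v0) (e v0) = 1"
    using e(3)[OF e(1)] by (auto simp: r_def field_simps)
  have "L v0 = span {r *\<^sub>R e v0} \<and> B (r *\<^sub>R e v0) (r *\<^sub>R e v0) = 1"
    using r e(2)[OF e(1)] span_image_scale[of "{e v0}" "\<lambda>_. r"] by (simp add: B_simps mult.assoc)
  then have "L v0 = span {l0} \<and> B l0 l0 = 1"
    unfolding l0_def by (rule someI)
  then show "L v0 = span {l0}" "B l0 l0 = 1" by auto
qed

lemma perp_L0: "perp_in B UNIV (L v0) = {x. B l0 x = 0}"
proof -
  have "(\<forall>y\<in>span {l0}. B x y = 0) \<longleftrightarrow> B x l0 = 0" for x
    by (auto simp: span_singleton B_simps intro: span_base)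
  then show ?thesis unfolding l0(1) perp_in_def using B_sym[of _ l0] by simp
qed

lemma smooth_l: "smooth_on I2 l"
  unfolding l_def using smooth_Psi_x .

lemma l_unit: "v \<in> I2 \<Longrightarrow> B (l v) (l v) = 1"
  by (simp add: l_def A_B l0)

lemma L_eq: assumes "v \<in> I2" shows "L v = span {l v}"
proof -
  obtain U e where e: "v \<in> U" "\<And>w. w \<in> U \<Longrightarrow> L w = span {e w}"
    "\<And>w. w \<in> U \<Longrightarrow> B (e w) (e w) > 0" using L_frame[OF assms] by metis
  define z where "z = e v - B (e v) (l v) *\<^sub>R l v"
  have "B z y = 0" for y
  proof -
    define x where "x = A v *v y - B l0 (A v *v y) *\<^sub>R l0"
    have x: "B x l0 = 0"
      by (simp add: x_def B_simps l0 B_sym[of "A v *v y" l0])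
    have "B (\<Psi> v *v x) (e v) = 0"
    proof (rule Psi_preserves_perp[OF assms])
      show "B x y = 0" if "y \<in> L v0" for y
        using that x by (auto simp: l0(1) span_singleton B_simps)
      show "e v \<in> L v" using e(2)[OF e(1)] by (simp add: span_base)
    qed
    moreover have "B (\<Psi> v *v x) (l v) = 0"
      unfolding l_def A_B(2)[OF assms] by (rule x)
    moreover have "y = \<Psi> v *v x + B l0 (A v *v y) *\<^sub>R l v"
      by (simp add: x_def l_def mv_simps A_inv(4)[OF assms])
    then have "B z y = B z (\<Psi> v *v x + B l0 (A v *v y) *\<^sub>R l v)" by simp
    ultimately show ?thesis
      by (simp add: z_def B_simps l_unit[OF assms] B_sym[of _ "\<Psi> v *v x"])
  qed
  then have "z = 0" by (rule B_nondegenerate)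
  then have el: "e v = B (e v) (l v) *\<^sub>R l v" by (simp add: z_def)
  moreover have "B (e v) (l v) \<noteq> 0" using el e(3)[OF e(1)] by (metis B_zero_left less_irrefl scale_eq_0_iff)
  ultimately have "span {e v} = span {l v}"
    using span_image_scale[of "{l v}" "\<lambda>_. B (e v) (l v)"] by simp
  then show ?thesis using e(1,2) by simp
qed

lemma smooth_m: "smooth_on I2 m"
  unfolding m_def by (intro smooth_on_mv op2 smooth_A smooth_on_D smooth_l)

lemma l_derivative: "v \<in> I2 \<Longrightarrow> (l has_vector_derivative \<Psi> v *v m v) (at v)"
  unfolding m_def using smooth_on_curve_derivative[OF smooth_l] A_inv(4) by simp

lemma l0_m: assumes "v \<in> I2" shows "B l0 (m v) = 0"
proof -
  note d = l_derivative[OF assms]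
  have "((\<lambda>w. B (l w) (l w)) has_vector_derivative 2 * B l0 (m v)) (at v)"
    by (rule has_vector_derivative_eq_rhs[OF B_has_vector_derivative[OF d d]])
      (simp add: l_def A_B(2)[OF assms] B_sym[of "m v"])
  from derivative_zero_if_constant[OF this op2 assms l_unit] show ?thesis by simp
qed

text \<open>In the unit frame \<open>l\<close> the connection is \<open>\<D>\<^sup>L \<sigma> = \<sigma>' - (\<sigma>, l) l' + (\<sigma>, l') l\<close>.\<close>

lemma Psi_derivative:
  assumes "v \<in> I2"
  shows "((\<lambda>v. \<Psi> v *v x) has_vector_derivative \<Psi> v *v (wedge B l0 (m v) *v x)) (at v)"
proof -
  define y' where "y' = D (\<lambda>v. \<Psi> v *v x) v 1"
  have y': "((\<lambda>v. \<Psi> v *v x) has_vector_derivative y') (at v)"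
    unfolding y'_def using smooth_on_curve_derivative[OF smooth_Psi_x assms] .
  have lm: "B l0 (m v) = 0" using l0_m[OF assms] .
  define \<phi>' where "\<phi>' = B (\<Psi> v *v x) (\<Psi> v *v m v) + B y' (l v)"
  have \<phi>': "((\<lambda>v. B (\<Psi> v *v x) (l v)) has_vector_derivative \<phi>') (at v)"
    unfolding \<phi>'_def by (intro B_has_vector_derivative y' l_derivative assms)
  define z where "z = y' - \<phi>' *\<^sub>R l v - B (\<Psi> v *v x) (l v) *\<^sub>R (\<Psi> v *v m v)"
  have "split_connection B L (\<lambda>v. \<Psi> v *v x) v =
      (\<phi>' + B (\<Psi> v *v x) (l v) * B (\<Psi> v *v m v) (l v) / B (l v) (l v)) *\<^sub>R l v
      + (z - (B z (l v) / B (l v) (l v)) *\<^sub>R l v)"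
    unfolding z_def
    by (rule split_connection_frame[OF op2 assms L_eq _ _ l_derivative[OF assms] y' \<phi>'])
      (simp_all add: l_unit)
  also have "\<dots> = y' - B (\<Psi> v *v x) (l v) *\<^sub>R (\<Psi> v *v m v) + B (\<Psi> v *v x) (\<Psi> v *v m v) *\<^sub>R l v"
    using lm by (simp add: z_def l_unit[OF assms] \<phi>'_def B_simps l_def l0(2) A_B(2)[OF assms]
        B_sym[of "m v" l0] algebra_simps)
  finally have "split_connection B L (\<lambda>v. \<Psi> v *v x) v =
      y' - B (\<Psi> v *v x) (l v) *\<^sub>R (\<Psi> v *v m v) + B (\<Psi> v *v x) (\<Psi> v *v m v) *\<^sub>R l v" .
  then have "y' = B (\<Psi> v *v x) (l v) *\<^sub>R (\<Psi> v *v m v) - B (\<Psi> v *v x) (\<Psi> v *v m v) *\<^sub>R l v"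
    using split_connection_Psi[OF assms, of x] by (simp add: algebra_simps)
  then have "y' = \<Psi> v *v (wedge B l0 (m v) *v x)"
    by (simp add: l_def A_B(2)[OF assms] wedge_apply mv_simps B_sym[of x])
  then show ?thesis using y' by simp
qed

lemma A_derivative:
  assumes "v \<in> I2"
  shows "((\<lambda>v. A v *v x) has_vector_derivative - (wedge B l0 (m v) *v (A v *v x))) (at v)"
proof -
  define a' where "a' = D (\<lambda>v. A v *v x) v 1"
  have a': "((\<lambda>v. A v *v x) has_vector_derivative a') (at v)"
    unfolding a'_def
    by (intro smooth_on_curve_derivative[OF _ assms] smooth_on_mv op2 smooth_A smooth_on_const)
  have "B (a' + wedge B l0 (m v) *v (A v *v x)) y = 0" for y
  proof -
    have "((\<lambda>v. B (A v *v x) y) has_vector_derivative B a' y) (at v)"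
      using B_has_vector_derivative[OF a' has_vector_derivative_const, of y] by (simp add: B_simps)
    moreover have "((\<lambda>v. B x (\<Psi> v *v y)) has_vector_derivative
        B x (\<Psi> v *v (wedge B l0 (m v) *v y))) (at v)"
      using B_has_vector_derivative[OF has_vector_derivative_const Psi_derivative[OF assms], of x y]
      by (simp add: B_simps)
    then have "((\<lambda>v. B (A v *v x) y) has_vector_derivative B x (\<Psi> v *v (wedge B l0 (m v) *v y))) (at v)"
      by (rule has_vector_derivative_transform_within_open[OF _ op2 assms]) (simp add: A_B(3))
    ultimately have "B a' y = B x (\<Psi> v *v (wedge B l0 (m v) *v y))"
      using vector_derivative_unique_at by blast
    then show ?thesis
      unfolding A_B(3)[OF assms, symmetric] by (simp add: wedge_apply B_simps B_sym[of _ "A v *v x"])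
  qed
  then have "a' + wedge B l0 (m v) *v (A v *v x) = 0" by (rule B_nondegenerate)
  then have "a' = - (wedge B l0 (m v) *v (A v *v x))" by (simp only: eq_neg_iff_add_eq_0)
  then show ?thesis using a' by (simp only:)
qed

section \<open>Sections of the surface and of the curve\<close>

text \<open>The domain of the surface, and the matrix \<open>l0 \<and> m(v)\<close> driving the evolution.\<close>

abbreviation \<Sigma> where "\<Sigma> \<equiv> I1 \<times> I2"
abbreviation J where "J v \<equiv> wedge B l0 (m v)"

lemma Psi_matrix_derivative:
  assumes "v \<in> I2" shows "(\<Psi> has_vector_derivative \<Psi> v ** J v) (at v)"
proof -
  note d = smooth_on_curve_derivative[OF smooth_Psi assms]
  have "D \<Psi> v 1 = \<Psi> v ** J v"
  proof (rule matrix_eqI)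
    fix x
    have "((\<lambda>v. \<Psi> v *v x) has_vector_derivative D \<Psi> v 1 *v x) (at v)"
      using mv_has_vector_derivative[OF d has_vector_derivative_const] by simp
    then show "D \<Psi> v 1 *v x = \<Psi> v ** J v *v x"
      using Psi_derivative[OF assms] vector_derivative_unique_at
      by (metis matrix_vector_mul_assoc)
  qed
  then show ?thesis using d by simp
qed

lemma A_matrix_derivative:
  assumes "v \<in> I2" shows "(A has_vector_derivative - (J v ** A v)) (at v)"
proof -
  note d = smooth_on_curve_derivative[OF smooth_A assms]
  have "D A v 1 = - (J v ** A v)"
  proof (rule matrix_eqI)
    fix x
    have "((\<lambda>v. A v *v x) has_vector_derivative D A v 1 *v x) (at v)"
      using mv_has_vector_derivative[OF d has_vector_derivative_const] by simp
    moreover have "- (J v *v (A v *v x)) = - (J v ** A v) *v x"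
      using mv_simps by (simp add: matrix_vector_mul_assoc)
    ultimately show "D A v 1 *v x = - (J v ** A v) *v x"
      using A_derivative[OF assms, of x] vector_derivative_unique_at by metis
  qed
  then show ?thesis using d by simp
qed

lemma smooth_Psi_snd: "smooth_on \<Sigma> (\<lambda>p. \<Psi> (snd p))"
  and smooth_A_snd: "smooth_on \<Sigma> (\<lambda>p. A (snd p))"
  using smooth_on_snd smooth_Psi smooth_A op1 op2 by blast+

lemma Psi_section:
  assumes y: "smooth_on \<Sigma> y" and \<phi>: "\<And>p. p \<in> \<Sigma> \<Longrightarrow> \<phi> p = \<Psi> (snd p) *v y p"
    and uv: "u \<in> I1" "v \<in> I2"
  shows "D \<phi> (u, v) (1, 0) = \<Psi> v *v D y (u, v) (1, 0)"
    and "D \<phi> (u, v) (0, 1) = \<Psi> v *v (D y (u, v) (0, 1) + J v *v y (u, v))"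
proof -
  have uv': "(u, v) \<in> \<Sigma>" using uv by simp
  have sm: "smooth_on \<Sigma> (\<lambda>p. \<Psi> (snd p) *v y p)"
    by (intro smooth_on_mv opS smooth_Psi_snd y)
  have eq: "D \<phi> (u, v) X = D (\<lambda>p. \<Psi> (snd p) *v y p) (u, v) X" for X
    by (rule D_cong[OF opS uv', symmetric])
      (use \<phi> smooth_on_imp_has_derivative[OF sm uv'] in \<open>auto simp: differentiable_def\<close>)
  have "((\<lambda>u. \<Psi> v *v y (u, v)) has_vector_derivative \<Psi> v *v D y (u, v) (1, 0)) (at u)"
    using mv_has_vector_derivative[OF has_vector_derivative_const partial_derivatives(1)[OF y uv']]
    by simp
  then show "D \<phi> (u, v) (1, 0) = \<Psi> v *v D y (u, v) (1, 0)"
    unfolding eq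
    by (rule vector_derivative_unique_at[OF partial_derivatives(1)[OF sm uv', unfolded snd_conv]])
  have "((\<lambda>v. \<Psi> v *v y (u, v)) has_vector_derivative
      \<Psi> v *v (D y (u, v) (0, 1) + J v *v y (u, v))) (at v)"
    using mv_has_vector_derivative[OF Psi_matrix_derivative[OF uv(2)] partial_derivatives(2)[OF y uv']]
    by (simp add: mv_simps matrix_vector_mul_assoc)
  then show "D \<phi> (u, v) (0, 1) = \<Psi> v *v (D y (u, v) (0, 1) + J v *v y (u, v))"
    unfolding eq
    by (rule vector_derivative_unique_at[OF partial_derivatives(2)[OF sm uv', unfolded snd_conv]])
qed

lemma C_facts:
  assumes "u \<in> I1"
  shows "subspace (C u)" "dim (C u) = 2" "x \<in> C u \<Longrightarrow> B l0 x = 0"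
    "x \<in> C u \<Longrightarrow> y \<in> C u \<Longrightarrow> B x y = 0"
  using legendre_C assms
  unfolding legendre_map_def subbundle_def totally_isotropic_def perp_L0 by blast+

lemma C_derivative:
  assumes "\<phi> \<in> sections I1 C" "u \<in> I1"
  shows "B l0 (D \<phi> u 1) = 0" "x \<in> C u \<Longrightarrow> B (D \<phi> u 1) x = 0"
proof -
  have "D \<phi> u 1 \<in> derived_bundle I1 C u"
    using assms(1) unfolding derived_bundle_def by blast
  then have "D \<phi> u 1 \<in> perp_in B (perp_in B UNIV (L v0)) (C u)"
    using legendre_C assms(2) unfolding legendre_map_def by blast
  then show "B l0 (D \<phi> u 1) = 0" "x \<in> C u \<Longrightarrow> B (D \<phi> u 1) x = 0"
    unfolding perp_L0 unfolding perp_in_def by auto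
qed

lemma J_on_C: "u \<in> I1 \<Longrightarrow> x \<in> C u \<Longrightarrow> J v *v x = - (B (m v) x *\<^sub>R l0)"
  by (simp add: wedge_apply C_facts)

lemma A_f: "u \<in> I1 \<Longrightarrow> v \<in> I2 \<Longrightarrow> y \<in> f (u, v) \<Longrightarrow> A v *v y \<in> C u"
  by (auto simp: f_eq A_inv)

text \<open>A section \<open>\<phi>\<close> of \<open>f\<close> corresponds to \<open>y = A \<phi>\<close> with \<open>y(u, v) \<in> C(u)\<close>; since \<open>C(u)\<close> does not
  depend on \<open>v\<close>, also \<open>y\<^sub>v\<close> has values in \<open>C(u)\<close>.\<close>

lemma f_section:
  assumes "\<phi> \<in> sections \<Sigma> f" and y_def: "y = (\<lambda>p. A (snd p) *v \<phi> p)" and uv: "u \<in> I1" "v \<in> I2"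
  shows "smooth_on \<Sigma> y" "y (u, v) \<in> C u" "\<phi> (u, v) = \<Psi> v *v y (u, v)"
    "D y (u, v) (0, 1) \<in> C u" "D \<phi> (u, v) (1, 0) = \<Psi> v *v D y (u, v) (1, 0)"
    "D \<phi> (u, v) (0, 1) = \<Psi> v *v (D y (u, v) (0, 1) - B (m v) (y (u, v)) *\<^sub>R l0)"
proof -
  have \<phi>: "smooth_on \<Sigma> \<phi>" "\<And>p. p \<in> \<Sigma> \<Longrightarrow> \<phi> p \<in> f p"
    using assms(1) by (auto simp: sections_def)
  show sm: "smooth_on \<Sigma> y"
    unfolding y_def by (intro smooth_on_mv opS smooth_A_snd \<phi>)
  have yC: "y (u, v) \<in> C u" if "v \<in> I2" for v
    using A_f[OF uv(1) that \<phi>(2)] uv(1) that by (simp add: y_def)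
  then show "y (u, v) \<in> C u" using uv by simp
  have eq: "\<phi> p = \<Psi> (snd p) *v y p" if "p \<in> \<Sigma>" for p
    using that A_inv(4) by (auto simp: y_def)
  then show "\<phi> (u, v) = \<Psi> v *v y (u, v)" using uv by fastforce
  show "D y (u, v) (0, 1) \<in> C u"
    using derivative_in_subspace[OF C_facts(1)[OF uv(1)] op2 uv(2) yC partial_derivatives(2)[OF sm]]
      uv by simp
  show "D \<phi> (u, v) (1, 0) = \<Psi> v *v D y (u, v) (1, 0)"
    "D \<phi> (u, v) (0, 1) = \<Psi> v *v (D y (u, v) (0, 1) - B (m v) (y (u, v)) *\<^sub>R l0)"
    using Psi_section[OF sm eq uv] J_on_C[OF uv(1) yC[OF uv(2)]] by simp_all
qed

text \<open>Otherwise \<open>\<phi>\<^sub>v \<in> f\<close> for all sections \<open>\<phi>\<close> of \<open>f\<close>, contrary to the immersion condition.\<close>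

lemma m_nonzero_on_C:
  assumes "u \<in> I1" "v \<in> I2"
  shows "\<exists>x\<in>C u. B (m v) x \<noteq> 0"
proof (rule ccontr)
  assume zero: "\<not> ?thesis"
  have "D \<phi> (u, v) (0, 1) \<in> f (u, v)" if "\<phi> \<in> sections \<Sigma> f" for \<phi>
    using f_section(2,4,6)[OF that refl assms] zero f_eq[OF assms] by auto
  moreover have "immersed \<Sigma> f" using legendre unfolding legendre_map_def by blast
  ultimately have "(0, 1) = (0 :: real \<times> real)"
    using assms unfolding immersed_def by (metis SigmaI)
  then show False by (simp add: zero_prod_def)
qed

lemma kernel_of_m:
  assumes "u \<in> I1" "v \<in> I2" "x \<in> C u" "y \<in> C u" "B (m v) x = 0" "B (m v) y = 0" "y \<noteq> 0"
  shows "x \<in> span {y}"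
proof -
  obtain z where z: "z \<in> C u" "B (m v) z \<noteq> 0" using m_nonzero_on_C assms(1,2) by blast
  have "z \<notin> span {y}" using z(2) assms(6) by (auto simp: span_singleton B_simps)
  then have "x \<in> span {z, y}"
    using plane_eq_span[OF C_facts(1,2)[OF assms(1)] z(1) assms(4)] assms(3,7) by blast
  then obtain k where k: "x - k *\<^sub>R z \<in> span {y}" by (auto simp: span_breakdown_eq)
  then obtain r where "x - k *\<^sub>R z = r *\<^sub>R y" by (auto simp: span_singleton)
  then have "B (m v) (x - k *\<^sub>R z) = B (m v) (r *\<^sub>R y)" by simp
  then have "B (m v) (x - k *\<^sub>R z) = 0" using assms(6) by (simp only: B_simps)
  then have "k = 0" using assms(5) z(2) by (simp add: B_simps)
  then show ?thesis using k by simp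
qed

section \<open>Curvature spheres\<close>

lemma s_facts:
  shows "subbundle 1 \<Sigma> s1" "subbundle 1 \<Sigma> s2"
    "p \<in> \<Sigma> \<Longrightarrow> s1 p \<inter> s2 p = {0}"
    "\<phi> \<in> sections \<Sigma> s1 \<Longrightarrow> \<phi> \<in> sections \<Sigma> f" "\<psi> \<in> sections \<Sigma> s2 \<Longrightarrow> \<psi> \<in> sections \<Sigma> f"
    "\<phi> \<in> sections \<Sigma> s1 \<Longrightarrow> p \<in> \<Sigma> \<Longrightarrow> D \<phi> p (1, 0) \<in> f p"
    "\<psi> \<in> sections \<Sigma> s2 \<Longrightarrow> p \<in> \<Sigma> \<Longrightarrow> D \<psi> p (0, 1) \<in> f p"
proof -
  note c = umbilic_free[unfolded curvature_data_def]
  have c1: "\<forall>\<sigma>\<in>sections \<Sigma> s1. \<forall>X\<in>sections \<Sigma> T1. (\<lambda>p. D \<sigma> p (X p)) \<in> sections \<Sigma> f"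
    and c2: "\<forall>\<sigma>\<in>sections \<Sigma> s2. \<forall>X\<in>sections \<Sigma> T2. (\<lambda>p. D \<sigma> p (X p)) \<in> sections \<Sigma> f"
    using c by - (elim conjE, assumption)+
  show "subbundle 1 \<Sigma> s1" "subbundle 1 \<Sigma> s2" "p \<in> \<Sigma> \<Longrightarrow> s1 p \<inter> s2 p = {0}"
    using c by blast+
  show "\<phi> \<in> sections \<Sigma> s1 \<Longrightarrow> \<phi> \<in> sections \<Sigma> f" "\<psi> \<in> sections \<Sigma> s2 \<Longrightarrow> \<psi> \<in> sections \<Sigma> f"
    using c unfolding sections_def by (auto, blast+)
  show "D \<phi> p (1, 0) \<in> f p" if "\<phi> \<in> sections \<Sigma> s1" "p \<in> \<Sigma>"
  proof -
    have "(\<lambda>p. D \<phi> p (1, 0)) \<in> sections \<Sigma> f" using bspec[OF bspec[OF c1 that(1)] coordinates(1)] by simp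
    then show ?thesis using that(2) unfolding sections_def by blast
  qed
  show "D \<psi> p (0, 1) \<in> f p" if "\<psi> \<in> sections \<Sigma> s2" "p \<in> \<Sigma>"
  proof -
    have "(\<lambda>p. D \<psi> p (0, 1)) \<in> sections \<Sigma> f" using bspec[OF bspec[OF c2 that(1)] coordinates(2)] by simp
    then show ?thesis using that(2) unfolding sections_def by blast
  qed
qed

text \<open>\<open>s2 = \<Psi> (C \<inter> m\<^sup>\<bottom>)\<close>.\<close>

lemma s2_eq:
  assumes "u \<in> I1" "v \<in> I2"
  obtains y where "y \<in> C u" "y \<noteq> 0" "B (m v) y = 0" "s2 (u, v) = span {\<Psi> v *v y}"
proof -
  have uv: "(u, v) \<in> \<Sigma>" using assms by simp
  obtain \<phi> where \<phi>: "\<phi> \<in> sections \<Sigma> s2" "\<phi> (u, v) \<noteq> 0"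
    using nonzero_section[OF s_facts(2) regular(2) uv, of "(1, 0)"] by (auto simp: zero_prod_def)
  define y where "y = (\<lambda>p. A (snd p) *v \<phi> p)"
  note F = f_section[OF s_facts(5)[OF \<phi>(1)] y_def assms]
  have "A v *v D \<phi> (u, v) (0, 1) \<in> C u" using A_f[OF assms s_facts(7)[OF \<phi>(1) uv]] .
  then have "B l0 (D y (u, v) (0, 1) - B (m v) (y (u, v)) *\<^sub>R l0) = 0"
    using C_facts(3)[OF assms(1)] F(6) A_inv(3)[OF assms(2)] by simp
  then have zero: "B (m v) (y (u, v)) = 0"
    using C_facts(3)[OF assms(1) F(4)] by (simp add: B_simps l0(2))
  have "s2 (u, v) = span {\<phi> (u, v)}"
    using line_bundle_eq_span[OF s_facts(2) uv _ \<phi>(2)] \<phi>(1) uv by (auto simp: sections_def)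
  moreover have "y (u, v) \<noteq> 0" using F(3) \<phi>(2) by auto
  ultimately show ?thesis using that[OF F(2) _ zero] F(3) by simp
qed

text \<open>The first two derivatives of \<open>l\<close> at the base point, read in \<open>L\<^sub>0\<^sup>\<bottom>\<close>. Since \<open>s2\<close> is
  immersed in the direction \<open>\<partial>\<^sub>v\<close>, they separate the points of every \<open>C u\<close>.\<close>

definition e1 where "e1 = m v0"
definition e2 where "e2 = D m v0 1"

lemma m_derivative_v0: "(m has_vector_derivative e2) (at v0)"
  unfolding e2_def using smooth_on_curve_derivative[OF smooth_m v0] .

lemma l0_e: "B l0 e1 = 0" "B l0 e2 = 0"
proof -
  show "B l0 e1 = 0" using l0_m[OF v0] by (simp add: e1_def)
  have "subspace {x. B l0 x = 0}" by (simp add: subspace_def B_simps)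
  then show "B l0 e2 = 0"
    using derivative_in_subspace[OF _ op2 v0 _ m_derivative_v0, of "{x. B l0 x = 0}"] l0_m by simp
qed

lemma e_separates:
  assumes u: "u \<in> I1" and x: "x \<in> C u" "B e1 x = 0" "B e2 x = 0"
  shows "x = 0"
proof (rule ccontr)
  assume "x \<noteq> 0"
  have uv: "(u, v0) \<in> \<Sigma>" using u v0 by simp
  obtain y where y: "y \<in> C u" "y \<noteq> 0" "B e1 y = 0" "s2 (u, v0) = span {y}"
    using s2_eq[OF u v0] by (auto simp: Psi_v0 e1_def)
  obtain k where k: "x = k *\<^sub>R y"
    using kernel_of_m[OF u v0 x(1) y(1)] x(2) y by (auto simp: e1_def span_singleton)
  then have y2: "B e2 y = 0" using \<open>x \<noteq> 0\<close> x(3) by (auto simp: B_simps)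
  have "D \<phi> (u, v0) (0, 1) \<in> s2 (u, v0)" if \<phi>: "\<phi> \<in> sections \<Sigma> s2" for \<phi>
  proof -
    define Y where "Y = (\<lambda>p. A (snd p) *v \<phi> p)"
    note F = f_section[OF s_facts(5)[OF \<phi>] Y_def u]
    have zero: "B (m v) (Y (u, v)) = 0" if v: "v \<in> I2" for v
    proof -
      obtain y where y: "B (m v) y = 0" "s2 (u, v) = span {\<Psi> v *v y}"
        using s2_eq[OF u v] by metis
      have "\<phi> (u, v) \<in> s2 (u, v)" using \<phi> u v by (auto simp: sections_def)
      then obtain k where "\<phi> (u, v) = k *\<^sub>R (\<Psi> v *v y)"
        using y(2) by (auto simp: span_singleton)
      then have "Y (u, v) = k *\<^sub>R y"
        using A_inv(3)[OF v] by (simp add: Y_def mv_simps)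
      then show ?thesis using y(1) by (simp add: B_simps)
    qed
    have Yk: "Y (u, v0) \<in> span {y}"
      using kernel_of_m[OF u v0 F(2)[OF v0] y(1) zero[OF v0]] y by (simp add: e1_def)
    have "((\<lambda>v. B (m v) (Y (u, v))) has_vector_derivative
        B e1 (D Y (u, v0) (0, 1)) + B e2 (Y (u, v0))) (at v0)"
      unfolding e1_def using B_has_vector_derivative[OF m_derivative_v0 partial_derivatives(2)[OF F(1)]]
        u v0 by simp
    then have "B e1 (D Y (u, v0) (0, 1)) + B e2 (Y (u, v0)) = 0"
      by (rule derivative_zero_if_constant[OF _ op2 v0 zero])
    moreover have "B e2 (Y (u, v0)) = 0" using Yk y2 by (auto simp: span_singleton B_simps)
    ultimately have "B (m v0) (D Y (u, v0) (0, 1)) = 0" by (simp add: e1_def)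
    then have "D Y (u, v0) (0, 1) \<in> span {y}"
      using kernel_of_m[OF u v0 F(4)[OF v0] y(1)] y by (simp add: e1_def)
    then show ?thesis
      using F(6)[OF v0] zero[OF v0] by (simp add: y(4) Psi_v0)
  qed
  then have "(0, 1) = (0 :: real \<times> real)"
    using regular(2) uv unfolding immersed_def by metis
  then show False by (simp add: zero_prod_def)
qed

section \<open>An adapted frame along the curve\<close>

text \<open>The section of \<open>C\<close> with prescribed products with \<open>e1\<close> and \<open>e2\<close>.\<close>

definition coord :: "real \<Rightarrow> real \<Rightarrow> real \<Rightarrow> real^6" where
  "coord a b u = (SOME x. x \<in> C u \<and> B e1 x = a \<and> B e2 x = b)"

lemma coord_unique:
  assumes "u \<in> I1" "x \<in> C u" "y \<in> C u" "B e1 x = B e1 y" "B e2 x = B e2 y"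
  shows "x = y"
  using e_separates[OF assms(1), of "x - y"] C_facts(1)[OF assms(1)] assms(2-5)
  by (simp add: subspace_diff B_simps)

text \<open>Cramer's rule in a local frame \<open>F\<close> of \<open>C\<close>, with determinant \<open>\<delta>\<close>.\<close>

lemma coord_local:
  assumes "u \<in> I1"
  shows "\<exists>U x. open U \<and> u \<in> U \<and> U \<subseteq> I1 \<and> smooth_on U x \<and>
    (\<forall>w\<in>U. x w \<in> C w \<and> B e1 (x w) = a \<and> B e2 (x w) = b)"
proof -
  have "subbundle 2 I1 C" using legendre_C unfolding legendre_map_def by blast
  then have "\<exists>U e. open U \<and> u \<in> U \<and> U \<subseteq> I1 \<and> (\<forall>i<2. smooth_on U (e i)) \<and>
      (\<forall>q\<in>U. C q = span ((\<lambda>i::nat. e i q) ` {..<2}))"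
    using assms unfolding subbundle_def by blast
  then obtain U and F :: "nat \<Rightarrow> real \<Rightarrow> real^6" where U: "open U" "u \<in> U" "U \<subseteq> I1"
    and F: "smooth_on U (F 0)" "smooth_on U (F 1)" "\<forall>q\<in>U. C q = span ((\<lambda>i. F i q) ` {..<2})"
    by (elim exE conjE) (rule that, auto)
  have CF: "C q = span {F 0 q, F 1 q}" if "q \<in> U" for q
  proof -
    have "{..<2} = {0, 1 :: nat}" by auto
    then show ?thesis using F(3) that by auto
  qed
  define \<delta> where "\<delta> q = B e1 (F 0 q) * B e2 (F 1 q) - B e1 (F 1 q) * B e2 (F 0 q)" for q
  have nz: "\<delta> q \<noteq> 0" if q: "q \<in> U" for q
  proof
    assume zero: "\<delta> q = 0"
    have q1: "q \<in> I1" using q U by blast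
    have mem: "F 0 q \<in> C q" "F 1 q \<in> C q" unfolding CF[OF q] by (auto intro: span_base)
    have comb: "r *\<^sub>R F 0 q + t *\<^sub>R F 1 q \<in> C q" for r t
      using mem C_facts(1)[OF q1] by (simp add: subspace_add subspace_scale)
    have dep: "r = 0 \<and> t = 0" if "r *\<^sub>R F 0 q + t *\<^sub>R F 1 q = 0" for r t
    proof (rule ccontr)
      assume "\<not> (r = 0 \<and> t = 0)"
      then have "F 0 q \<in> span {F 1 q} \<or> F 1 q \<in> span {F 0 q}"
      proof (cases "r = 0")
        case True
        then show ?thesis using that \<open>\<not> (r = 0 \<and> t = 0)\<close> by (auto simp: span_zero)
      next
        case False
        then have "F 0 q = (- t / r) *\<^sub>R F 1 q"
          using that by (simp add: add_eq_0_iff2 divide_inverse)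
            (metis (no_types, lifting) add_eq_0_iff scaleR_left.minus scaleR_minus_right
              divideR_right mult.commute scaleR_scaleR)
        then show ?thesis by (metis span_base span_scale insertI1)
      qed
      then have "span {F 0 q, F 1 q} = span {F 1 q} \<or> span {F 1 q, F 0 q} = span {F 0 q}"
        using span_redundant by blast
      then have "dim (C q) \<le> 1"
        unfolding CF[OF q] using dim_le_card[of "span {F 1 q}" "{F 1 q}"]
          dim_le_card[of "span {F 0 q}" "{F 0 q}"]
        by (auto simp del: dim_span simp: insert_commute)
      then show False using C_facts(2)[OF q1] by simp
    qed
    have "B e2 (F 1 q) *\<^sub>R F 0 q + (- B e2 (F 0 q)) *\<^sub>R F 1 q = 0"
      using comb[of "B e2 (F 1 q)" "- B e2 (F 0 q)"] zero
      by (intro e_separates[OF q1]) (auto simp: B_simps \<delta>_def algebra_simps)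
    from dep[OF this] have z2: "B e2 (F 1 q) = 0" "B e2 (F 0 q) = 0" by auto
    have "B e1 (F 1 q) *\<^sub>R F 0 q + (- B e1 (F 0 q)) *\<^sub>R F 1 q = 0"
      using comb[of "B e1 (F 1 q)" "- B e1 (F 0 q)"] z2
      by (intro e_separates[OF q1]) (auto simp: B_simps algebra_simps)
    from dep[OF this] have "F 0 q = 0"
      using e_separates[OF q1 mem(1)] z2 by simp
    then show False using dep[of 1 0] by simp
  qed
  define x where "x q = ((a * B e2 (F 1 q) - b * B e1 (F 1 q)) / \<delta> q) *\<^sub>R F 0 q +
      ((b * B e1 (F 0 q) - a * B e2 (F 0 q)) / \<delta> q) *\<^sub>R F 1 q" for q
  have "smooth_on U \<delta>"
    unfolding \<delta>_def using F U by (intro smooth_on_diff smooth_on_mult smooth_on_B) auto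
  then have "smooth_on U x"
    unfolding x_def using F U nz
    by (intro smooth_on_add smooth_on_scaleR smooth_on_divide smooth_on_diff smooth_on_mult smooth_on_B)
      auto
  moreover have "x q \<in> C q \<and> B e1 (x q) = a \<and> B e2 (x q) = b" if q: "q \<in> U" for q
  proof (intro conjI)
    show "x q \<in> C q"
      unfolding x_def CF[OF q] by (intro span_add span_scale span_base) auto
    show "B e1 (x q) = a" "B e2 (x q) = b"
      using nz[OF q] by (simp_all add: x_def B_simps divide_simps) (simp_all add: \<delta>_def algebra_simps)
  qed
  ultimately show ?thesis using U by blast
qed

lemma coord:
  assumes "u \<in> I1"
  shows "coord a b u \<in> C u" "B e1 (coord a b u) = a" "B e2 (coord a b u) = b"
proof -
  have "\<exists>x. x \<in> C u \<and> B e1 x = a \<and> B e2 x = b" using coord_local[OF assms] by blast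
  then have "coord a b u \<in> C u \<and> B e1 (coord a b u) = a \<and> B e2 (coord a b u) = b"
    unfolding coord_def by (rule someI_ex)
  then show "coord a b u \<in> C u" "B e1 (coord a b u) = a" "B e2 (coord a b u) = b" by auto
qed

lemma smooth_coord: "smooth_on I1 (coord a b)"
proof (rule smooth_on_local)
  fix u assume u: "u \<in> I1"
  obtain U x where U: "open U" "u \<in> U" "U \<subseteq> I1" "smooth_on U x"
    and x: "\<forall>w\<in>U. x w \<in> C w \<and> B e1 (x w) = a \<and> B e2 (x w) = b"
    using coord_local[OF u, of a b] by (elim exE conjE)
  have "coord a b w = x w" if "w \<in> U" for w
    using coord_unique[of w "coord a b w" "x w"] coord[of w a b] bspec[OF x that] subsetD[OF U(3) that]
    by simp
  then have "smooth_on U (coord a b)" using smooth_on_cong[OF U(1), of "coord a b" x] U(4) by simp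
  then show "\<exists>U. open U \<and> u \<in> U \<and> smooth_on U (coord a b)" using U by blast
qed

text \<open>The frame of \<open>C\<close> dual to \<open>e1, e2\<close>, the derivative \<open>\<nu>\<close> of \<open>\<epsilon>2\<close>, its squared length \<open>g\<close>, and the
  factor \<open>h\<close> with \<open>\<epsilon>1' = h \<nu>\<close> (see \<open>eps1_derivative\<close>; \<open>g > 0\<close> is \<open>g_pos\<close>).\<close>

definition \<epsilon>1 where "\<epsilon>1 = coord 1 0"
definition \<epsilon>2 where "\<epsilon>2 = coord 0 1"
definition \<nu> where "\<nu> u = D \<epsilon>2 u 1"
definition g where "g u = B (\<nu> u) (\<nu> u)"
definition h where "h u = B (D \<epsilon>1 u 1) (\<nu> u) / g u"

lemma smooth_eps: "smooth_on I1 \<epsilon>1" "smooth_on I1 \<epsilon>2"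
  unfolding \<epsilon>1_def \<epsilon>2_def using smooth_coord by auto

lemma eps: assumes "u \<in> I1"
  shows "\<epsilon>1 u \<in> C u" "\<epsilon>2 u \<in> C u" "B e1 (\<epsilon>1 u) = 1" "B e2 (\<epsilon>1 u) = 0" "B e1 (\<epsilon>2 u) = 0" "B e2 (\<epsilon>2 u) = 1"
  unfolding \<epsilon>1_def \<epsilon>2_def using coord[OF assms] by auto

lemma eps_sections: "\<epsilon>1 \<in> sections I1 C" "\<epsilon>2 \<in> sections I1 C"
  using eps smooth_eps by (auto simp: sections_def)

lemma C_expand:
  assumes "u \<in> I1" "x \<in> C u"
  shows "x = B e1 x *\<^sub>R \<epsilon>1 u + B e2 x *\<^sub>R \<epsilon>2 u"
proof (rule coord_unique[OF assms])
  show "B e1 x *\<^sub>R \<epsilon>1 u + B e2 x *\<^sub>R \<epsilon>2 u \<in> C u"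
    using C_facts(1)[OF assms(1)] eps(1,2)[OF assms(1)] by (intro subspace_add subspace_scale)
qed (simp_all add: B_simps eps[OF assms(1)])

lemma C_eq_span: assumes "u \<in> I1" shows "C u = span {\<epsilon>1 u, \<epsilon>2 u}"
proof
  show "C u \<subseteq> span {\<epsilon>1 u, \<epsilon>2 u}"
  proof
    fix x assume "x \<in> C u"
    moreover have "B e1 x *\<^sub>R \<epsilon>1 u + B e2 x *\<^sub>R \<epsilon>2 u \<in> span {\<epsilon>1 u, \<epsilon>2 u}"
      by (intro span_add span_scale span_base) auto
    ultimately show "x \<in> span {\<epsilon>1 u, \<epsilon>2 u}"
      using C_expand[OF assms, of x] by simp
  qed
  show "span {\<epsilon>1 u, \<epsilon>2 u} \<subseteq> C u"
    using eps[OF assms] C_facts(1)[OF assms] by (intro span_minimal) auto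
qed

lemma eps_derivative:
  assumes "u \<in> I1"
  shows "(\<epsilon>1 has_vector_derivative D \<epsilon>1 u 1) (at u)" "(\<epsilon>2 has_vector_derivative \<nu> u) (at u)"
  unfolding \<nu>_def using smooth_on_curve_derivative smooth_eps assms by blast+

lemma constant_product_derivative:
  assumes "(x has_vector_derivative x') (at u)" "u \<in> I1" "\<And>w. w \<in> I1 \<Longrightarrow> B y (x w) = c"
  shows "B y x' = 0"
proof -
  have "((\<lambda>w. B y (x w)) has_vector_derivative B y x') (at u)"
    using B_has_vector_derivative[OF has_vector_derivative_const assms(1), of y] by (simp add: B_simps)
  then show ?thesis by (rule derivative_zero_if_constant[OF _ op1 assms(2,3)])
qed

lemma smooth_nu: "smooth_on I1 \<nu>"
  unfolding \<nu>_def by (intro smooth_on_D smooth_eps)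

lemma smooth_g: "smooth_on I1 g"
  unfolding g_def by (intro smooth_on_B op1 smooth_nu)

lemma eps_products:
  assumes "u \<in> I1"
  shows "B l0 (\<epsilon>1 u) = 0" "B l0 (\<epsilon>2 u) = 0" "B (\<epsilon>1 u) (\<epsilon>1 u) = 0" "B (\<epsilon>2 u) (\<epsilon>2 u) = 0"
    "B (\<epsilon>1 u) (\<epsilon>2 u) = 0" "B (\<epsilon>2 u) (\<epsilon>1 u) = 0"
  using C_facts(3,4)[OF assms] eps(1,2)[OF assms] by auto

lemma eps_derivative_products:
  assumes "u \<in> I1"
  shows "B l0 (D \<epsilon>1 u 1) = 0" "B l0 (\<nu> u) = 0" "B e1 (D \<epsilon>1 u 1) = 0" "B e1 (\<nu> u) = 0"
    "B e2 (D \<epsilon>1 u 1) = 0" "B e2 (\<nu> u) = 0"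
    "x \<in> C u \<Longrightarrow> B (D \<epsilon>1 u 1) x = 0" "x \<in> C u \<Longrightarrow> B (\<nu> u) x = 0"
proof -
  show "B l0 (D \<epsilon>1 u 1) = 0" "B l0 (\<nu> u) = 0"
    "x \<in> C u \<Longrightarrow> B (D \<epsilon>1 u 1) x = 0" "x \<in> C u \<Longrightarrow> B (\<nu> u) x = 0"
    unfolding \<nu>_def using C_derivative eps_sections assms by blast+
  show "B e1 (D \<epsilon>1 u 1) = 0" "B e1 (\<nu> u) = 0" "B e2 (D \<epsilon>1 u 1) = 0" "B e2 (\<nu> u) = 0"
    by (rule constant_product_derivative[OF eps_derivative(1)[OF assms] assms]
        constant_product_derivative[OF eps_derivative(2)[OF assms] assms]; simp add: eps)+
qed

text \<open>The Leibniz rule for \<open>y = (e1, y) \<epsilon>1 + (e2, y) \<epsilon>2\<close>.\<close>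

lemma curve_in_C_derivative:
  assumes "u \<in> I1" "\<And>w. w \<in> I1 \<Longrightarrow> y w \<in> C w" "(y has_vector_derivative y') (at u)"
  shows "y' = B e1 y' *\<^sub>R \<epsilon>1 u + B e2 y' *\<^sub>R \<epsilon>2 u + (B e1 (y u) *\<^sub>R D \<epsilon>1 u 1 + B e2 (y u) *\<^sub>R \<nu> u)"
proof -
  have eq: "B e1 (y w) *\<^sub>R \<epsilon>1 w + B e2 (y w) *\<^sub>R \<epsilon>2 w = y w" if "w \<in> I1" for w
    by (rule C_expand[OF that assms(2)[OF that], symmetric])
  have "((\<lambda>w. B e (y w)) has_vector_derivative B e y') (at u)" for e
    using B_has_vector_derivative[OF has_vector_derivative_const assms(3), of e] by (simp add: B_simps)
  then have "((\<lambda>w. B e1 (y w) *\<^sub>R \<epsilon>1 w + B e2 (y w) *\<^sub>R \<epsilon>2 w) has_vector_derivative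
      (B e1 (y u) *\<^sub>R D \<epsilon>1 u 1 + B e1 y' *\<^sub>R \<epsilon>1 u) + (B e2 (y u) *\<^sub>R \<nu> u + B e2 y' *\<^sub>R \<epsilon>2 u)) (at u)"
    by (intro has_vector_derivative_add scaleR_has_vector_derivative
        eps_derivative assms(1))
  then have "(y has_vector_derivative
      (B e1 (y u) *\<^sub>R D \<epsilon>1 u 1 + B e1 y' *\<^sub>R \<epsilon>1 u) + (B e2 (y u) *\<^sub>R \<nu> u + B e2 y' *\<^sub>R \<epsilon>2 u)) (at u)"
    by (rule has_vector_derivative_transform_within_open[OF _ op1 assms(1)])
      (rule eq)
  from vector_derivative_unique_at[OF assms(3) this]
  show ?thesis by (rule trans) (simp add: algebra_simps)
qed

lemma section_of_s1:
  assumes "\<phi> \<in> sections \<Sigma> s1" "u \<in> I1" "v \<in> I2"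
  defines "y \<equiv> A v *v \<phi> (u, v)"
  shows "y \<in> C u" "\<phi> (u, v) = \<Psi> v *v y" "B e1 y *\<^sub>R D \<epsilon>1 u 1 + B e2 y *\<^sub>R \<nu> u \<in> C u"
    "\<exists>a b. D \<phi> (u, v) (1, 0) = \<Psi> v *v (a *\<^sub>R \<epsilon>1 u + b *\<^sub>R \<epsilon>2 u + (B e1 y *\<^sub>R D \<epsilon>1 u 1 + B e2 y *\<^sub>R \<nu> u))
      \<and> ((\<lambda>w. B e1 (A v *v \<phi> (w, v))) has_vector_derivative a) (at u)
      \<and> ((\<lambda>w. B e2 (A v *v \<phi> (w, v))) has_vector_derivative b) (at u)"
proof -
  define Y where "Y = (\<lambda>p. A (snd p) *v \<phi> p)"
  note F = f_section[OF s_facts(4)[OF assms(1)] Y_def]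
  have uv: "(u, v) \<in> \<Sigma>" using assms by simp
  have Yy: "Y (u, v) = y" by (simp add: Y_def y_def)
  show "y \<in> C u" "\<phi> (u, v) = \<Psi> v *v y" using F(2,3)[OF assms(2,3)] Yy by auto
  define a where "a = B e1 (D Y (u, v) (1, 0))"
  define b where "b = B e2 (D Y (u, v) (1, 0))"
  note dY = partial_derivatives(1)[OF F(1)[OF assms(2,3)] uv]
  have d: "((\<lambda>w. B e1 (Y (w, v))) has_vector_derivative a) (at u)"
    "((\<lambda>w. B e2 (Y (w, v))) has_vector_derivative b) (at u)"
    unfolding a_def b_def using B_has_vector_derivative[OF has_vector_derivative_const dY]
    by (simp_all add: B_simps)
  have DY: "D Y (u, v) (1, 0) =
      a *\<^sub>R \<epsilon>1 u + b *\<^sub>R \<epsilon>2 u + (B e1 y *\<^sub>R D \<epsilon>1 u 1 + B e2 y *\<^sub>R \<nu> u)"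
    unfolding a_def b_def Yy[symmetric]
    by (rule curve_in_C_derivative[OF assms(2) F(2)[OF _ assms(3)] dY])
  have "A v *v D \<phi> (u, v) (1, 0) \<in> C u" using A_f[OF assms(2,3) s_facts(6)[OF assms(1) uv]] .
  then have "D Y (u, v) (1, 0) \<in> C u" using F(5)[OF assms(2,3)] A_inv(3)[OF assms(3)] by simp
  moreover have "a *\<^sub>R \<epsilon>1 u + b *\<^sub>R \<epsilon>2 u \<in> C u"
    using C_facts(1)[OF assms(2)] eps(1,2)[OF assms(2)] by (intro subspace_add subspace_scale)
  ultimately show "B e1 y *\<^sub>R D \<epsilon>1 u 1 + B e2 y *\<^sub>R \<nu> u \<in> C u"
    using subspace_diff[OF C_facts(1)[OF assms(2)]] DY by fastforce
  show "\<exists>a b. D \<phi> (u, v) (1, 0) = \<Psi> v *v (a *\<^sub>R \<epsilon>1 u + b *\<^sub>R \<epsilon>2 u + (B e1 y *\<^sub>R D \<epsilon>1 u 1 + B e2 y *\<^sub>R \<nu> u))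
      \<and> ((\<lambda>w. B e1 (A v *v \<phi> (w, v))) has_vector_derivative a) (at u)
      \<and> ((\<lambda>w. B e2 (A v *v \<phi> (w, v))) has_vector_derivative b) (at u)"
    using F(5)[OF assms(2,3)] DY d by (intro exI[of _ a] exI[of _ b]) (simp add: Y_def)
qed

text \<open>The section \<open>\<epsilon>2\<close> spans \<open>s2\<close> along \<open>v = v0\<close>, where it differs from \<open>s1\<close>; as \<open>C\<close> is
  immersed, its derivative leaves \<open>C\<close>.\<close>

lemma nu_notin_C:
  assumes u: "u \<in> I1" shows "\<nu> u \<notin> C u"
proof
  assume nu: "\<nu> u \<in> C u"
  note C = C_facts(1)[OF u]
  have uv: "(u, v0) \<in> \<Sigma>" using u v0 by simp
  obtain \<phi> where \<phi>: "\<phi> \<in> sections \<Sigma> s1" "\<phi> (u, v0) \<noteq> 0"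
    using nonzero_section[OF s_facts(1) regular(1) uv, of "(1, 0)"] by (auto simp: zero_prod_def)
  define y where "y = A v0 *v \<phi> (u, v0)"
  note s = section_of_s1[OF \<phi>(1) u v0, folded y_def]
  have y: "y = \<phi> (u, v0)" by (simp add: y_def A_v0)
  \<comment> \<open>otherwise \<open>y\<close> would lie in both curvature spheres\<close>
  have "B e1 y \<noteq> 0"
  proof
    assume "B e1 y = 0"
    obtain z where z: "z \<in> C u" "z \<noteq> 0" "B e1 z = 0" "s2 (u, v0) = span {z}"
      using s2_eq[OF u v0] by (auto simp: Psi_v0 e1_def)
    have "y \<in> s2 (u, v0)"
      using kernel_of_m[OF u v0 s(1) z(1)] \<open>B e1 y = 0\<close> z by (simp add: e1_def)
    moreover have "y \<in> s1 (u, v0)" using \<phi>(1) uv by (auto simp: y sections_def)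
    ultimately have "y = 0" using s_facts(3)[OF uv] by blast
    then show False using \<phi>(2) y by simp
  qed
  moreover have "B e1 y *\<^sub>R D \<epsilon>1 u 1 \<in> C u"
    using subspace_diff[OF C s(3) subspace_scale[OF C nu, of "B e2 y"]] by simp
  ultimately have d1: "D \<epsilon>1 u 1 \<in> C u"
    using subspace_scale[OF C, of "B e1 y *\<^sub>R D \<epsilon>1 u 1" "inverse (B e1 y)"] by simp
  have "D \<sigma> u 1 \<in> C u" if \<sigma>: "\<sigma> \<in> sections I1 C" for \<sigma>
  proof -
    have d: "(\<sigma> has_vector_derivative D \<sigma> u 1) (at u)"
      using smooth_on_curve_derivative \<sigma> u unfolding sections_def by blast
    have "D \<sigma> u 1 = B e1 (D \<sigma> u 1) *\<^sub>R \<epsilon>1 u + B e2 (D \<sigma> u 1) *\<^sub>R \<epsilon>2 u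
        + (B e1 (\<sigma> u) *\<^sub>R D \<epsilon>1 u 1 + B e2 (\<sigma> u) *\<^sub>R \<nu> u)"
      using \<sigma> by (intro curve_in_C_derivative[OF u _ d]) (auto simp: sections_def)
    also have "\<dots> \<in> C u"
      using C nu d1 eps(1,2)[OF u] by (intro subspace_add subspace_scale)
    finally show ?thesis .
  qed
  moreover have "immersed I1 C" using legendre_C unfolding legendre_map_def by blast
  ultimately have "(1::real) = 0" using u unfolding immersed_def by metis
  then show False by simp
qed

lemma eps_independent:
  assumes "u \<in> I1" shows "\<epsilon>1 u \<notin> span {\<epsilon>2 u}" "\<epsilon>2 u \<noteq> 0" "\<epsilon>1 u \<noteq> 0"
  using eps[OF assms] by (auto simp: span_singleton B_simps)

lemma g_pos: assumes "u \<in> I1" shows "g u > 0"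
  unfolding g_def
  using positive_off_null_plane[OF eps_independent(1,2)[OF assms], of "\<nu> u"] nu_notin_C[OF assms]
    eps_products[OF assms] eps_derivative_products(8)[OF assms] eps(1,2)[OF assms] C_eq_span[OF assms]
  by simp

text \<open>\<open>C\<close> is the orthogonal complement of the 4-dimensional space \<open>\<langle>l0, \<nu>, \<epsilon>1, \<epsilon>2\<rangle>\<close>. As \<open>e1, e2\<close> separate
  the points of \<open>C\<close>, vectors can be compared by their products with \<open>l0, \<epsilon>1, \<epsilon>2, \<nu>, e1, e2\<close>.\<close>

lemma in_C_if_orthogonal:
  assumes u: "u \<in> I1" and x: "B l0 x = 0" "B (\<epsilon>1 u) x = 0" "B (\<epsilon>2 u) x = 0" "B (\<nu> u) x = 0"
  shows "x \<in> C u"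
proof -
  note p = eps_products[OF u] eps_derivative_products(2,8)[OF u] eps(1,2)[OF u]
  define V where "V = span {\<nu> u, l0, \<epsilon>1 u, \<epsilon>2 u}"
  have "l0 \<notin> span {\<epsilon>1 u, \<epsilon>2 u}"
  proof
    assume "l0 \<in> span {\<epsilon>1 u, \<epsilon>2 u}"
    then have "B l0 l0 = 0" using C_facts(3)[OF u] C_eq_span[OF u] by blast
    then show False using l0(2) by simp
  qed
  moreover have "\<nu> u \<notin> span {l0, \<epsilon>1 u, \<epsilon>2 u}"
  proof
    assume "\<nu> u \<in> span {l0, \<epsilon>1 u, \<epsilon>2 u}"
    then obtain k where k: "\<nu> u - k *\<^sub>R l0 \<in> C u"
      by (auto simp: span_breakdown_eq[of _ l0] C_eq_span[OF u])
    then have "B l0 (\<nu> u - k *\<^sub>R l0) = 0" using C_facts(3)[OF u] by blast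
    then have "k = 0" using p l0(2) by (simp add: B_simps)
    then show False using k nu_notin_C[OF u] by simp
  qed
  ultimately have "independent {\<nu> u, l0, \<epsilon>1 u, \<epsilon>2 u}" "card {\<nu> u, l0, \<epsilon>1 u, \<epsilon>2 u} = 4"
    using eps_independent[OF u] by (auto simp: independent_insert card_insert_if span_base)
  then have "dim V = 4" unfolding V_def using dim_span_eq_card_independent by metis
  then have dim: "dim (perp B V) = 2" using dim_perp[of V] by (simp add: V_def)
  have perp: "y \<in> perp B V" if "B l0 y = 0" "B (\<epsilon>1 u) y = 0" "B (\<epsilon>2 u) y = 0" "B (\<nu> u) y = 0" for y
  proof -
    have "V \<subseteq> {z. B y z = 0}"
      unfolding V_def using that B_sym[of y]
      by (intro span_minimal) (auto simp: subspace_def B_simps)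
    then show ?thesis by (auto simp: perp_in_def)
  qed
  have "C u \<subseteq> perp B V"
    using C_facts(3,4)[OF u] p eps_derivative_products(8)[OF u] by (auto intro!: perp)
  then have "C u = perp B V"
    using subspace_dim_equal[OF C_facts(1)[OF u] subspace_perp[OF subspace_UNIV]] dim C_facts(2)[OF u]
    by simp
  then show ?thesis using perp x by simp
qed

lemma frame_eqI:
  assumes u: "u \<in> I1" and "B l0 x = B l0 y" "B (\<epsilon>1 u) x = B (\<epsilon>1 u) y" "B (\<epsilon>2 u) x = B (\<epsilon>2 u) y"
    "B (\<nu> u) x = B (\<nu> u) y" "B e1 x = B e1 y" "B e2 x = B e2 y"
  shows "x = y"
proof -
  have "x - y \<in> C u" using assms by (intro in_C_if_orthogonal) (auto simp: B_simps)
  then have "x - y = 0" using assms by (intro e_separates[OF u]) (auto simp: B_simps)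
  then show ?thesis by simp
qed

lemma eps1_derivative: assumes u: "u \<in> I1" shows "D \<epsilon>1 u 1 = h u *\<^sub>R \<nu> u"
  using g_pos[OF u] eps_derivative_products[OF u] eps(1,2)[OF u]
  by (intro frame_eqI[OF u])
    (simp_all add: B_simps h_def g_def[symmetric] B_sym[of "\<epsilon>1 u"] B_sym[of "\<epsilon>2 u"] B_sym[of _ "D \<epsilon>1 u 1"])

lemma smooth_h: "smooth_on I1 h"
proof -
  have "g u \<noteq> 0" if "u \<in> I1" for u using g_pos[OF that] by simp
  then show ?thesis
    unfolding h_def by (intro smooth_on_divide smooth_on_B smooth_on_D smooth_g smooth_nu smooth_eps op1)
qed

text \<open>\<open>s1 = \<Psi> \<langle>\<epsilon>1 - h \<epsilon>2\<rangle>\<close>: the \<open>\<nu>\<close>-part of the derivative of \<open>x \<epsilon>1 + y \<epsilon>2\<close> is \<open>(x h + y) \<nu>\<close>.\<close>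

lemma s1_eq:
  assumes "u \<in> I1" "v \<in> I2"
  shows "s1 (u, v) = span {\<Psi> v *v (\<epsilon>1 u - h u *\<^sub>R \<epsilon>2 u)}"
    "\<phi> \<in> sections \<Sigma> s1 \<Longrightarrow> B e2 (A v *v \<phi> (u, v)) = - h u * B e1 (A v *v \<phi> (u, v))"
proof -
  have uv: "(u, v) \<in> \<Sigma>" using assms by simp
  have *: "B e2 (A v *v \<phi> (u, v)) = - h u * B e1 (A v *v \<phi> (u, v))"
    if \<phi>: "\<phi> \<in> sections \<Sigma> s1" for \<phi>
  proof -
    define y where "y = A v *v \<phi> (u, v)"
    have "(B e1 y * h u + B e2 y) *\<^sub>R \<nu> u \<in> C u"
      using section_of_s1(3)[OF \<phi> assms, folded y_def] by (simp add: eps1_derivative[OF assms(1)] algebra_simps)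
    then have "(B e1 y * h u + B e2 y) * g u = 0"
      using eps_derivative_products(8)[OF assms(1)] by (fastforce simp: g_def B_simps)
    then have "B e1 y * h u + B e2 y = 0" using g_pos[OF assms(1)] by simp
    then show ?thesis unfolding y_def[symmetric] by algebra
  qed
  then show "\<phi> \<in> sections \<Sigma> s1 \<Longrightarrow> B e2 (A v *v \<phi> (u, v)) = - h u * B e1 (A v *v \<phi> (u, v))" .
  obtain \<phi> where \<phi>: "\<phi> \<in> sections \<Sigma> s1" "\<phi> (u, v) \<noteq> 0"
    using nonzero_section[OF s_facts(1) regular(1) uv, of "(1, 0)"] by (auto simp: zero_prod_def)
  define y where "y = A v *v \<phi> (u, v)"
  note s = section_of_s1[OF \<phi>(1) assms, folded y_def]
  have "y = B e1 y *\<^sub>R (\<epsilon>1 u - h u *\<^sub>R \<epsilon>2 u)"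
    using C_expand[OF assms(1) s(1)] *[OF \<phi>(1), folded y_def] by (simp add: algebra_simps)
  then have \<phi>y: "\<phi> (u, v) = B e1 y *\<^sub>R (\<Psi> v *v (\<epsilon>1 u - h u *\<^sub>R \<epsilon>2 u))"
    using s(2) by (metis mv_simps)
  then have "B e1 y \<noteq> 0" using \<phi>(2) by auto
  then have "span {\<phi> (u, v)} = span {\<Psi> v *v (\<epsilon>1 u - h u *\<^sub>R \<epsilon>2 u)}"
    using span_image_scale[of "{\<Psi> v *v (\<epsilon>1 u - h u *\<^sub>R \<epsilon>2 u)}" "\<lambda>_. B e1 y"] \<phi>y by simp
  then show "s1 (u, v) = span {\<Psi> v *v (\<epsilon>1 u - h u *\<^sub>R \<epsilon>2 u)}"
    using line_bundle_eq_span[OF s_facts(1) uv _ \<phi>(2)] \<phi>(1) uv by (auto simp: sections_def)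
qed

text \<open>This expresses \<open>s1 \<inter> s2 = {0}\<close>.\<close>

lemma m_nonzero_on_s1:
  assumes "u \<in> I1" "v \<in> I2" shows "B (m v) (\<epsilon>1 u - h u *\<^sub>R \<epsilon>2 u) \<noteq> 0"
proof
  define y where "y = \<epsilon>1 u - h u *\<^sub>R \<epsilon>2 u"
  assume "B (m v) (\<epsilon>1 u - h u *\<^sub>R \<epsilon>2 u) = 0"
  then have my: "B (m v) y = 0" by (simp add: y_def)
  have uv: "(u, v) \<in> \<Sigma>" using assms by simp
  have yC: "y \<in> C u" unfolding y_def using C_facts(1)[OF assms(1)] eps(1,2)[OF assms(1)]
    by (intro subspace_diff subspace_scale)
  obtain z where z: "z \<in> C u" "z \<noteq> 0" "B (m v) z = 0" "s2 (u, v) = span {\<Psi> v *v z}"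
    using s2_eq[OF assms] .
  have "y \<in> span {z}" using kernel_of_m[OF assms yC z(1) my z(3,2)] .
  then have "\<Psi> v *v y \<in> s2 (u, v)"
    by (auto simp: z(4) span_singleton mv_simps)
  moreover have "\<Psi> v *v y \<in> s1 (u, v)" unfolding s1_eq(1)[OF assms] y_def by (simp add: span_base)
  ultimately have "\<Psi> v *v y = 0" using s_facts(3)[OF uv] by blast
  then have "y = 0" using A_inv(3)[OF assms(2), of y] by simp
  then have "B e1 y = 0" by (simp add: B_simps)
  then show False by (simp add: y_def B_simps eps[OF assms(1)])
qed

text \<open>\<open>h' \<noteq> 0\<close> says that \<open>s1\<close> is immersed in the direction \<open>\<partial>\<^sub>u\<close>.\<close>

lemma h_derivative_nonzero:
  assumes u: "u \<in> I1" shows "D h u 1 \<noteq> 0"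
proof
  assume zero: "D h u 1 = 0"
  have uv: "(u, v0) \<in> \<Sigma>" using u v0 by simp
  have "D \<phi> (u, v0) (1, 0) \<in> s1 (u, v0)" if \<phi>: "\<phi> \<in> sections \<Sigma> s1" for \<phi>
  proof -
    obtain a b where ab: "D \<phi> (u, v0) (1, 0) = \<Psi> v0 *v (a *\<^sub>R \<epsilon>1 u + b *\<^sub>R \<epsilon>2 u +
        (B e1 (A v0 *v \<phi> (u, v0)) *\<^sub>R D \<epsilon>1 u 1 + B e2 (A v0 *v \<phi> (u, v0)) *\<^sub>R \<nu> u))"
      "((\<lambda>w. B e1 (A v0 *v \<phi> (w, v0))) has_vector_derivative a) (at u)"
      "((\<lambda>w. B e2 (A v0 *v \<phi> (w, v0))) has_vector_derivative b) (at u)"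
      using section_of_s1(4)[OF \<phi> u v0] by blast
    have "((\<lambda>w. - h w * B e1 (A v0 *v \<phi> (w, v0))) has_vector_derivative - h u * a) (at u)"
      using has_vector_derivative_minus[OF has_vector_derivative_mult[OF
            smooth_on_curve_derivative[OF smooth_h u] ab(2)]] zero by simp
    then have "((\<lambda>w. B e2 (A v0 *v \<phi> (w, v0))) has_vector_derivative - h u * a) (at u)"
      by (rule has_vector_derivative_transform_within_open[OF _ op1 u]) (simp add: s1_eq(2)[OF _ v0 \<phi>])
    then have "b = - h u * a" using ab(3) vector_derivative_unique_at by blast
    then have "D \<phi> (u, v0) (1, 0) = a *\<^sub>R (\<Psi> v0 *v (\<epsilon>1 u - h u *\<^sub>R \<epsilon>2 u))"
      using ab(1) s1_eq(2)[OF u v0 \<phi>] eps1_derivative[OF u]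
      by (simp add: Psi_v0 algebra_simps)
    then show ?thesis unfolding s1_eq(1)[OF u v0] by (simp add: span_base span_scale)
  qed
  then have "(1, 0) = (0 :: real \<times> real)" using regular(1) uv unfolding immersed_def by metis
  then show False by (simp add: zero_prod_def)
qed

lemma nu_derivative_products:
  assumes u: "u \<in> I1"
  shows "B l0 (D \<nu> u 1) = 0" "B e1 (D \<nu> u 1) = 0" "B e2 (D \<nu> u 1) = 0"
    "B (D \<nu> u 1) (\<epsilon>1 u) = - h u * g u" "B (D \<nu> u 1) (\<epsilon>2 u) = - g u"
proof -
  have d: "(\<nu> has_vector_derivative D \<nu> u 1) (at u)"
    using smooth_on_curve_derivative[OF smooth_nu u] .
  show "B l0 (D \<nu> u 1) = 0" "B e1 (D \<nu> u 1) = 0" "B e2 (D \<nu> u 1) = 0"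
    by (rule constant_product_derivative[OF d u]; simp add: eps_derivative_products)+
  have *: "B (\<nu> u) x' + B (D \<nu> u 1) (x u) = 0"
    if "(x has_vector_derivative x') (at u)" "\<And>u. u \<in> I1 \<Longrightarrow> x u \<in> C u" for x x'
    by (rule derivative_zero_if_constant[OF B_has_vector_derivative[OF d that(1)] op1 u])
      (simp add: eps_derivative_products that(2))
  show "B (D \<nu> u 1) (\<epsilon>1 u) = - h u * g u"
    using *[OF eps_derivative(1)[OF u]] eps(1) eps1_derivative[OF u] by (simp add: B_simps g_def)
  show "B (D \<nu> u 1) (\<epsilon>2 u) = - g u"
    using *[OF eps_derivative(2)[OF u]] eps(2) by (simp add: g_def)
qed

section \<open>Spherical curvature lines of the second family\<close>

lemma T2_eq: "p \<in> \<Sigma> \<Longrightarrow> T2 p = span {(0, 1)}"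
proof -
  assume p: "p \<in> \<Sigma>"
  have "subbundle 1 \<Sigma> T2" using umbilic_free unfolding curvature_data_def by blast
  moreover have "(0, 1) \<in> T2 p" using p coordinates(2) unfolding sections_def by blast
  ultimately show ?thesis
    using line_bundle_eq_span[of \<Sigma> T2 p "(0, 1)"] p by (simp add: zero_prod_def)
qed

lemma B_m_e:
  assumes "\<And>v. v \<in> I2 \<Longrightarrow> B n (m v) = 0"
  shows "B n e1 = 0" "B n e2 = 0"
proof -
  have sub: "subspace {x. B n x = 0}" by (simp add: subspace_def B_simps)
  show "B n e1 = 0" unfolding e1_def using assms v0 by simp
  show "B n e2 = 0"
    using derivative_in_subspace[OF sub op2 v0 _ m_derivative_v0] assms by simp
qed

lemma orthogonal_to_m_imp_nu:
  assumes u: "u \<in> I1" and n: "B l0 n = 0" "\<And>x. x \<in> C u \<Longrightarrow> B n x = 0" "B n e1 = 0" "B n e2 = 0"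
  shows "n = (B (\<nu> u) n / g u) *\<^sub>R \<nu> u"
  using g_pos[OF u] eps_derivative_products[OF u] eps(1,2)[OF u] n(2)
  by (intro frame_eqI[OF u])
    (simp_all add: B_simps g_def[symmetric] n(1) B_sym[of e1 n] B_sym[of e2 n] n(3,4)
      B_sym[of "\<epsilon>1 u"] B_sym[of "\<epsilon>2 u"])

lemma Psi_fixes:
  assumes "B l0 x = 0" "\<And>v. v \<in> I2 \<Longrightarrow> B (m v) x = 0" "v \<in> I2"
  shows "\<Psi> v *v x = x"
proof -
  have "((\<lambda>v. \<Psi> v *v x) has_vector_derivative 0) (at v)" if "v \<in> I2" for v
    using Psi_derivative[OF that, of x] assms(1,2) that by (simp add: wedge_apply)
  then have "\<Psi> v *v x = \<Psi> v0 *v x"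
    by (rule zero_derivative_constant[OF open_interval_imp(2)[OF I2] v0 assms(3)])
  then show ?thesis by (simp add: Psi_v0)
qed

text \<open>A line \<open>M(u)\<close> that is constant in \<open>v\<close> and orthogonal to \<open>f = \<Psi> C\<close> is orthogonal to all \<open>l(v)\<close>, by
  differentiation in \<open>v\<close>. Then it is fixed by \<open>A\<close> and orthogonal to all \<open>m(v)\<close>, which leaves only the
  line \<open>\<langle>\<nu>(u)\<rangle>\<close>. Conversely that line works if it is orthogonal to all \<open>m(v)\<close>.\<close>

lemma spherical_T2_iff:
  "spherical_leaves B \<Sigma> f T2 \<longleftrightarrow> (\<forall>u\<in>I1. \<forall>v\<in>I2. B (m v) (\<nu> u) = 0)"
proof
  assume "spherical_leaves B \<Sigma> f T2"
  then obtain M where M: "subbundle 1 \<Sigma> M" "\<And>p. p \<in> \<Sigma> \<Longrightarrow> spacelike B (M p)"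
    "\<And>p. p \<in> \<Sigma> \<Longrightarrow> M p \<subseteq> perp B (f p)" "constant_along_leaves \<Sigma> T2 M"
    unfolding spherical_leaves_def by blast
  show "\<forall>u\<in>I1. \<forall>v\<in>I2. B (m v) (\<nu> u) = 0"
  proof (intro ballI)
    fix u v assume u: "u \<in> I1" and v: "v \<in> I2"
    define \<gamma> where "\<gamma> t = (u, t)" for t :: real
    have \<gamma>_d: "(\<gamma> has_vector_derivative (0, 1)) (at t)" for t
      unfolding \<gamma>_def by (auto intro!: derivative_eq_intros)
    have "smooth_on I2 (\<lambda>t. (u, 0) + (0, t))"
      by (intro smooth_on_add op2 smooth_on_const smooth_on_linear bounded_linear_Pair
          bounded_linear_zero bounded_linear_ident)
    then have \<gamma>_s: "smooth_on I2 \<gamma>" by (simp add: \<gamma>_def[abs_def])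
    have const: "M (u, w) = M (u, v0)" if "w \<in> I2" for w
    proof -
      have "\<gamma> t \<in> \<Sigma> \<and> vector_derivative \<gamma> (at t) \<in> T2 (\<gamma> t)" if "t \<in> I2" for t
        using u that unfolding vector_derivative_at[OF \<gamma>_d] by (simp add: \<gamma>_def T2_eq span_base)
      then have "\<forall>s\<in>I2. \<forall>t\<in>I2. M (\<gamma> s) = M (\<gamma> t)"
        using I2 \<gamma>_s
        by (intro M(4)[unfolded constant_along_leaves_def, THEN spec[of _ I2], THEN spec[of _ \<gamma>], THEN mp])
          (intro conjI ballI; simp)
      from bspec[OF bspec[OF this that] v0] show ?thesis by (simp only: \<gamma>_def)
    qed
    have uv: "(u, v0) \<in> \<Sigma>" using u v0 by simp
    obtain U e where "(u, v0) \<in> U" "\<And>q. q \<in> U \<Longrightarrow> M q = span {e q}" "\<And>q. q \<in> U \<Longrightarrow> e q \<noteq> 0"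
      by (rule line_bundle_frame[OF M(1) uv]) (rule that)
    then obtain n where n: "n \<in> M (u, v0)" "n \<noteq> 0" using span_base by blast
    have nf: "B n (\<Psi> w *v x) = 0" if w: "w \<in> I2" and "x \<in> C u" for w x
      using M(3)[of "(u, w)"] const[OF w] n(1) that u f_eq[OF u w]
      unfolding perp_in_def by blast
    have nl: "B n (l w) = 0" if w: "w \<in> I2" for w
    proof -
      obtain x where x: "x \<in> C u" "B (m w) x \<noteq> 0" using m_nonzero_on_C[OF u w] by blast
      have "B n (\<Psi> w *v (J w *v x)) = 0"
        using derivative_in_subspace[OF _ op2 w _ Psi_derivative[OF w], of "{y. B n y = 0}" x]
          nf[OF _ x(1)] by (simp add: subspace_def B_simps)
      then have "B (m w) x * B n (l w) = 0"
        using J_on_C[OF u x(1)] mv_simps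
        by (simp add: mv_simps B_simps l_def)
      then show ?thesis using x(2) by simp
    qed
    have nm: "B n (\<Psi> w *v m w) = 0" if w: "w \<in> I2" for w
      using derivative_in_subspace[OF _ op2 w _ l_derivative[OF w], of "{y. B n y = 0}"] nl
      by (simp add: subspace_def B_simps)
    have An: "A w *v n = n" if w: "w \<in> I2" for w
    proof -
      have "((\<lambda>w. A w *v n) has_vector_derivative 0) (at w)" if "w \<in> I2" for w
      proof -
        have "B l0 (A w *v n) = 0" "B (m w) (A w *v n) = 0"
          using nl[OF that] nm[OF that] B_sym[of _ "A w *v n"] A_B(3)[OF that] by (simp_all add: l_def)
        then show ?thesis using A_derivative[OF that, of n] by (simp add: wedge_apply)
      qed
      then have "A w *v n = A v0 *v n"
        by (rule zero_derivative_constant[OF open_interval_imp(2)[OF I2] v0 w])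
      then show ?thesis by (simp add: A_v0)
    qed
    have nm': "B n (m w) = 0" if "w \<in> I2" for w
      using nm[OF that] A_B(3)[OF that, of n "m w"] An[OF that] by simp
    have "B l0 n = 0" using nl[OF v0] B_sym[of l0 n] by (simp add: l_def Psi_v0)
    then have n_nu: "n = (B (\<nu> u) n / g u) *\<^sub>R \<nu> u"
      using nf[OF v0] B_m_e[OF nm'] by (intro orthogonal_to_m_imp_nu u) (auto simp: Psi_v0)
    then have "B (\<nu> u) n / g u \<noteq> 0" using n(2) by (metis scale_zero_left)
    moreover have "B n (m v) = (B (\<nu> u) n / g u) * B (\<nu> u) (m v)"
      by (subst n_nu) (simp only: B_simps)
    ultimately show "B (m v) (\<nu> u) = 0" using nm'[OF v] B_sym[of "m v"] by simp
  qed
next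
  assume zero: "\<forall>u\<in>I1. \<forall>v\<in>I2. B (m v) (\<nu> u) = 0"
  define M where "M p = span {\<nu> (fst p)}" for p :: "real \<times> real"
  have nu0: "\<nu> u \<noteq> 0" if "u \<in> I1" for u using g_pos[OF that] by (auto simp: g_def B_simps)
  have Psi_nu: "\<Psi> v *v \<nu> u = \<nu> u" if "u \<in> I1" "v \<in> I2" for u v
    using Psi_fixes[OF eps_derivative_products(2)[OF that(1)]] zero that by blast
  have "subbundle 1 \<Sigma> M"
    unfolding subbundle_def
  proof (intro conjI ballI)
    fix p assume p: "p \<in> \<Sigma>"
    show "subspace (M p)" by (simp add: M_def)
    have "independent {\<nu> (fst p)}" using nu0 p by auto
    then show "dim (M p) = 1" unfolding M_def by (simp add: dim_eq_card_independent)
    show "\<exists>U e. open U \<and> p \<in> U \<and> U \<subseteq> \<Sigma> \<and> (\<forall>i<1. smooth_on U (e i)) \<and>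
        (\<forall>q\<in>U. M q = span ((\<lambda>i::nat. e i q) ` {..<1}))"
      using p opS smooth_on_fst[OF smooth_nu op1 op2]
      by (intro exI[of _ \<Sigma>] exI[of _ "\<lambda>_ q. \<nu> (fst q)"]) (auto simp: M_def lessThan_Suc)
  qed
  moreover have "spacelike B (M p) \<and> M p \<subseteq> perp B (f p)" if pS: "p \<in> \<Sigma>" for p
  proof
    obtain u v where p: "p = (u, v)" "u \<in> I1" "v \<in> I2" using pS by auto
    show "spacelike B (M p)"
      unfolding spacelike_def M_def using g_pos[OF p(2)]
      by (auto simp: p(1) span_singleton B_simps g_def[symmetric] zero_less_mult_iff mult.assoc[symmetric]
          linorder_neq_iff)
    have "B (\<nu> u) (\<Psi> v *v x) = 0" if "x \<in> C u" for x
      using A_B(2)[OF p(3), of "\<nu> u" x] Psi_nu[OF p(2,3)] eps_derivative_products(8)[OF p(2) that] by simp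
    then show "M p \<subseteq> perp B (f p)"
      by (auto simp: p(1) M_def perp_in_def f_eq[OF p(2,3)] span_singleton B_simps)
  qed
  moreover have "constant_along_leaves \<Sigma> T2 M"
    unfolding constant_along_leaves_def
  proof (intro allI impI ballI)
    fix K :: "real set" and \<gamma> s t
    assume *: "open_interval K \<and> smooth_on K \<gamma> \<and>
        (\<forall>t\<in>K. \<gamma> t \<in> \<Sigma> \<and> vector_derivative \<gamma> (at t) \<in> T2 (\<gamma> t))" and st: "s \<in> K" "t \<in> K"
    have "((\<lambda>t. fst (\<gamma> t)) has_vector_derivative 0) (at t)" if "t \<in> K" for t
    proof -
      have d: "(\<gamma> has_vector_derivative D \<gamma> t 1) (at t)"
        using * that smooth_on_curve_derivative by blast
      then have "D \<gamma> t 1 \<in> span {(0, 1)}"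
        using * that T2_eq vector_derivative_at[OF d] by auto
      then have "fst (D \<gamma> t 1) = 0" by (auto simp: span_singleton)
      then show ?thesis
        using bounded_linear.has_vector_derivative[OF bounded_linear_fst d] by simp
    qed
    then have "fst (\<gamma> s) = fst (\<gamma> t)"
      using zero_derivative_constant[OF open_interval_imp(2) st(2,1)] * by blast
    then show "M (\<gamma> s) = M (\<gamma> t)" by (simp add: M_def)
  qed
  ultimately show "spherical_leaves B \<Sigma> f T2" unfolding spherical_leaves_def by blast
qed

section \<open>Subspaces containing all the lines\<close>

text \<open>Let \<open>V = L\<^sub>0 \<oplus> W\<close>. If \<open>m\<close> takes values in \<open>V\<close>, then so do the derivatives of all \<open>A x\<close>, hence the
  increments \<open>A(v) x - x\<close>; take \<open>x = l(v)\<close>. If \<open>L\<close> lies in \<open>V\<close>, the same holds for \<open>\<Psi> x - x\<close>; take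
  \<open>x = m(v)\<close>.\<close>

lemma L_in_sum_iff:
  assumes W: "subspace W" "W \<subseteq> {x. B l0 x = 0}"
  shows "(\<forall>v\<in>I2. L v \<subseteq> {x + y |x y. x \<in> L v0 \<and> y \<in> W}) \<longleftrightarrow> (\<forall>v\<in>I2. m v \<in> W)"
proof -
  define V where "V = {x + y |x y. x \<in> L v0 \<and> y \<in> W}"
  have V: "subspace V" unfolding V_def l0(1) using W(1) by (intro subspace_sums) auto
  have WV: "x \<in> V" if "x \<in> W" for x
    unfolding V_def l0(1) using that span_zero[of "{l0}"] by force
  have lV: "l0 \<in> V" unfolding V_def l0(1) using span_base[of l0 "{l0}"] subspace_0[OF W(1)] by force
  have Wm: "m v \<in> W" if mV: "m v \<in> V" and v: "v \<in> I2" for v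
  proof -
    obtain k y where y: "m v = k *\<^sub>R l0 + y" "y \<in> W"
      using mV unfolding V_def l0(1) span_singleton by blast
    have "k = 0" using l0_m[OF v] W(2) y by (auto simp: B_simps l0(2))
    then show ?thesis using y by simp
  qed
  have "m v \<in> W" if L: "\<And>v. v \<in> I2 \<Longrightarrow> L v \<subseteq> V" and v: "v \<in> I2" for v
  proof -
    have l: "l w \<in> V" if "w \<in> I2" for w using L[OF that] L_eq[OF that] by (auto simp: span_base)
    have l': "\<Psi> w *v m w \<in> V" if "w \<in> I2" for w
      using derivative_in_subspace[OF V op2 that l l_derivative[OF that]] by simp
    have "\<Psi> v *v m v - \<Psi> v0 *v m v \<in> V"
    proof (rule increment_in_subspace[OF V open_interval_imp(2)[OF I2] v0 v Psi_derivative])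
      fix w assume w: "w \<in> I2"
      then show "\<Psi> w *v (J w *v m v) \<in> V"
        using l[OF w] l'[OF w] V
        by (simp add: wedge_apply mv_simps l_def[symmetric]
            subspace_diff subspace_scale)
    qed
    then have "\<Psi> v *v m v - (\<Psi> v *v m v - m v) \<in> V"
      using subspace_diff[OF V l'[OF v], of "\<Psi> v *v m v - m v"] by (simp only: Psi_v0 matrix_vector_mul_lid)
    then have "m v \<in> V" by (simp only: diff_diff_eq2 add_diff_cancel_left')
    then show ?thesis using Wm v by simp
  qed
  moreover have "L v \<subseteq> V" if m: "\<And>v. v \<in> I2 \<Longrightarrow> m v \<in> W" and v: "v \<in> I2" for v
  proof -
    have "A v *v l v - A v0 *v l v \<in> V"
    proof (rule increment_in_subspace[OF V open_interval_imp(2)[OF I2] v0 v A_derivative])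
      fix w assume "w \<in> I2"
      then show "- (J w *v (A w *v l v)) \<in> V"
        using WV[OF m] lV V by (simp add: wedge_apply subspace_diff subspace_scale)
    qed
    then have "l0 - (l0 - l v) \<in> V"
      using subspace_diff[OF V lV, of "l0 - l v"] by (simp add: l_def A_inv(3)[OF v] A_v0)
    then have "l v \<in> V" by (simp only: diff_diff_eq2 add_diff_cancel_left')
    then show ?thesis unfolding L_eq[OF v] using V by (simp add: span_minimal)
  qed
  ultimately show ?thesis unfolding V_def[symmetric] by blast
qed

section \<open>The quadratic differential in the frame\<close>

text \<open>The quadratic form of a matrix \<open>K = \<eta>(X)\<close> in \<open>f \<and> f\<^sup>\<bottom>\<close>: modulo \<open>f\<close>, which \<open>K\<close> annihilates, the
  derivative of a section with value \<open>\<Psi> c\<close> is \<open>((e1, c) h + (e2, c)) \<Psi> \<nu>\<close> in direction \<open>\<partial>\<^sub>u\<close> and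
  \<open>- (m, c) l\<close> in direction \<open>\<partial>\<^sub>v\<close>.\<close>

lemma quad_surface:
  assumes u: "u \<in> I1" and v: "v \<in> I2" and K: "K = \<eta> (u, v) X"
    and kills: "\<And>x. x \<in> C u \<Longrightarrow> K *v (\<Psi> v *v x) = 0"
    and maps: "K *v (\<Psi> v *v \<nu> u) \<in> f (u, v)" "K *v l v \<in> f (u, v)"
  shows "quad \<Sigma> f \<eta> (u, v) X Y =
    fst Y * (h u * B (\<Psi> v *v e1) (K *v (\<Psi> v *v \<nu> u)) + B (\<Psi> v *v e2) (K *v (\<Psi> v *v \<nu> u)))
    - snd Y * (B (m v) (\<epsilon>1 u) * B (\<Psi> v *v e1) (K *v l v) + B (m v) (\<epsilon>2 u) * B (\<Psi> v *v e2) (K *v l v))"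
proof -
  have uv: "(u, v) \<in> \<Sigma>" using u v by simp
  define P where "P = K *v (\<Psi> v *v \<nu> u)"
  define Q where "Q = K *v l v"
  have sub: "subspace (f (u, v))"
    using legendre uv unfolding legendre_map_def subbundle_def by blast
  have fspan: "f (u, v) = span {\<Psi> v *v \<epsilon>1 u, \<Psi> v *v \<epsilon>2 u}"
    unfolding f_eq[OF u v] C_eq_span[OF u]
    using linear_span_image[OF matrix_vector_mul_linear, of "\<Psi> v" "{\<epsilon>1 u, \<epsilon>2 u}"] by simp
  have E: "K *v D (SOME \<sigma>. \<sigma> \<in> sections \<Sigma> f \<and> \<sigma> (u, v) = x) (u, v) Y =
      B (\<Psi> v *v e1) x *\<^sub>R ((fst Y * h u) *\<^sub>R P - (snd Y * B (m v) (\<epsilon>1 u)) *\<^sub>R Q)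
      + B (\<Psi> v *v e2) x *\<^sub>R (fst Y *\<^sub>R P - (snd Y * B (m v) (\<epsilon>2 u)) *\<^sub>R Q)"
    if x: "x \<in> f (u, v)" for x
  proof -
    obtain c where c: "c \<in> C u" "x = \<Psi> v *v c" using x by (auto simp: f_eq[OF u v])
    define \<sigma> where "\<sigma> = (SOME \<sigma>. \<sigma> \<in> sections \<Sigma> f \<and> \<sigma> (u, v) = x)"
    define \<tau> where "\<tau> p = \<Psi> (snd p) *v (B e1 c *\<^sub>R \<epsilon>1 (fst p) + B e2 c *\<^sub>R \<epsilon>2 (fst p))"
      for p :: "real \<times> real"
    have "smooth_on \<Sigma> \<tau>"
      unfolding \<tau>_def
      by (intro smooth_on_mv smooth_on_add smooth_on_scaleR smooth_on_const smooth_on_fst smooth_eps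
          smooth_Psi_snd opS op1 op2)
    moreover have "\<tau> p \<in> f p" if "p \<in> \<Sigma>" for p
      using that f_eq C_facts(1) eps(1,2)
      by (auto simp: \<tau>_def intro!: imageI subspace_add subspace_scale)
    moreover have "\<tau> (u, v) = x" using C_expand[OF u c(1)] c(2) by (simp add: \<tau>_def)
    ultimately have "\<tau> \<in> sections \<Sigma> f \<and> \<tau> (u, v) = x" by (simp add: sections_def)
    then have \<sigma>: "\<sigma> \<in> sections \<Sigma> f" "\<sigma> (u, v) = x"
      unfolding \<sigma>_def using someI[of "\<lambda>\<sigma>. \<sigma> \<in> sections \<Sigma> f \<and> \<sigma> (u, v) = x"] by blast+
    define y where "y = (\<lambda>p. A (snd p) *v \<sigma> p)"
    note F = f_section[OF \<sigma>(1) y_def]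
    have yc: "y (u, v) = c" using \<sigma>(2) c(2) A_inv(3)[OF v] by (simp add: y_def)
    obtain r t where Dy: "D y (u, v) (1, 0) =
        r *\<^sub>R \<epsilon>1 u + t *\<^sub>R \<epsilon>2 u + (B e1 c *\<^sub>R D \<epsilon>1 u 1 + B e2 c *\<^sub>R \<nu> u)"
      using curve_in_C_derivative[OF u F(2)[OF _ v] partial_derivatives(1)[OF F(1)[OF u v] uv]]
      unfolding yc by blast
    have "K *v D \<sigma> (u, v) (1, 0) = (B e1 c * h u + B e2 c) *\<^sub>R P"
      unfolding F(5)[OF u v] Dy
      by (simp add: P_def eps1_derivative[OF u] mv_simps kills eps(1,2)[OF u] algebra_simps)
    moreover have "K *v D \<sigma> (u, v) (0, 1) = - (B (m v) c *\<^sub>R Q)"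
      unfolding F(6)[OF u v] yc Q_def l_def
      by (simp add: mv_simps kills[OF F(4)[OF u v]])
    moreover have "B (m v) c = B e1 c * B (m v) (\<epsilon>1 u) + B e2 c * B (m v) (\<epsilon>2 u)"
      by (subst C_expand[OF u c(1)]) (simp only: B_simps)
    moreover have "D \<sigma> (u, v) Y = fst Y *\<^sub>R D \<sigma> (u, v) (1, 0) + snd Y *\<^sub>R D \<sigma> (u, v) (0, 1)"
      using \<sigma>(1) uv by (intro D_plane[of \<Sigma>]) (auto simp: sections_def)
    moreover have "B (\<Psi> v *v e1) x = B e1 c" "B (\<Psi> v *v e2) x = B e2 c"
      unfolding c(2) by (simp_all add: A_B(2)[OF v])
    ultimately show ?thesis
      unfolding \<sigma>_def[symmetric]
      by (simp only: mv_simps) (simp add: algebra_simps)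
  qed
  have PQ: "P \<in> f (u, v)" "Q \<in> f (u, v)" using maps by (auto simp: P_def Q_def)
  have "trace_on (f (u, v)) (\<lambda>x. K *v D (SOME \<sigma>. \<sigma> \<in> sections \<Sigma> f \<and> \<sigma> (u, v) = x) (u, v) Y) =
      B (\<Psi> v *v e1) ((fst Y * h u) *\<^sub>R P - (snd Y * B (m v) (\<epsilon>1 u)) *\<^sub>R Q)
      + B (\<Psi> v *v e2) (fst Y *\<^sub>R P - (snd Y * B (m v) (\<epsilon>2 u)) *\<^sub>R Q)"
  proof (rule trace_on_plane[OF fspan, where \<phi> = "B (\<Psi> v *v e1)" and \<psi> = "B (\<Psi> v *v e2)"
        and p = "(fst Y * h u) *\<^sub>R P - (snd Y * B (m v) (\<epsilon>1 u)) *\<^sub>R Q"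
        and q = "fst Y *\<^sub>R P - (snd Y * B (m v) (\<epsilon>2 u)) *\<^sub>R Q"])
  qed (use PQ sub in \<open>simp_all add: E linear_B_right A_B(2)[OF v] eps[OF u] subspace_diff subspace_scale\<close>)
  then show ?thesis
    unfolding quad_def K[symmetric] P_def[symmetric] Q_def[symmetric]
    by (simp add: B_simps algebra_simps)
qed

lemma quad_curve:
  assumes u: "u \<in> I1" and K: "K = \<xi> u X"
    and kills: "\<And>x. x \<in> C u \<Longrightarrow> K *v x = 0" and maps: "K *v \<nu> u \<in> C u"
  shows "quad I1 C \<xi> u X Y = Y * (h u * B e1 (K *v \<nu> u) + B e2 (K *v \<nu> u))"
proof -
  define P where "P = K *v \<nu> u"
  have E: "K *v D (SOME \<sigma>. \<sigma> \<in> sections I1 C \<and> \<sigma> u = x) u Y =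
      B e1 x *\<^sub>R ((Y * h u) *\<^sub>R P) + B e2 x *\<^sub>R (Y *\<^sub>R P)" if x: "x \<in> C u" for x
  proof -
    define \<sigma> where "\<sigma> = (SOME \<sigma>. \<sigma> \<in> sections I1 C \<and> \<sigma> u = x)"
    have "coord (B e1 x) (B e2 x) u = x"
      using coord[OF u] x by (intro coord_unique[OF u]) auto
    then have "coord (B e1 x) (B e2 x) \<in> sections I1 C \<and> coord (B e1 x) (B e2 x) u = x"
      using coord(1) smooth_coord by (auto simp: sections_def)
    then have \<sigma>: "\<sigma> \<in> sections I1 C" "\<sigma> u = x"
      unfolding \<sigma>_def using someI[of "\<lambda>\<sigma>. \<sigma> \<in> sections I1 C \<and> \<sigma> u = x"] by blast+
    have d: "(\<sigma> has_vector_derivative D \<sigma> u 1) (at u)"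
      using smooth_on_curve_derivative \<sigma>(1) u unfolding sections_def by blast
    have "\<sigma> w \<in> C w" if "w \<in> I1" for w using \<sigma>(1) that by (simp add: sections_def)
    then obtain r t where D\<sigma>: "D \<sigma> u 1 =
        r *\<^sub>R \<epsilon>1 u + t *\<^sub>R \<epsilon>2 u + (B e1 x *\<^sub>R D \<epsilon>1 u 1 + B e2 x *\<^sub>R \<nu> u)"
      using curve_in_C_derivative[OF u _ d] unfolding \<sigma>(2) by blast
    have "K *v D \<sigma> u 1 = (B e1 x * h u + B e2 x) *\<^sub>R P"
      unfolding D\<sigma>
      by (simp add: P_def eps1_derivative[OF u] mv_simps kills eps(1,2)[OF u] algebra_simps)
    then show ?thesis
      unfolding \<sigma>_def[symmetric] D_curve[OF d, of Y]
      by (simp add: mv_simps algebra_simps)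
  qed
  have P: "P \<in> C u" using maps by (simp add: P_def)
  have "trace_on (C u) (\<lambda>x. K *v D (SOME \<sigma>. \<sigma> \<in> sections I1 C \<and> \<sigma> u = x) u Y) =
      B e1 ((Y * h u) *\<^sub>R P) + B e2 (Y *\<^sub>R P)"
  proof (rule trace_on_plane[OF C_eq_span[OF u], where \<phi> = "B e1" and \<psi> = "B e2"
        and p = "(Y * h u) *\<^sub>R P" and q = "Y *\<^sub>R P"])
  qed (use P C_facts(1)[OF u] in \<open>simp_all add: E linear_B_right eps[OF u] subspace_scale\<close>)
  then show ?thesis
    unfolding quad_def K[symmetric] P_def[symmetric] by (simp add: B_simps algebra_simps)
qed

section \<open>Closed forms on the surface from forms along the curve\<close>

text \<open>The fibre of \<open>C \<and> C\<^sup>\<bottom>\<close>, with \<open>C\<^sup>\<bottom>\<close> taken in \<open>L\<^sub>0\<^sup>\<bottom>\<close>.\<close>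

abbreviation \<Xi> where "\<Xi> u \<equiv> f_wedge_f_perp B (perp_in B UNIV (L v0)) C u"

lemma Xi_eq: "\<Xi> u = wedge_space B (C u) {x. B l0 x = 0 \<and> (\<forall>y\<in>C u. B x y = 0)}"
  unfolding f_wedge_f_perp_def perp_L0 unfolding perp_in_def by simp

lemma Xi_props:
  assumes K: "K \<in> \<Xi> u" and u: "u \<in> I1"
  shows "B (K *v x) y = - B x (K *v y)" "x \<in> C u \<Longrightarrow> K *v x = 0" "K *v l0 = 0" "B l0 (K *v x) = 0"
    "K *v \<nu> u \<in> C u"
proof -
  note K' = K[unfolded Xi_eq]
  have CW: "B x y = 0" if "x \<in> C u" "y \<in> {x. B l0 x = 0 \<and> (\<forall>y\<in>C u. B x y = 0)}" for x y
    using that B_sym[of x y] by simp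
  note props = wedge_space_props[OF K' C_facts(1)[OF u] CW]
  show skew: "B (K *v x) y = - B x (K *v y)" for x y using props(1) .
  show "x \<in> C u \<Longrightarrow> K *v x = 0" using props(2) C_facts(4)[OF u] by blast
  show "K *v \<nu> u \<in> C u" using props(3) eps_derivative_products(8)[OF u] by blast
  have "K *v x \<in> {x. B l0 x = 0}" for x
    by (rule wedge_space_range[OF K']) (use C_facts(3)[OF u] in \<open>auto simp: subspace_def B_simps\<close>)
  then show r: "B l0 (K *v x) = 0" for x by blast
  have "B (K *v l0) y = 0" for y using skew[of l0 y] r[of y] by simp
  then show "K *v l0 = 0" by (rule B_nondegenerate)
qed

text \<open>Derivatives of \<open>\<Psi> Z A\<close>; in direction \<open>\<partial>\<^sub>v\<close> the evolution contributes the commutator with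
  \<open>l0 \<and> m\<close>.\<close>

lemma conj_derivative:
  assumes Z: "smooth_on \<Sigma> Z" and H: "\<And>p. p \<in> \<Sigma> \<Longrightarrow> H p = \<Psi> (snd p) ** Z p ** A (snd p)"
    and uv: "u \<in> I1" "v \<in> I2"
  shows "D H (u, v) (1, 0) = \<Psi> v ** D Z (u, v) (1, 0) ** A v"
    and "D H (u, v) (0, 1) = \<Psi> v ** (D Z (u, v) (0, 1) + J v ** Z (u, v) - Z (u, v) ** J v) ** A v"
proof -
  have uv': "(u, v) \<in> \<Sigma>" using uv by simp
  define G where "G p = \<Psi> (snd p) ** Z p ** A (snd p)" for p
  have sm: "smooth_on \<Sigma> G"
    unfolding G_def by (intro smooth_on_mm opS smooth_Psi_snd smooth_A_snd Z)
  have eq: "D H (u, v) X = D G (u, v) X" for X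
    by (rule D_cong[OF opS uv', symmetric])
      (use H smooth_on_imp_has_derivative[OF sm uv'] in \<open>auto simp: differentiable_def G_def\<close>)
  have "((\<lambda>u. \<Psi> v ** Z (u, v) ** A v) has_vector_derivative \<Psi> v ** D Z (u, v) (1, 0) ** A v) (at u)"
    by (rule has_vector_derivative_eq_rhs[OF mm_has_vector_derivative[OF mm_has_vector_derivative[OF
              has_vector_derivative_const partial_derivatives(1)[OF Z uv']] has_vector_derivative_const]])
      (simp add: mm_simps)
  then show "D H (u, v) (1, 0) = \<Psi> v ** D Z (u, v) (1, 0) ** A v"
    unfolding eq
    using vector_derivative_unique_at[OF partial_derivatives(1)[OF sm uv', unfolded G_def snd_conv]]
    by (simp add: G_def[abs_def])
  have "((\<lambda>v. \<Psi> v ** Z (u, v) ** A v) has_vector_derivative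
      \<Psi> v ** (D Z (u, v) (0, 1) + J v ** Z (u, v) - Z (u, v) ** J v) ** A v) (at v)"
    by (rule has_vector_derivative_eq_rhs[OF mm_has_vector_derivative[OF mm_has_vector_derivative[OF
              Psi_matrix_derivative[OF uv(2)] partial_derivatives(2)[OF Z uv']] A_matrix_derivative[OF uv(2)]]])
      (simp add: mm_simps matrix_mul_assoc)
  then show "D H (u, v) (0, 1) = \<Psi> v ** (D Z (u, v) (0, 1) + J v ** Z (u, v) - Z (u, v) ** J v) ** A v"
    unfolding eq
    using vector_derivative_unique_at[OF partial_derivatives(2)[OF sm uv', unfolded G_def snd_conv]]
    by (simp add: G_def[abs_def])
qed

text \<open>The form \<open>\<eta> = \<Psi> (\<xi> du + (l0 \<and> c) dv) A\<close> is closed when \<open>c\<close> solves \<open>c\<^sub>u = - \<xi> m\<close>, as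
  \<open>[l0 \<and> m, \<xi>] = - l0 \<and> \<xi> m\<close>. Moreover \<open>\<xi>\<close> and \<open>l0 \<and> c\<close> commute, and at \<open>v = v0\<close> the coefficient
  of \<open>du\<^sup>2\<close> in \<open>\<Q>\<^sup>\<eta>\<close> is that of \<open>\<Q>\<^sup>\<xi>\<close>.\<close>

lemma lie_applicable_of_curve_form:
  assumes \<xi>: "smooth_on I1 \<xi>" "\<And>u. u \<in> I1 \<Longrightarrow> \<xi> u \<in> \<Xi> u"
    and c: "smooth_on \<Sigma> c" "\<And>u v. u \<in> I1 \<Longrightarrow> v \<in> I2 \<Longrightarrow> c (u, v) \<in> C u"
      "\<And>u v. u \<in> I1 \<Longrightarrow> v \<in> I2 \<Longrightarrow> D c (u, v) (1, 0) = - (\<xi> u *v m v)"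
    and nz: "u0 \<in> I1" "h u0 * B e1 (\<xi> u0 *v \<nu> u0) + B e2 (\<xi> u0 *v \<nu> u0) \<noteq> 0"
  shows "lie_applicable B \<Sigma> f"
proof -
  define Z1 where "Z1 p = \<xi> (fst p)" for p :: "real \<times> real"
  define Z2 where "Z2 p = wedge B l0 (c p)" for p
  define H1 where "H1 p = \<Psi> (snd p) ** Z1 p ** A (snd p)" for p
  define H2 where "H2 p = \<Psi> (snd p) ** Z2 p ** A (snd p)" for p
  define \<eta> where "\<eta> p X = fst X *\<^sub>R H1 p + snd X *\<^sub>R H2 p" for p and X :: "real \<times> real"
  have smZ: "smooth_on \<Sigma> Z1" "smooth_on \<Sigma> Z2"
    unfolding Z1_def Z2_def
    by (intro smooth_on_fst \<xi> op1 op2 smooth_on_wedge opS smooth_on_const c)+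
  have smH: "smooth_on \<Sigma> H1" "smooth_on \<Sigma> H2"
    unfolding H1_def H2_def by (intro smooth_on_mm opS smooth_Psi_snd smooth_A_snd smZ)+
  have sm\<eta>: "smooth_on \<Sigma> (\<lambda>p. \<eta> p X)" for X
    unfolding \<eta>_def by (intro smooth_on_add smooth_on_scaleR opS smooth_on_const smH)
  have mem: "H1 (u, v) \<in> f_wedge_f_perp B UNIV f (u, v)" "H2 (u, v) \<in> f_wedge_f_perp B UNIV f (u, v)"
    if uv: "u \<in> I1" "v \<in> I2" for u v
  proof -
    have CC: "perp B ((*v) (\<Psi> v) ` C u) = (*v) (\<Psi> v) ` {x. \<forall>y\<in>C u. B x y = 0}"
    proof -
      have "x = \<Psi> v *v (A v *v x)" for x using A_inv(4)[OF uv(2)] by simp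
      moreover have "B (A v *v x) y = B x (\<Psi> v *v y)" for x y using A_B(3)[OF uv(2)] .
      ultimately show ?thesis
        by (auto simp: perp_in_def A_B(2)[OF uv(2)] intro!: image_eqI[where x = "A v *v _"])
    qed
    have fw: "f_wedge_f_perp B UNIV f (u, v) =
        wedge_space B ((*v) (\<Psi> v) ` C u) ((*v) (\<Psi> v) ` {x. \<forall>y\<in>C u. B x y = 0})"
      unfolding f_wedge_f_perp_def f_eq[OF uv] CC ..
    show "H1 (u, v) \<in> f_wedge_f_perp B UNIV f (u, v)"
      unfolding fw H1_def Z1_def snd_conv fst_conv
      by (rule wedge_space_conj[OF A_orthogonal[OF uv(2)] \<xi>(2)[OF uv(1), unfolded Xi_eq]]) auto
    have "wedge B l0 (c (u, v)) = - wedge B (c (u, v)) l0"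
      by (rule matrix_eqI)
        (simp add: wedge_apply mv_simps)
    moreover have "wedge B (c (u, v)) l0 \<in> wedge_space B (C u) {x. \<forall>y\<in>C u. B x y = 0}"
      using c(2)[OF uv] C_facts(3)[OF uv(1)] by (intro wedge_space_intros) auto
    ultimately have "Z2 (u, v) \<in> wedge_space B (C u) {x. \<forall>y\<in>C u. B x y = 0}"
      using subspace_neg[OF wedge_space_intros(2)] by (simp add: Z2_def)
    then show "H2 (u, v) \<in> f_wedge_f_perp B UNIV f (u, v)"
      unfolding fw H2_def snd_conv by (rule wedge_space_conj[OF A_orthogonal[OF uv(2)]]) simp
  qed
  have form: "\<eta> \<in> one_forms \<Sigma> (f_wedge_f_perp B UNIV f)"
    unfolding one_forms_def sections_def
  proof (intro CollectI conjI ballI allI sm\<eta>)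
    show "linear (\<eta> p)" for p
      unfolding \<eta>_def by (rule linearI) (simp_all add: algebra_simps)
    fix X p assume "p \<in> \<Sigma>"
    then show "\<eta> p X \<in> f_wedge_f_perp B UNIV f p"
      using mem[of "fst p" "snd p"] wedge_space_intros(2)
      unfolding \<eta>_def f_wedge_f_perp_def by (auto intro!: subspace_add subspace_scale)
  qed
  have closed: "D H2 (u, v) (1, 0) = D H1 (u, v) (0, 1)" if uv: "u \<in> I1" "v \<in> I2" for u v
  proof -
    have uv': "(u, v) \<in> \<Sigma>" using uv by simp
    note X = Xi_props[OF \<xi>(2)[OF uv(1)] uv(1)]
    have "((\<lambda>u. Z2 (u, v)) has_vector_derivative wedge B l0 (- (\<xi> u *v m v))) (at u)"
      unfolding Z2_def
      by (rule has_vector_derivative_eq_rhs[OF bounded_bilinear.has_vector_derivative[OF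
              bounded_bilinear_wedge has_vector_derivative_const partial_derivatives(1)[OF c(1) uv']]])
        (simp add: c(3)[OF uv] bounded_bilinear.zero_left[OF bounded_bilinear_wedge])
    then have d2: "D Z2 (u, v) (1, 0) = wedge B l0 (- (\<xi> u *v m v))"
      using vector_derivative_unique_at[OF partial_derivatives(1)[OF smZ(2) uv']] by blast
    have "((\<lambda>v. Z1 (u, v)) has_vector_derivative 0) (at v)" by (simp add: Z1_def)
    then have d1: "D Z1 (u, v) (0, 1) = 0"
      using vector_derivative_unique_at[OF partial_derivatives(2)[OF smZ(1) uv']] by blast
    have "wedge B l0 (- (\<xi> u *v m v)) = J v ** \<xi> u - \<xi> u ** J v"
      by (rule matrix_eqI)
        (simp add: wedge_apply matrix_vector_mul_assoc[symmetric] mv_simps B_simps X(1,3,4)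
          B_sym[of "m v" "\<xi> u *v _"])
    then show ?thesis
      unfolding conj_derivative[OF smZ(2) H2_def uv] conj_derivative[OF smZ(1) H1_def uv] d1 d2
      by (simp add: Z1_def)
  qed
  have commute: "H1 (u, v) ** H2 (u, v) = H2 (u, v) ** H1 (u, v)" if uv: "u \<in> I1" "v \<in> I2" for u v
  proof (rule matrix_eqI)
    fix x
    note X = Xi_props[OF \<xi>(2)[OF uv(1)] uv(1)]
    have "B (c (u, v)) (\<xi> u *v y) = 0" for y
      using X(1)[of "c (u, v)" y] X(2)[OF c(2)[OF uv]] by (simp add: B_simps)
    then show "(H1 (u, v) ** H2 (u, v)) *v x = (H2 (u, v) ** H1 (u, v)) *v x"
      by (simp add: H1_def H2_def Z1_def Z2_def matrix_vector_mul_assoc[symmetric] A_inv(3)[OF uv(2)]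
          wedge_apply mv_simps X(3,4) X(2)[OF c(2)[OF uv]])
  qed
  have flat: "ext_deriv \<eta> p X Y = 0 \<and> bracket_wedge \<eta> \<eta> p X Y = 0" if pS: "p \<in> \<Sigma>" for p X Y
  proof
    obtain u v where p: "p = (u, v)" and uv: "u \<in> I1" "v \<in> I2" using pS by force
    have "D (\<lambda>q. \<eta> q Y) p X = fst Y *\<^sub>R D H1 p X + snd Y *\<^sub>R D H2 p X" for X Y
      unfolding \<eta>_def
      by (intro D_eq has_derivative_add has_derivative_scaleR_right
          smooth_on_imp_has_derivative[OF smH(1) pS] smooth_on_imp_has_derivative[OF smH(2) pS])
    then show "ext_deriv \<eta> p X Y = 0"
      unfolding ext_deriv_def p
      by (simp add: D_plane[OF smH(1), of "(u, v)" X] D_plane[OF smH(1), of "(u, v)" Y]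
          D_plane[OF smH(2), of "(u, v)" X] D_plane[OF smH(2), of "(u, v)" Y] uv closed[OF uv] algebra_simps)
    show "bracket_wedge \<eta> \<eta> p X Y = 0"
      unfolding bracket_wedge_def commutator_def \<eta>_def p
      by (simp add: mm_simps commute[OF uv] algebra_simps)
  qed
  have "quad \<Sigma> f \<eta> (u0, v0) (1, 0) (1, 0) \<noteq> 0"
  proof -
    note X = Xi_props[OF \<xi>(2)[OF nz(1)] nz(1)]
    have K: "\<xi> u0 = \<eta> (u0, v0) (1, 0)"
      by (simp add: \<eta>_def H1_def Z1_def Psi_v0) (simp add: A_v0)
    have "0 \<in> f (u0, v0)"
      using f_eq[OF nz(1) v0] subspace_0[OF C_facts(1)[OF nz(1)]] by (simp add: Psi_v0)
    then have "quad \<Sigma> f \<eta> (u0, v0) (1, 0) (1, 0) =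
        h u0 * B e1 (\<xi> u0 *v \<nu> u0) + B e2 (\<xi> u0 *v \<nu> u0)"
      using X(2,3,5) f_eq[OF nz(1) v0]
      by (subst quad_surface[where \<eta> = \<eta>, OF nz(1) v0 K]) (simp_all add: Psi_v0 l_def)
    then show ?thesis using nz(2) by simp
  qed
  then show ?thesis
    unfolding lie_applicable_def quad_nonzero_def using form flat nz(1) v0 by blast
qed

lemma smooth_m_snd: "smooth_on \<Sigma> (\<lambda>p. m (snd p))"
  using smooth_on_snd[OF smooth_m op1 op2] .

text \<open>Here \<open>(m(v), \<epsilon>2)\<close> does not depend on \<open>u\<close>, so \<open>\<epsilon>2\<close> itself provides the conserved quantities of
  \<open>\<xi> = \<epsilon>2 \<and> \<nu>\<close>.\<close>

lemma lie_applicable_if_spherical: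
  assumes "spherical_leaves B \<Sigma> f T2"
  shows "lie_applicable B \<Sigma> f"
proof -
  have zero: "B (m v) (\<nu> u) = 0" if "u \<in> I1" "v \<in> I2" for u v
    using assms that unfolding spherical_T2_iff by blast
  obtain u0 where u0: "u0 \<in> I1" using open_interval_imp(4)[OF I1] by blast
  define c where "c p = - (B (m (snd p)) (\<epsilon>2 (fst p)) *\<^sub>R \<epsilon>2 (fst p))" for p
  show ?thesis
  proof (rule lie_applicable_of_curve_form)
    show "smooth_on I1 (\<lambda>u. wedge B (\<epsilon>2 u) (\<nu> u))"
      by (intro smooth_on_wedge op1 smooth_eps smooth_nu)
    show "wedge B (\<epsilon>2 u) (\<nu> u) \<in> \<Xi> u" if "u \<in> I1" for u
      unfolding Xi_eq using eps_derivative_products[OF that] eps(2)[OF that]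
      by (intro wedge_space_intros) auto
    show smc: "smooth_on \<Sigma> c"
      unfolding c_def
      by (intro smooth_on_minus smooth_on_scaleR smooth_on_B opS smooth_m_snd smooth_on_fst smooth_eps op1 op2)
    fix u v assume uv: "u \<in> I1" "v \<in> I2"
    show "c (u, v) \<in> C u"
      using C_facts(1)[OF uv(1)] eps(2)[OF uv(1)] by (simp add: c_def subspace_neg subspace_scale)
    have "((\<lambda>u. c (u, v)) has_vector_derivative - (B (m v) (\<epsilon>2 u) *\<^sub>R \<nu> u)) (at u)"
      unfolding c_def fst_conv snd_conv
      by (rule has_vector_derivative_eq_rhs[OF has_vector_derivative_minus[OF
              scaleR_has_vector_derivative[OF B_has_vector_derivative[OF has_vector_derivative_const eps_derivative(2)[OF uv(1)]]
                eps_derivative(2)[OF uv(1)]]]])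
        (simp add: zero[OF uv] B_simps)
    then have "D c (u, v) (1, 0) = - (B (m v) (\<epsilon>2 u) *\<^sub>R \<nu> u)"
      using vector_derivative_unique_at[OF partial_derivatives(1)[OF smc]] uv by blast
    then show "D c (u, v) (1, 0) = - (wedge B (\<epsilon>2 u) (\<nu> u) *v m v)"
      using zero[OF uv] by (simp add: wedge_apply B_sym[of _ "m v"])
  next
    show "u0 \<in> I1" using u0 .
    show "h u0 * B e1 (wedge B (\<epsilon>2 u0) (\<nu> u0) *v \<nu> u0) + B e2 (wedge B (\<epsilon>2 u0) (\<nu> u0) *v \<nu> u0) \<noteq> 0"
      using g_pos[OF u0] eps_derivative_products(8)[OF u0 eps(2)[OF u0]] B_sym[of "\<epsilon>2 u0" "\<nu> u0"]
      by (simp add: wedge_apply B_simps eps[OF u0] g_def[symmetric])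
  qed
qed

text \<open>The coefficients of \<open>t\<^sup>0\<close> and \<open>t\<^sup>1\<close> in the equation of a linear conserved quantity.\<close>

lemma lcq_derivatives:
  assumes "linear_conserved_quantity E I1 C \<xi> p0 p1" "u \<in> I1"
  shows "(p0 has_vector_derivative 0) (at u)" "(p1 has_vector_derivative - (\<xi> u 1 *v p0 u)) (at u)"
proof -
  have p: "smooth_on I1 p0" "smooth_on I1 p1"
    and eq: "\<And>t. D (\<lambda>w. p0 w + t *\<^sub>R p1 w) u 1 + t *\<^sub>R (\<xi> u 1 *v (p0 u + t *\<^sub>R p1 u)) = 0"
    using assms unfolding linear_conserved_quantity_def sections_def by blast+
  note d = smooth_on_curve_derivative[OF p(1) assms(2)] smooth_on_curve_derivative[OF p(2) assms(2)]
  have "((\<lambda>w. p0 w + t *\<^sub>R p1 w) has_vector_derivative D p0 u 1 + t *\<^sub>R D p1 u 1) (at u)" for t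
    by (intro has_vector_derivative_add d(1)
        scaleR_right_has_vector_derivative[OF d(2)])
  then have "D (\<lambda>w. p0 w + t *\<^sub>R p1 w) u 1 = D p0 u 1 + t *\<^sub>R D p1 u 1" for t
    using D_curve[of _ _ u 1] by fastforce
  then have eq': "D p0 u 1 + t *\<^sub>R D p1 u 1 + t *\<^sub>R (\<xi> u 1 *v (p0 u + t *\<^sub>R p1 u)) = 0" for t
    using eq by simp
  have p0': "D p0 u 1 = 0" using eq'[of 0] by simp
  have "D p1 u 1 + \<xi> u 1 *v p0 u = 0"
  proof -
    \<comment> \<open>the terms of odd order in \<open>t\<close>, from \<open>t = 1\<close> and \<open>t = -1\<close>\<close>
    have "D p1 u 1 + \<xi> u 1 *v p0 u + \<xi> u 1 *v p1 u = 0"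
      "- (D p1 u 1 + \<xi> u 1 *v p0 u) + \<xi> u 1 *v p1 u = 0"
      using eq'[of 1] eq'[of "-1"] p0'
      by (simp_all add: mv_simps algebra_simps)
    then have "2 *\<^sub>R (D p1 u 1 + \<xi> u 1 *v p0 u) = 0"
      by (simp add: scaleR_2 algebra_simps)
    then show ?thesis by simp
  qed
  then have "D p1 u 1 = - (\<xi> u 1 *v p0 u)" by (simp only: eq_neg_iff_add_eq_0)
  then show "(p0 has_vector_derivative 0) (at u)" "(p1 has_vector_derivative - (\<xi> u 1 *v p0 u)) (at u)"
    using d p0' by simp_all
qed

text \<open>The given form of the polarisation is \<open>\<xi>0 - d\<tau>\<close> with \<open>\<xi>0\<close> in \<open>C \<and> C\<^sup>\<bottom>\<close>; replacing \<open>p1\<close> by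
  \<open>p1 - \<tau> p0\<close> gives conserved quantities of \<open>\<xi>0\<close>.\<close>

lemma lie_applicable_if_constrained_elastic:
  assumes elastic: "constrained_elastic B (perp_in B UNIV (L v0)) I1 C W0"
    and m: "\<And>v. v \<in> I2 \<Longrightarrow> m v \<in> W0"
  shows "lie_applicable B \<Sigma> f"
proof -
  obtain P \<xi> p0 p1 where W0: "dim W0 = 3"
    and pol: "polarisation B (perp_in B UNIV (L v0)) I1 C P" "\<xi> \<in> P"
    and lcq: "\<forall>i<3::nat. linear_conserved_quantity (perp_in B UNIV (L v0)) I1 C \<xi> (p0 i) (p1 i)"
    and span: "\<forall>u\<in>I1. {\<Sum>i<3. a i *\<^sub>R p0 i u |a :: nat \<Rightarrow> real. True} = W0"
    using elastic unfolding constrained_elastic_def by (elim conjE exE) (rule that)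
  obtain \<xi>0 where \<xi>0: "\<xi>0 \<in> one_forms I1 \<Xi>" "quad_nonzero I1 C \<xi>0"
    "P = gauge_orbit B I1 C \<xi>0" using pol(1) unfolding polarisation_def by blast
  obtain \<tau> where \<tau>: "\<tau> \<in> sections I1 (\<lambda>u. wedge_space B (C u) (C u))"
    "\<forall>u\<in>I1. \<forall>X. \<xi> u X = \<xi>0 u X - D \<tau> u X" using pol(2) \<xi>0(3) unfolding gauge_orbit_def by blast
  have sm\<tau>: "smooth_on I1 \<tau>" using \<tau>(1) by (simp add: sections_def)
  obtain u0 where u0: "u0 \<in> I1" using open_interval_imp(4)[OF I1] by blast
  define q where "q i = p0 i u0" for i
  have p0q: "p0 i u = q i" if "i < 3" "u \<in> I1" for i u
    unfolding q_def using lcq that(1) lcq_derivatives(1)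
    by (intro zero_derivative_constant[OF open_interval_imp(2)[OF I1] u0 that(2)]) blast
  obtain \<phi> where \<phi>: "\<And>i. linear (\<phi> i)" "\<And>x. x \<in> W0 \<Longrightarrow> x = (\<Sum>i<3. \<phi> i x *\<^sub>R q i)"
    using coordinates_on_subspace[of W0 q] span u0 W0 unfolding q_def by blast
  define c where "c p = (\<Sum>i<3. \<phi> i (m (snd p)) *\<^sub>R (p1 i (fst p) - \<tau> (fst p) *v q i))" for p
  have p1: "smooth_on I1 (p1 i)" "\<And>u. u \<in> I1 \<Longrightarrow> p1 i u \<in> C u" if "i < 3" for i
    using lcq that unfolding linear_conserved_quantity_def sections_def by blast+
  define \<xi>1 where "\<xi>1 u = \<xi>0 u 1" for u
  have \<xi>1: "smooth_on I1 \<xi>1" "\<And>u. u \<in> I1 \<Longrightarrow> \<xi>1 u \<in> \<Xi> u"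
    using \<xi>0(1) unfolding one_forms_def sections_def \<xi>1_def by blast+
  obtain u X Y where quad: "u \<in> I1" "quad I1 C \<xi>0 u X Y \<noteq> 0"
    using \<xi>0(2) unfolding quad_nonzero_def by blast
  have lin: "\<xi>0 u X = X *\<^sub>R \<xi>1 u"
    using \<xi>0(1) quad(1) linear_cmul[of "\<xi>0 u" X 1] by (simp add: one_forms_def \<xi>1_def)
  note Xu = Xi_props[OF \<xi>1(2)[OF quad(1)] quad(1)]
  have "quad I1 C \<xi>0 u X Y = Y * (h u * B e1 (\<xi>0 u X *v \<nu> u) + B e2 (\<xi>0 u X *v \<nu> u))"
    using Xu C_facts(1)[OF quad(1)]
    by (intro quad_curve[OF quad(1) refl])
      (simp_all add: lin mv_simps subspace_scale)
  then have nz: "h u * B e1 (\<xi>1 u *v \<nu> u) + B e2 (\<xi>1 u *v \<nu> u) \<noteq> 0"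
    using quad(2) by (auto simp: lin mv_simps B_simps
        distrib_left mult.left_commute[of _ X] simp flip: distrib_left)
  show ?thesis
  proof (rule lie_applicable_of_curve_form[OF \<xi>1 _ _ _ quad(1) nz])
    show smc: "smooth_on \<Sigma> c"
      unfolding c_def
      by (intro smooth_on_sum smooth_on_scaleR smooth_on_diff smooth_on_mv opS smooth_on_const
          smooth_on_fst[OF _ op1 op2] sm\<tau> p1
          smooth_on_linear_compose[OF linear_conv_bounded_linear[THEN iffD1, OF \<phi>(1)]] smooth_m_snd) auto
    fix u v assume uv: "u \<in> I1" "v \<in> I2"
    have "\<tau> u *v x \<in> C u" for x
      using \<tau>(1) uv(1) by (intro wedge_space_range[OF _ C_facts(1)[OF uv(1)] subset_refl subset_refl])
        (auto simp: sections_def)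
    then show "c (u, v) \<in> C u"
      using C_facts(1)[OF uv(1)] p1 uv(1)
      by (auto simp: c_def intro!: subspace_sum subspace_scale subspace_diff)
    have "((\<lambda>u. p1 i u - \<tau> u *v q i) has_vector_derivative - (\<xi>1 u *v q i)) (at u)" if i: "i < 3" for i
    proof -
      have d1: "(p1 i has_vector_derivative - (\<xi> u 1 *v q i)) (at u)"
        using lcq_derivatives(2)[OF _ uv(1)] lcq i p0q[OF i uv(1)] by metis
      have "((\<lambda>u. \<tau> u *v q i) has_vector_derivative D \<tau> u 1 *v q i) (at u)"
        using mv_has_vector_derivative[OF smooth_on_curve_derivative[OF sm\<tau> uv(1)]
            has_vector_derivative_const] by simp
      from has_vector_derivative_diff[OF d1 this] show ?thesis
        using \<tau>(2) uv(1) by (simp add: \<xi>1_def mv_simps)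
    qed
    then have "((\<lambda>u. c (u, v)) has_vector_derivative (\<Sum>i<3. \<phi> i (m v) *\<^sub>R - (\<xi>1 u *v q i))) (at u)"
      unfolding c_def fst_conv snd_conv
      by (intro has_vector_derivative_sum scaleR_right_has_vector_derivative)
        auto
    then have "D c (u, v) (1, 0) = (\<Sum>i<3. \<phi> i (m v) *\<^sub>R - (\<xi>1 u *v q i))"
      using vector_derivative_unique_at[OF partial_derivatives(1)[OF smc]] uv by blast
    also have "\<dots> = - (\<xi>1 u *v (\<Sum>i<3. \<phi> i (m v) *\<^sub>R q i))"
      by (simp add: bounded_bilinear.sum_right[OF bounded_bilinear_mv] mv_simps sum_negf)
    also have "\<dots> = - (\<xi>1 u *v m v)" using \<phi>(2)[OF m[OF uv(2)]] by simp
    finally show "D c (u, v) (1, 0) = - (\<xi>1 u *v m v)" .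
  qed
qed

end

section \<open>From closed forms on the surface to forms along the curve\<close>

text \<open>A closed form \<open>\<Psi> (Z du + Y dv) A\<close> with values in \<open>f \<and> f\<^sup>\<bottom>\<close>. The values of \<open>Z\<close> and \<open>Y\<close> are described
  by the properties of elements of \<open>C \<and> C\<^sup>\<bottom>\<close> that are used, where \<open>C\<^sup>\<bottom>\<close> contains \<open>l0\<close>.\<close>

locale closed_form = evolved_surface +
  fixes Z Y :: "real \<times> real \<Rightarrow> real^6^6"
  assumes smooth_Z: "smooth_on (I1 \<times> I2) Z" and smooth_Y: "smooth_on (I1 \<times> I2) Y"
    and Z_skew: "\<And>u v x y. u \<in> I1 \<Longrightarrow> v \<in> I2 \<Longrightarrow> B (Z (u, v) *v x) y = - B x (Z (u, v) *v y)"
    and Y_skew: "\<And>u v x y. u \<in> I1 \<Longrightarrow> v \<in> I2 \<Longrightarrow> B (Y (u, v) *v x) y = - B x (Y (u, v) *v y)"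
    and Z_kills: "\<And>u v x. u \<in> I1 \<Longrightarrow> v \<in> I2 \<Longrightarrow> x \<in> C u \<Longrightarrow> Z (u, v) *v x = 0"
    and Y_kills: "\<And>u v x. u \<in> I1 \<Longrightarrow> v \<in> I2 \<Longrightarrow> x \<in> C u \<Longrightarrow> Y (u, v) *v x = 0"
    and Z_maps: "\<And>u v x. u \<in> I1 \<Longrightarrow> v \<in> I2 \<Longrightarrow> (\<And>y. y \<in> C u \<Longrightarrow> B x y = 0) \<Longrightarrow> Z (u, v) *v x \<in> C u"
    and Y_maps: "\<And>u v x. u \<in> I1 \<Longrightarrow> v \<in> I2 \<Longrightarrow> (\<And>y. y \<in> C u \<Longrightarrow> B x y = 0) \<Longrightarrow> Y (u, v) *v x \<in> C u"
    and closed: "\<And>u v. u \<in> I1 \<Longrightarrow> v \<in> I2 \<Longrightarrow>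
      D Y (u, v) (1, 0) = D Z (u, v) (0, 1) + J v ** Z (u, v) - Z (u, v) ** J v"
begin

lemma Yu_derivative:
  assumes "u \<in> I1" "v \<in> I2" "(a has_vector_derivative a') (at u)"
  shows "((\<lambda>u. Y (u, v) *v a u) has_vector_derivative Y (u, v) *v a' + D Y (u, v) (1, 0) *v a u) (at u)"
  using mv_has_vector_derivative[OF partial_derivatives(1)[OF smooth_Y, of u v] assms(3)] assms(1,2) by simp

lemma Zv_derivative:
  assumes "u \<in> I1" "v \<in> I2"
  shows "((\<lambda>v. Z (u, v) *v x) has_vector_derivative D Z (u, v) (0, 1) *v x) (at v)"
  using mv_has_vector_derivative[OF partial_derivatives(2)[OF smooth_Z, of u v] has_vector_derivative_const] assms
  by simp

lemma closed_apply:
  assumes "u \<in> I1" "v \<in> I2"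
  shows "D Y (u, v) (1, 0) *v x =
    D Z (u, v) (0, 1) *v x + J v *v (Z (u, v) *v x) - Z (u, v) *v (J v *v x)"
  unfolding closed[OF assms]
  by (simp add: mv_simps matrix_vector_mul_assoc)

lemmas zero_derivative_u = derivative_zero_if_constant[OF _ op1, where k = 0]

lemmas zero_derivative_v = derivative_zero_if_constant[OF _ op2, where k = 0]

text \<open>The closedness equation applied to a section of \<open>C\<close>, where \<open>Z\<close> and \<open>Y\<close> vanish.\<close>

lemma closed_on_C:
  assumes uv: "u \<in> I1" "v \<in> I2" and a: "\<And>w. w \<in> I1 \<Longrightarrow> a w \<in> C w" "(a has_vector_derivative a') (at u)"
  shows "Y (u, v) *v a' = - (B (m v) (a u) *\<^sub>R (Z (u, v) *v l0))"
proof -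
  have "Y (u, v) *v a' + D Y (u, v) (1, 0) *v a u = 0"
    by (rule zero_derivative_u[OF Yu_derivative[OF uv a(2)] uv(1)]) (rule Y_kills[OF _ uv(2) a(1)])
  moreover have "D Z (u, v) (0, 1) *v a u = 0"
    by (rule zero_derivative_v[OF Zv_derivative[OF uv] uv(2)]) (rule Z_kills[OF uv(1) _ a(1)[OF uv(1)]])
  ultimately show ?thesis
    unfolding closed_apply[OF uv] Z_kills[OF uv a(1)[OF uv(1)]] J_on_C[OF uv(1) a(1)[OF uv(1)]]
    by (simp add: mv_simps
        eq_neg_iff_add_eq_0)
qed

text \<open>Closedness on \<open>C\<close> removes the \<open>l0\<close>-part of \<open>Z\<close> and the \<open>\<nu>\<close>-part of \<open>Y\<close>, because \<open>m\<close> does not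
  vanish on \<open>\<epsilon>1 - h \<epsilon>2\<close>.\<close>

lemma Z_l0_Y_nu:
  assumes uv: "u \<in> I1" "v \<in> I2"
  shows "Z (u, v) *v l0 = 0" "Y (u, v) *v \<nu> u = 0"
proof -
  have 1: "h u *\<^sub>R (Y (u, v) *v \<nu> u) = - (B (m v) (\<epsilon>1 u) *\<^sub>R (Z (u, v) *v l0))"
    using closed_on_C[OF uv eps(1) eps_derivative(1)[OF uv(1)]]
    by (simp add: eps1_derivative[OF uv(1)] mv_simps)
  have 2: "Y (u, v) *v \<nu> u = - (B (m v) (\<epsilon>2 u) *\<^sub>R (Z (u, v) *v l0))"
    using closed_on_C[OF uv eps(2) eps_derivative(2)[OF uv(1)]] by simp
  have "B (m v) (\<epsilon>1 u - h u *\<^sub>R \<epsilon>2 u) *\<^sub>R (Z (u, v) *v l0) = 0"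
    using 1 unfolding 2 by (auto simp: B_simps algebra_simps)
  then show "Z (u, v) *v l0 = 0" using m_nonzero_on_s1[OF uv] by simp
  then show "Y (u, v) *v \<nu> u = 0" using 2 by simp
qed

text \<open>What is left is \<open>Z = \<alpha> \<epsilon>1 \<and> \<epsilon>2 + \<beta>1 \<epsilon>1 \<and> \<nu> + \<beta>2 \<epsilon>2 \<and> \<nu>\<close> and \<open>Y = \<kappa> \<epsilon>1 \<and> \<epsilon>2 + l0 \<and> c\<close> with
  \<open>c = x \<epsilon>1 + y \<epsilon>2\<close>; see \<open>Z_values\<close> and \<open>Y_values\<close>.\<close>

definition c where "c p = Y p *v l0"
definition x where "x p = B e1 (c p)"
definition y where "y p = B e2 (c p)"
definition \<kappa> where "\<kappa> p = B e2 (Y p *v e1)"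
definition \<alpha> where "\<alpha> p = B e2 (Z p *v e1)"
definition \<beta>1 where "\<beta>1 p = - B e1 (Z p *v \<nu> (fst p)) / g (fst p)"
definition \<beta>2 where "\<beta>2 p = - B e2 (Z p *v \<nu> (fst p)) / g (fst p)"

lemma g_nonzero_fst: "p \<in> \<Sigma> \<Longrightarrow> g (fst p) \<noteq> 0"
  using g_pos[of "fst p"] by force

lemma smooth_coefficients:
  "smooth_on \<Sigma> c" "smooth_on \<Sigma> \<kappa>" "smooth_on \<Sigma> \<alpha>" "smooth_on \<Sigma> \<beta>1" "smooth_on \<Sigma> \<beta>2"
  unfolding c_def \<kappa>_def \<alpha>_def \<beta>1_def \<beta>2_def
  by (intro smooth_on_B smooth_on_mv opS smooth_on_const smooth_Y smooth_Z smooth_on_divide smooth_on_minus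
      smooth_on_fst smooth_nu smooth_g op1 op2 g_nonzero_fst; assumption)+

lemma c_in_C: "u \<in> I1 \<Longrightarrow> v \<in> I2 \<Longrightarrow> c (u, v) \<in> C u"
  unfolding c_def using Y_maps C_facts(3) by blast

lemma c_expand: "u \<in> I1 \<Longrightarrow> v \<in> I2 \<Longrightarrow> c (u, v) = x (u, v) *\<^sub>R \<epsilon>1 u + y (u, v) *\<^sub>R \<epsilon>2 u"
  unfolding x_def y_def using C_expand c_in_C by blast

lemma c_derivative: assumes uv: "u \<in> I1" "v \<in> I2" shows "D c (u, v) (1, 0) = - (Z (u, v) *v m v)"
proof -
  have "((\<lambda>u. c (u, v)) has_vector_derivative D Y (u, v) (1, 0) *v l0) (at u)"
    unfolding c_def using Yu_derivative[OF uv has_vector_derivative_const, of l0] by simp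
  then have "D c (u, v) (1, 0) = D Y (u, v) (1, 0) *v l0"
    using vector_derivative_unique_at[OF partial_derivatives(1)[OF smooth_coefficients(1)]] uv by blast
  moreover have "D Z (u, v) (0, 1) *v l0 = 0"
    by (rule zero_derivative_v[OF Zv_derivative[OF uv] uv(2)]) (rule Z_l0_Y_nu(1)[OF uv(1)])
  moreover have "J v *v l0 = m v"
    using l0_m[OF uv(2)] B_sym[of "m v" l0] by (simp add: wedge_apply l0(2))
  ultimately show ?thesis
    unfolding closed_apply[OF uv] Z_l0_Y_nu(1)[OF uv] by simp
qed

lemma Z_values:
  assumes uv: "u \<in> I1" "v \<in> I2"
  shows "Z (u, v) *v \<nu> u = - (g u *\<^sub>R (\<beta>1 (u, v) *\<^sub>R \<epsilon>1 u + \<beta>2 (u, v) *\<^sub>R \<epsilon>2 u))"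
    "Z (u, v) *v e1 = \<alpha> (u, v) *\<^sub>R \<epsilon>2 u + \<beta>1 (u, v) *\<^sub>R \<nu> u"
    "Z (u, v) *v e2 = - (\<alpha> (u, v) *\<^sub>R \<epsilon>1 u) + \<beta>2 (u, v) *\<^sub>R \<nu> u"
proof -
  note u = uv(1)
  have g: "g u \<noteq> 0" using g_pos[OF u] by simp
  have ZC: "Z (u, v) *v \<nu> u \<in> C u" using Z_maps[OF uv] eps_derivative_products(8)[OF u] by blast
  have b: "B e1 (Z (u, v) *v \<nu> u) = - (g u * \<beta>1 (u, v))" "B e2 (Z (u, v) *v \<nu> u) = - (g u * \<beta>2 (u, v))"
    using g by (simp_all add: \<beta>1_def \<beta>2_def)
  show "Z (u, v) *v \<nu> u = - (g u *\<^sub>R (\<beta>1 (u, v) *\<^sub>R \<epsilon>1 u + \<beta>2 (u, v) *\<^sub>R \<epsilon>2 u))"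
    using C_expand[OF u ZC] unfolding b by (simp add: algebra_simps)
  have flip: "B w (Z (u, v) *v z) = - B z (Z (u, v) *v w)" for w z
    using Z_skew[OF uv, of z w] B_sym[of w] by simp
  have self: "B z (Z (u, v) *v z) = 0" for z using flip[of z z] by simp
  note zero = Z_l0_Y_nu(1)[OF uv] Z_kills[OF uv eps(1)[OF u]] Z_kills[OF uv eps(2)[OF u]]
  note pr = eps_products[OF u] eps_derivative_products[OF u] eps[OF u] g_def[of u, symmetric]
  have eps_nu: "B (\<epsilon>1 u) (\<nu> u) = 0" "B (\<epsilon>2 u) (\<nu> u) = 0"
    using eps_derivative_products(8)[OF u] eps(1,2)[OF u] B_sym[of _ "\<nu> u"] by auto
  have nu_eps: "B (\<nu> u) (\<epsilon>1 u) = 0" "B (\<nu> u) (\<epsilon>2 u) = 0"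
    using eps_derivative_products(8)[OF u] eps(1,2)[OF u] by auto
  show "Z (u, v) *v e1 = \<alpha> (u, v) *\<^sub>R \<epsilon>2 u + \<beta>1 (u, v) *\<^sub>R \<nu> u"
    by (rule frame_eqI[OF u])
      (simp_all add: flip[of l0] flip[of "\<epsilon>1 u"] flip[of "\<epsilon>2 u"] flip[of "\<nu> u"] zero self b B_simps
        pr eps_nu nu_eps \<alpha>_def)
  have "B e1 (Z (u, v) *v e2) = - \<alpha> (u, v)" unfolding \<alpha>_def by (rule flip)
  then show "Z (u, v) *v e2 = - (\<alpha> (u, v) *\<^sub>R \<epsilon>1 u) + \<beta>2 (u, v) *\<^sub>R \<nu> u"
    by (intro frame_eqI[OF u])
      (simp_all add: flip[of l0] flip[of "\<epsilon>1 u"] flip[of "\<epsilon>2 u"] flip[of "\<nu> u"] zero self b B_simps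
        pr eps_nu nu_eps)
qed

lemma Y_values:
  assumes uv: "u \<in> I1" "v \<in> I2"
  shows "Y (u, v) *v e1 = \<kappa> (u, v) *\<^sub>R \<epsilon>2 u - x (u, v) *\<^sub>R l0"
    "Y (u, v) *v e2 = - (\<kappa> (u, v) *\<^sub>R \<epsilon>1 u) - y (u, v) *\<^sub>R l0"
proof -
  note u = uv(1)
  have flip: "B w (Y (u, v) *v z) = - B z (Y (u, v) *v w)" for w z
    using Y_skew[OF uv, of z w] B_sym[of w] by simp
  have self: "B z (Y (u, v) *v z) = 0" for z using flip[of z z] by simp
  note zero = Z_l0_Y_nu(2)[OF uv] Y_kills[OF uv eps(1)[OF u]] Y_kills[OF uv eps(2)[OF u]]
  have l0_eps: "B (\<epsilon>1 u) l0 = 0" "B (\<epsilon>2 u) l0 = 0" "B (\<nu> u) l0 = 0" "B e1 l0 = 0" "B e2 l0 = 0"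
    using eps_products[OF u] eps_derivative_products(2)[OF u] l0_e B_sym[of _ l0] by auto
  have nu_eps: "B (\<nu> u) (\<epsilon>1 u) = 0" "B (\<nu> u) (\<epsilon>2 u) = 0"
    using eps_derivative_products(8)[OF u] eps(1,2)[OF u] by auto
  have c': "B e1 (Y (u, v) *v l0) = x (u, v)" "B e2 (Y (u, v) *v l0) = y (u, v)"
    by (simp_all add: x_def y_def c_def)
  show "Y (u, v) *v e1 = \<kappa> (u, v) *\<^sub>R \<epsilon>2 u - x (u, v) *\<^sub>R l0"
    by (rule frame_eqI[OF u])
      (simp_all add: flip[of l0] flip[of "\<epsilon>1 u"] flip[of "\<epsilon>2 u"] flip[of "\<nu> u"] zero self B_simps
        eps_products[OF u] eps[OF u] l0_eps nu_eps l0(2) c' \<kappa>_def)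
  have "B e1 (Y (u, v) *v e2) = - \<kappa> (u, v)" unfolding \<kappa>_def by (rule flip)
  then show "Y (u, v) *v e2 = - (\<kappa> (u, v) *\<^sub>R \<epsilon>1 u) - y (u, v) *\<^sub>R l0"
    by (intro frame_eqI[OF u])
      (simp_all add: flip[of l0] flip[of "\<epsilon>1 u"] flip[of "\<epsilon>2 u"] flip[of "\<nu> u"] zero self B_simps
        eps_products[OF u] eps[OF u] l0_eps nu_eps l0(2) c')
qed

lemma v_derivatives:
  assumes uv: "u \<in> I1" "v \<in> I2"
  shows "D \<alpha> (u, v) (0, 1) = D \<kappa> (u, v) (1, 0)"
    "D \<beta>1 (u, v) (0, 1) = \<kappa> (u, v)" "D \<beta>2 (u, v) (0, 1) = - h u * \<kappa> (u, v)"
proof -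
  note u = uv(1)
  have uv': "(u, v) \<in> \<Sigma>" using uv by simp
  have g: "g u \<noteq> 0" using g_pos[OF u] by simp
  have BZ: "((\<lambda>v. B e (Z (u, v) *v w)) has_vector_derivative B e (D Z (u, v) (0, 1) *v w)) (at v)" for e w
    using B_has_vector_derivative[OF has_vector_derivative_const Zv_derivative[OF uv], of e] by (simp add: B_simps)
  have "D \<alpha> (u, v) (0, 1) = B e2 (D Z (u, v) (0, 1) *v e1)"
    using vector_derivative_unique_at[OF partial_derivatives(2)[OF smooth_coefficients(3) uv']] BZ
    unfolding \<alpha>_def by blast
  moreover have "((\<lambda>u. B e2 (Y (u, v) *v e1)) has_vector_derivative B e2 (D Y (u, v) (1, 0) *v e1)) (at u)"
    using B_has_vector_derivative[OF has_vector_derivative_const Yu_derivative[OF uv has_vector_derivative_const], of e2]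
    by (simp add: B_simps)
  then have "D \<kappa> (u, v) (1, 0) = B e2 (D Y (u, v) (1, 0) *v e1)"
    using vector_derivative_unique_at[OF partial_derivatives(1)[OF smooth_coefficients(2) uv']]
    unfolding \<kappa>_def by blast
  moreover have "B e2 l0 = 0" "B e2 (Z (u, v) *v l0) = 0" "B l0 (Z (u, v) *v e1) = 0"
    using l0_e B_sym[of e2 l0] Z_l0_Y_nu(1)[OF uv] Z_skew[OF uv, of l0 e1] by (auto simp: B_simps)
  ultimately show "D \<alpha> (u, v) (0, 1) = D \<kappa> (u, v) (1, 0)"
    unfolding closed_apply[OF uv]
    by (simp add: wedge_apply B_simps l0_e mv_simps)
  have "Y (u, v) *v D \<nu> u 1 + D Y (u, v) (1, 0) *v \<nu> u = 0"
    by (rule zero_derivative_u[OF Yu_derivative[OF uv smooth_on_curve_derivative[OF smooth_nu u]] u])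
      (rule Z_l0_Y_nu(2)[OF _ uv(2)])
  moreover have "Z (u, v) *v \<nu> u \<in> C u" using Z_maps[OF uv] eps_derivative_products(8)[OF u] by blast
  moreover from this have "B l0 (Z (u, v) *v \<nu> u) = 0" by (rule C_facts(3)[OF u])
  ultimately have Yn: "D Z (u, v) (0, 1) *v \<nu> u = B (m v) (Z (u, v) *v \<nu> u) *\<^sub>R l0 - Y (u, v) *v D \<nu> u 1"
    unfolding closed_apply[OF uv]
    by (simp add: J_on_C[OF u] wedge_apply eps_derivative_products(2)[OF u] Z_l0_Y_nu(1)[OF uv]
        mv_simps algebra_simps)
  have "B e (D Z (u, v) (0, 1) *v \<nu> u) = B (D \<nu> u 1) (Y (u, v) *v e)" if "B e l0 = 0" for e
    unfolding Yn using that Y_skew[OF uv, of "D \<nu> u 1" e] B_sym[of e] by (simp add: B_simps)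
  then have n: "B e1 (D Z (u, v) (0, 1) *v \<nu> u) = - (g u * \<kappa> (u, v))"
    "B e2 (D Z (u, v) (0, 1) *v \<nu> u) = h u * g u * \<kappa> (u, v)"
    using nu_derivative_products[OF u] l0_e B_sym[of _ l0] Y_values[OF uv] by (simp_all add: B_simps)
  have quot: "((\<lambda>v. - B e (Z (u, v) *v \<nu> u) / g u) has_vector_derivative
      - B e (D Z (u, v) (0, 1) *v \<nu> u) / g u) (at v)" for e
    by (intro has_vector_derivative_divide has_vector_derivative_minus BZ)
  show "D \<beta>1 (u, v) (0, 1) = \<kappa> (u, v)"
    using vector_derivative_unique_at[OF partial_derivatives(2)[OF smooth_coefficients(4) uv']] quot[of e1] n g
    unfolding \<beta>1_def by fastforce
  show "D \<beta>2 (u, v) (0, 1) = - h u * \<kappa> (u, v)"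
    using vector_derivative_unique_at[OF partial_derivatives(2)[OF smooth_coefficients(5) uv']] quot[of e2] n g
    unfolding \<beta>2_def by fastforce
qed

text \<open>Subtracting the \<open>u\<close>-derivative of \<open>\<tau> = \<beta>1 \<epsilon>1 \<and> \<epsilon>2\<close> from \<open>Z\<close> leaves \<open>a \<epsilon>1 \<and> \<epsilon>2 + b \<epsilon>2 \<and> \<nu>\<close>, whose
  coefficients do not depend on \<open>v\<close> by closedness; the definitions take their values at \<open>v0\<close>.\<close>

definition a where "a u = \<alpha> (u, v0) - D \<beta>1 (u, v0) (1, 0)"
definition b where "b u = h u * \<beta>1 (u, v0) + \<beta>2 (u, v0)"

lemma a_eq: assumes "u \<in> I1" "v \<in> I2" shows "\<alpha> (u, v) - D \<beta>1 (u, v) (1, 0) = a u"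
  unfolding a_def
  by (rule cross_derivative_constant[OF I1 I2 smooth_coefficients(2,4,3)])
    (use v_derivatives assms v0 in auto)

lemma b_eq: assumes "u \<in> I1" "v \<in> I2" shows "h u * \<beta>1 (u, v) + \<beta>2 (u, v) = b u"
proof -
  have "((\<lambda>v. h u * \<beta>1 (u, v) + \<beta>2 (u, v)) has_vector_derivative 0) (at v)" if "v \<in> I2" for v
    using has_vector_derivative_add[OF has_vector_derivative_mult_right[OF
          partial_derivatives(2)[OF smooth_coefficients(4), of u v], of "h u"]
        partial_derivatives(2)[OF smooth_coefficients(5), of u v]] v_derivatives[OF assms(1) that] assms that
    by simp
  then show ?thesis
    unfolding b_def by (intro zero_derivative_constant[OF open_interval_imp(2)[OF I2] v0 assms(2)])
qed

lemma smooth_a: "smooth_on I1 a" and smooth_b: "smooth_on I1 b"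
  unfolding a_def b_def
  by (intro smooth_on_diff smooth_on_add smooth_on_mult smooth_h op1
      smooth_on_slices(1)[OF smooth_coefficients(3) op1 op2 v0]
      smooth_on_slices(1)[OF smooth_coefficients(4) op1 op2 v0]
      smooth_on_slices(1)[OF smooth_coefficients(5) op1 op2 v0]
      smooth_on_slices(1)[OF smooth_on_D[OF smooth_coefficients(4)] op1 op2 v0])+

text \<open>The resulting form \<open>\<xi>\<close> along \<open>C\<close>, and \<open>\<zeta> = c + \<tau> m = x' \<epsilon>1 + y' \<epsilon>2\<close>, which solves
  \<open>\<zeta>\<^sub>u = - \<xi> m\<close>.\<close>

definition \<xi> where "\<xi> u = a u *\<^sub>R wedge B (\<epsilon>1 u) (\<epsilon>2 u) + b u *\<^sub>R wedge B (\<epsilon>2 u) (\<nu> u)"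
definition x' where "x' p = x p - \<beta>1 p * B (m (snd p)) (\<epsilon>2 (fst p))"
definition y' where "y' p = y p + \<beta>1 p * B (m (snd p)) (\<epsilon>1 (fst p))"
definition \<zeta> where "\<zeta> p = x' p *\<^sub>R \<epsilon>1 (fst p) + y' p *\<^sub>R \<epsilon>2 (fst p)"

lemma smooth_gauged_coordinates: "smooth_on \<Sigma> x'" "smooth_on \<Sigma> y'"
  unfolding x'_def y'_def x_def y_def
  by (intro smooth_on_diff smooth_on_add smooth_on_mult smooth_on_B smooth_on_const opS smooth_coefficients
      smooth_m_snd smooth_on_fst smooth_eps op1 op2)+

lemma smooth_zeta: "smooth_on \<Sigma> \<zeta>"
  unfolding \<zeta>_def
  by (intro smooth_on_add smooth_on_scaleR smooth_gauged_coordinates opS smooth_on_fst smooth_eps op1 op2)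

lemma M_derivatives:
  assumes "u \<in> I1"
  shows "((\<lambda>u. B n (\<epsilon>1 u)) has_vector_derivative h u * B n (\<nu> u)) (at u)"
    "((\<lambda>u. B n (\<epsilon>2 u)) has_vector_derivative B n (\<nu> u)) (at u)"
    "((\<lambda>u. B n (\<nu> u)) has_vector_derivative B n (D \<nu> u 1)) (at u)"
  using B_has_vector_derivative[OF has_vector_derivative_const eps_derivative(1)[OF assms], of n]
    B_has_vector_derivative[OF has_vector_derivative_const eps_derivative(2)[OF assms], of n]
    B_has_vector_derivative[OF has_vector_derivative_const smooth_on_curve_derivative[OF smooth_nu assms], of n]
  by (simp_all add: B_simps eps1_derivative[OF assms])

lemma gauged_relations:
  assumes uv: "u \<in> I1" "v \<in> I2"
  shows "((\<lambda>u. x' (u, v)) has_vector_derivative a u * B (m v) (\<epsilon>2 u)) (at u)"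
    "((\<lambda>u. y' (u, v)) has_vector_derivative - a u * B (m v) (\<epsilon>1 u) + b u * B (m v) (\<nu> u)) (at u)"
    "h u * x' (u, v) + y' (u, v) = - b u * B (m v) (\<epsilon>2 u)"
proof -
  note u = uv(1)
  have uv': "(u, v) \<in> \<Sigma>" using uv by simp
  note dc = partial_derivatives(1)[OF smooth_coefficients(1) uv', unfolded c_derivative[OF uv]]
  note dM = M_derivatives[OF u, of "m v"]
  note d\<beta> = partial_derivatives(1)[OF smooth_coefficients(4) uv']
  have skew: "B w (Z (u, v) *v m v) = - B (m v) (Z (u, v) *v w)" for w
    using Z_skew[OF uv, of "m v" w] B_sym[of w] by simp
  have dx: "((\<lambda>u. x (u, v)) has_vector_derivative \<alpha> (u, v) * B (m v) (\<epsilon>2 u) + \<beta>1 (u, v) * B (m v) (\<nu> u)) (at u)"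
    unfolding x_def
    by (rule has_vector_derivative_eq_rhs[OF B_has_vector_derivative[OF has_vector_derivative_const dc]])
      (simp add: B_simps skew Z_values[OF uv])
  have dy: "((\<lambda>u. y (u, v)) has_vector_derivative - \<alpha> (u, v) * B (m v) (\<epsilon>1 u) + \<beta>2 (u, v) * B (m v) (\<nu> u)) (at u)"
    unfolding y_def
    by (rule has_vector_derivative_eq_rhs[OF B_has_vector_derivative[OF has_vector_derivative_const dc]])
      (simp add: B_simps skew Z_values[OF uv])
  have "B (c (u, v)) (D \<nu> u 1) + B (- (Z (u, v) *v m v)) (\<nu> u) = 0"
    by (rule zero_derivative_u[OF B_has_vector_derivative[OF dc smooth_on_curve_derivative[OF smooth_nu u]] u])
      (use eps_derivative_products(8) c_in_C[OF _ uv(2)] B_sym in metis)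
  then have "g u * (h u * x (u, v) + y (u, v) + \<beta>1 (u, v) * B (m v) (\<epsilon>1 u) + \<beta>2 (u, v) * B (m v) (\<epsilon>2 u)) = 0"
    using nu_derivative_products(4,5)[OF u] B_sym[of _ "D \<nu> u 1"] skew[of "\<nu> u"] B_sym[of _ "\<nu> u"]
    by (simp add: c_expand[OF uv] Z_values[OF uv] B_simps algebra_simps)
  then have rel: "h u * x (u, v) + y (u, v) = - \<beta>1 (u, v) * B (m v) (\<epsilon>1 u) - \<beta>2 (u, v) * B (m v) (\<epsilon>2 u)"
    using g_pos[OF u] by simp
  show "((\<lambda>u. x' (u, v)) has_vector_derivative a u * B (m v) (\<epsilon>2 u)) (at u)"
    unfolding x'_def fst_conv snd_conv
    by (rule has_vector_derivative_eq_rhs[OF has_vector_derivative_diff[OF dx has_vector_derivative_mult[OF d\<beta> dM(2)]]])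
      (simp add: a_eq[OF uv, symmetric] algebra_simps)
  show "((\<lambda>u. y' (u, v)) has_vector_derivative - a u * B (m v) (\<epsilon>1 u) + b u * B (m v) (\<nu> u)) (at u)"
    unfolding y'_def fst_conv snd_conv
    by (rule has_vector_derivative_eq_rhs[OF has_vector_derivative_add[OF dy has_vector_derivative_mult[OF d\<beta> dM(1)]]])
      (simp add: a_eq[OF uv, symmetric] b_eq[OF uv, symmetric] algebra_simps)
  have "h u * x' (u, v) + y' (u, v) = h u * x (u, v) + y (u, v)
      + \<beta>1 (u, v) * B (m v) (\<epsilon>1 u) - h u * \<beta>1 (u, v) * B (m v) (\<epsilon>2 u)"
    by (simp add: x'_def y'_def algebra_simps)
  then show "h u * x' (u, v) + y' (u, v) = - b u * B (m v) (\<epsilon>2 u)"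
    unfolding rel b_eq[OF uv, symmetric] by (simp add: algebra_simps)
qed

lemma zeta:
  assumes uv: "u \<in> I1" "v \<in> I2"
  shows "\<zeta> (u, v) \<in> C u" "((\<lambda>u. \<zeta> (u, v)) has_vector_derivative - (\<xi> u *v m v)) (at u)"
proof -
  note u = uv(1)
  show "\<zeta> (u, v) \<in> C u"
    using C_facts(1)[OF u] eps(1,2)[OF u] by (simp add: \<zeta>_def subspace_add subspace_scale)
  note r = gauged_relations[OF uv]
  have Yr: "y' (u, v) = - b u * B (m v) (\<epsilon>2 u) - h u * x' (u, v)" using r(3) by simp
  have "((\<lambda>u. \<zeta> (u, v)) has_vector_derivative
      (x' (u, v) *\<^sub>R (h u *\<^sub>R \<nu> u) + (a u * B (m v) (\<epsilon>2 u)) *\<^sub>R \<epsilon>1 u)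
      + (y' (u, v) *\<^sub>R \<nu> u + (- a u * B (m v) (\<epsilon>1 u) + b u * B (m v) (\<nu> u)) *\<^sub>R \<epsilon>2 u)) (at u)"
    unfolding \<zeta>_def fst_conv eps1_derivative[OF u, symmetric]
    by (intro has_vector_derivative_add scaleR_has_vector_derivative
        r eps_derivative u)
  then show "((\<lambda>u. \<zeta> (u, v)) has_vector_derivative - (\<xi> u *v m v)) (at u)"
    by (elim has_vector_derivative_eq_rhs)
      (simp only: Yr, simp add: \<xi>_def wedge_apply mv_simps
        B_sym[of _ "m v"] algebra_simps)
qed

text \<open>Differentiating \<open>h x' + y' = - b (m, \<epsilon>2)\<close> eliminates \<open>y'\<close> and expresses \<open>h' x'\<close> by products of
  \<open>m\<close> with the frame (\<open>x'_eq\<close>). A second differentiation eliminates \<open>x'\<close> and says that \<open>m\<close> is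
  orthogonal to the curve \<open>w\<close>.\<close>

definition k where "k u = a u * h u + D b u 1"

definition w where
  "w u = D h u 1 *\<^sub>R (D a u 1 *\<^sub>R \<epsilon>1 u - (3 * D b u 1) *\<^sub>R \<nu> u - D k u 1 *\<^sub>R \<epsilon>2 u - (2 * b u) *\<^sub>R D \<nu> u 1)
    - D (\<lambda>u. D h u 1) u 1 *\<^sub>R (a u *\<^sub>R \<epsilon>1 u - k u *\<^sub>R \<epsilon>2 u - (2 * b u) *\<^sub>R \<nu> u)
    - ((D h u 1)\<^sup>2 * a u) *\<^sub>R \<epsilon>2 u"

lemma x'_eq:
  assumes uv: "u \<in> I1" "v \<in> I2"
  shows "D h u 1 * x' (u, v) = a u * B (m v) (\<epsilon>1 u) - k u * B (m v) (\<epsilon>2 u) - 2 * b u * B (m v) (\<nu> u)"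
proof -
  note u = uv(1)
  note dh = smooth_on_curve_derivative[OF smooth_h u] and db = smooth_on_curve_derivative[OF smooth_b u]
  note r = gauged_relations[OF uv]
  note dM = M_derivatives[OF u, of "m v"]
  have "((\<lambda>u. h u * x' (u, v) + y' (u, v) + b u * B (m v) (\<epsilon>2 u)) has_vector_derivative
      (h u * (a u * B (m v) (\<epsilon>2 u)) + D h u 1 * x' (u, v)) + (- a u * B (m v) (\<epsilon>1 u) + b u * B (m v) (\<nu> u))
      + (b u * B (m v) (\<nu> u) + D b u 1 * B (m v) (\<epsilon>2 u))) (at u)"
    by (intro has_vector_derivative_add has_vector_derivative_mult dh r db dM)
  moreover have "h w * x' (w, v) + y' (w, v) + b w * B (m v) (\<epsilon>2 w) = 0" if "w \<in> I1" for w
    using gauged_relations(3)[OF that uv(2)] by simp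
  ultimately have "(h u * (a u * B (m v) (\<epsilon>2 u)) + D h u 1 * x' (u, v))
      + (- a u * B (m v) (\<epsilon>1 u) + b u * B (m v) (\<nu> u))
      + (b u * B (m v) (\<nu> u) + D b u 1 * B (m v) (\<epsilon>2 u)) = 0"
    by (rule zero_derivative_u[OF _ u])
  then show ?thesis by (simp add: k_def algebra_simps)
qed

lemma w_orthogonal:
  assumes uv: "u \<in> I1" "v \<in> I2"
  shows "B (m v) (w u) = 0"
proof -
  note u = uv(1)
  have smk: "smooth_on I1 k"
    unfolding k_def by (intro smooth_on_add smooth_on_mult smooth_on_D op1 smooth_a smooth_b smooth_h)
  note d = smooth_on_curve_derivative[OF smooth_on_D[OF smooth_h] u, of 1]
    smooth_on_curve_derivative[OF smooth_a u] smooth_on_curve_derivative[OF smk u]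
    smooth_on_curve_derivative[OF smooth_b u]
  note dM = M_derivatives[OF u, of "m v"]
  define E where "E = D h u 1 * (a u * B (m v) (\<epsilon>2 u)) + D (\<lambda>u. D h u 1) u 1 * x' (u, v)
      - ((a u * (h u * B (m v) (\<nu> u)) + D a u 1 * B (m v) (\<epsilon>1 u))
        - (k u * B (m v) (\<nu> u) + D k u 1 * B (m v) (\<epsilon>2 u))
        - (2 * b u * B (m v) (D \<nu> u 1) + 2 * D b u 1 * B (m v) (\<nu> u)))"
  have "((\<lambda>u. D h u 1 * x' (u, v) - (a u * B (m v) (\<epsilon>1 u) - k u * B (m v) (\<epsilon>2 u) - 2 * b u * B (m v) (\<nu> u)))
      has_vector_derivative E) (at u)"
    unfolding E_def
    by (intro has_vector_derivative_diff has_vector_derivative_mult d dM gauged_relations[OF uv]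
        has_vector_derivative_mult_right)
  from zero_derivative_u[OF this u] have "E = 0" using x'_eq[OF _ uv(2)] by simp
  have "D h u 1 * E = (D h u 1)\<^sup>2 * (a u * B (m v) (\<epsilon>2 u))
      + D (\<lambda>u. D h u 1) u 1 * (D h u 1 * x' (u, v))
      - D h u 1 * ((a u * (h u * B (m v) (\<nu> u)) + D a u 1 * B (m v) (\<epsilon>1 u))
        - (k u * B (m v) (\<nu> u) + D k u 1 * B (m v) (\<epsilon>2 u))
        - (2 * b u * B (m v) (D \<nu> u 1) + 2 * D b u 1 * B (m v) (\<nu> u)))"
    unfolding E_def by (simp add: algebra_simps power2_eq_square)
  note this[unfolded \<open>E = 0\<close> mult_zero_right x'_eq[OF uv]]
  moreover have "k u = a u * h u + D b u 1" by (rule k_def)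
  ultimately show ?thesis
    unfolding w_def by (simp add: B_simps algebra_simps power2_eq_square)
qed

lemma w_products:
  assumes u: "u \<in> I1"
  shows "B l0 (w u) = 0" "B (w u) (\<epsilon>1 u - h u *\<^sub>R \<epsilon>2 u) = 0" "B (w u) (\<epsilon>2 u) = 2 * b u * D h u 1 * g u"
  using eps_products[OF u] eps_derivative_products(2)[OF u] nu_derivative_products[OF u]
    eps_derivative_products(8)[OF u eps(1)[OF u]] eps_derivative_products(8)[OF u eps(2)[OF u]]
  by (simp_all add: w_def B_simps algebra_simps)

text \<open>If \<open>b = 0\<close> then orthogonality of \<open>w\<close> to \<open>e1\<close> and \<open>e2\<close> forces \<open>a = 0\<close> and \<open>\<zeta> = 0\<close>, so the form
  is a pure gauge and its quadratic form vanishes (\<open>quad_zero\<close>).\<close>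

lemma b_zero_imp:
  assumes zero: "\<And>u. u \<in> I1 \<Longrightarrow> b u = 0" and uv: "u \<in> I1" "v \<in> I2"
  shows "\<beta>2 (u, v) = - h u * \<beta>1 (u, v)"
    "x (u, v) = \<beta>1 (u, v) * B (m v) (\<epsilon>2 u)" "y (u, v) = - \<beta>1 (u, v) * B (m v) (\<epsilon>1 u)"
proof -
  show "\<beta>2 (u, v) = - h u * \<beta>1 (u, v)" using b_eq[OF uv] zero[OF uv(1)] by simp
  note u = uv(1)
  have h: "D h u 1 \<noteq> 0" using h_derivative_nonzero[OF u] .
  have db: "D b w 1 = 0" if "w \<in> I1" for w
    using zero_derivative_u[OF smooth_on_curve_derivative[OF smooth_b that] that] zero by blast
  have k: "k w = a w * h w" if "w \<in> I1" for w using db[OF that] by (simp add: k_def)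
  have "((\<lambda>w. a w * h w) has_vector_derivative a u * D h u 1 + D a u 1 * h u) (at u)"
    using has_vector_derivative_mult smooth_on_curve_derivative smooth_a smooth_h u by blast
  then have "(k has_vector_derivative a u * D h u 1 + D a u 1 * h u) (at u)"
    by (rule has_vector_derivative_transform_within_open[OF _ op1 u]) (simp add: k)
  then have dk: "D k u 1 = a u * D h u 1 + D a u 1 * h u" using D_curve[of k _ u 1] by simp
  have "B (w u) e1 = 0" "B (w u) e2 = 0"
    using B_m_e[of "w u"] w_orthogonal[OF u] B_sym[of "w u"] by simp_all
  then have "B e1 (w u) = 0" "B e2 (w u) = 0" using B_sym[of _ "w u"] by simp_all
  then have "D h u 1 * D a u 1 = D (\<lambda>u. D h u 1) u 1 * a u"
    "D h u 1 * D k u 1 + (D h u 1)\<^sup>2 * a u = D (\<lambda>u. D h u 1) u 1 * k u"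
    using eps[OF u] eps_derivative_products[OF u] nu_derivative_products[OF u] zero[OF u]
    by (simp_all add: w_def B_simps algebra_simps)
  then have "2 * (D h u 1)\<^sup>2 * a u = 0"
    unfolding dk k[OF u] by (simp add: power2_eq_square) algebra
  then have "a u = 0" using h by simp
  then have "x' (u, v) = 0" using x'_eq[OF uv] k[OF u] zero[OF u] h by simp
  then have "y' (u, v) = 0" using gauged_relations(3)[OF uv] zero[OF u] by simp
  then show "x (u, v) = \<beta>1 (u, v) * B (m v) (\<epsilon>2 u)" "y (u, v) = - \<beta>1 (u, v) * B (m v) (\<epsilon>1 u)"
    using \<open>x' (u, v) = 0\<close> by (simp_all add: x'_def y'_def)
qed

lemma quad_zero:
  assumes zero: "\<And>u. u \<in> I1 \<Longrightarrow> b u = 0" and uv: "u \<in> I1" "v \<in> I2"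
    and \<eta>: "\<eta> (u, v) S = fst S *\<^sub>R (\<Psi> v ** Z (u, v) ** A v) + snd S *\<^sub>R (\<Psi> v ** Y (u, v) ** A v)"
  shows "quad \<Sigma> f \<eta> (u, v) S R = 0"
proof -
  have K: "\<eta> (u, v) S *v (\<Psi> v *v z) =
      \<Psi> v *v (fst S *\<^sub>R (Z (u, v) *v z) + snd S *\<^sub>R (Y (u, v) *v z))" for z
    unfolding \<eta>
    by (simp add: mv_simps
        matrix_vector_mul_assoc[symmetric] A_inv(3)[OF uv(2)] mv_simps)
  have K\<nu>: "\<eta> (u, v) S *v (\<Psi> v *v \<nu> u) = \<Psi> v *v (fst S *\<^sub>R (Z (u, v) *v \<nu> u))"
    and Kl: "\<eta> (u, v) S *v l v = \<Psi> v *v (snd S *\<^sub>R c (u, v))"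
    unfolding K l_def using Z_l0_Y_nu[OF uv] by (simp_all add: c_def)
  have "Z (u, v) *v \<nu> u \<in> C u" using Z_maps[OF uv] eps_derivative_products(8)[OF uv(1)] by blast
  then have "\<eta> (u, v) S *v (\<Psi> v *v \<nu> u) \<in> f (u, v)" "\<eta> (u, v) S *v l v \<in> f (u, v)"
    unfolding K\<nu> Kl f_eq[OF uv] using c_in_C[OF uv] C_facts(1)[OF uv(1)]
    by (auto intro!: imageI subspace_scale)
  moreover have "\<eta> (u, v) S *v (\<Psi> v *v z) = 0" if "z \<in> C u" for z
    unfolding K using Z_kills[OF uv that] Y_kills[OF uv that] by simp
  ultimately have "quad \<Sigma> f \<eta> (u, v) S R =
      fst R * (fst S * (h u * B e1 (Z (u, v) *v \<nu> u) + B e2 (Z (u, v) *v \<nu> u)))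
      - snd R * (snd S * (B (m v) (\<epsilon>1 u) * x (u, v) + B (m v) (\<epsilon>2 u) * y (u, v)))"
    by (subst quad_surface[where \<eta> = \<eta>, OF uv refl])
      (simp_all add: K\<nu> Kl A_B(2)[OF uv(2)] B_simps x_def y_def algebra_simps)
  also have "h u * B e1 (Z (u, v) *v \<nu> u) + B e2 (Z (u, v) *v \<nu> u) = 0"
    using b_zero_imp(1)[OF zero uv] by (simp add: Z_values[OF uv] B_simps eps[OF uv(1)])
  also have "B (m v) (\<epsilon>1 u) * x (u, v) + B (m v) (\<epsilon>2 u) * y (u, v) = 0"
    using b_zero_imp(2,3)[OF zero uv] by simp
  finally show ?thesis by simp
qed

text \<open>The orthogonal complement of all \<open>m(v)\<close> contains \<open>l0\<close> and all \<open>w(u)\<close>. If it were only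
  2-dimensional, \<open>w(u)\<close> would be a multiple of \<open>w(u0)\<close>. Since \<open>w\<close> is orthogonal to \<open>\<epsilon>1 - h \<epsilon>2\<close>, so would
  be \<open>w(u0)\<close> for \<open>u\<close> near \<open>u0\<close>, hence also to the derivative \<open>- h' \<epsilon>2\<close>, contrary to
  \<open>(w, \<epsilon>2) = 2 b h' g\<close>.\<close>

lemma dim_m_le_3:
  assumes u0: "u0 \<in> I1" "b u0 \<noteq> 0"
  shows "dim (span (m ` I2)) \<le> 3"
proof (rule ccontr)
  define U where "U = span (m ` I2)"
  assume "\<not> dim (span (m ` I2)) \<le> 3"
  then have d2: "dim (perp B U) \<le> 2" using dim_perp[of U] by (simp add: U_def)
  have perp: "z \<in> perp B U" if "\<And>v. v \<in> I2 \<Longrightarrow> B (m v) z = 0" for z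
  proof -
    have "U \<subseteq> {y. B z y = 0}"
      unfolding U_def using that B_sym[of z] by (intro span_minimal) (auto simp: subspace_def B_simps)
    then show ?thesis by (auto simp: perp_in_def)
  qed
  have l0P: "l0 \<in> perp B U" using l0_m B_sym[of _ l0] by (intro perp) metis
  have wP: "w u \<in> perp B U" if "u \<in> I1" for u using w_orthogonal that by (intro perp) blast
  have w_eps2: "B (w u) (\<epsilon>2 u) \<noteq> 0" if "u \<in> I1" "b u \<noteq> 0" for u
    using w_products(3)[OF that(1)] that g_pos h_derivative_nonzero by fastforce
  have w0: "w u0 \<noteq> 0" using w_eps2[OF u0] by (auto simp: B_simps)
  have "l0 \<notin> span {w u0}"
  proof
    assume "l0 \<in> span {w u0}"
    then obtain r where r: "l0 = r *\<^sub>R w u0" by (auto simp: span_singleton)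
    have "B l0 l0 = r * B l0 (w u0)" by (subst (2) r) (simp only: B_simps)
    then show False using w_products(1)[OF u0(1)] l0(2) by simp
  qed
  then have ind: "independent {l0, w u0}" "card {l0, w u0} = 2"
    using w0 by (auto simp: independent_insert card_insert_if span_base)
  have "perp B U = span {l0, w u0}"
    using card_ge_dim_independent[of "{l0, w u0}" "perp B U"] ind d2 l0P wP[OF u0(1)]
      span_minimal[of "{l0, w u0}" "perp B U"] subspace_perp[OF subspace_UNIV, of U] by auto
  then have multiple: "\<exists>r. w u = r *\<^sub>R w u0" if u: "u \<in> I1" for u
  proof -
    obtain s where "w u - s *\<^sub>R l0 \<in> span {w u0}"
      using wP[OF u] \<open>perp B U = span {l0, w u0}\<close> by (auto simp: span_breakdown_eq)
    then obtain r where "w u - s *\<^sub>R l0 = r *\<^sub>R w u0" by (auto simp: span_singleton)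
    then have r: "w u = s *\<^sub>R l0 + r *\<^sub>R w u0" by (simp add: diff_eq_eq add.commute)
    have "B l0 (w u) = s" unfolding r using w_products(1)[OF u0(1)] by (simp add: B_simps l0(2))
    then show ?thesis using w_products(1)[OF u] r by auto
  qed
  have ort: "B (w u0) (\<epsilon>1 u - h u *\<^sub>R \<epsilon>2 u) = 0" if u: "u \<in> I1" "b u \<noteq> 0" for u
  proof -
    obtain r where r: "w u = r *\<^sub>R w u0" using multiple[OF u(1)] by blast
    then have "r \<noteq> 0" using w_eps2[OF u] by (auto simp: B_simps)
    then show ?thesis using w_products(2)[OF u(1)] r by (simp add: B_simps)
  qed
  define V where "V = {u \<in> I1. b u \<noteq> 0}"
  have "V = I1 \<inter> b -` (- {0})" by (auto simp: V_def)
  then have V: "open V" "u0 \<in> V"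
    using continuous_open_preimage[OF smooth_on_imp_continuous_on[OF smooth_b] op1, of "- {0}"] u0
    by (auto simp: V_def)
  have "((\<lambda>u. B (w u0) (\<epsilon>1 u) - h u * B (w u0) (\<epsilon>2 u)) has_vector_derivative
      h u0 * B (w u0) (\<nu> u0) - (h u0 * B (w u0) (\<nu> u0) + D h u0 1 * B (w u0) (\<epsilon>2 u0))) (at u0)"
    by (intro has_vector_derivative_diff has_vector_derivative_mult M_derivatives u0
        smooth_on_curve_derivative[OF smooth_h])
  then have "h u0 * B (w u0) (\<nu> u0) - (h u0 * B (w u0) (\<nu> u0) + D h u0 1 * B (w u0) (\<epsilon>2 u0)) = 0"
    by (rule derivative_zero_if_constant[OF _ V]) (use ort in \<open>auto simp: V_def B_simps\<close>)
  then show False using h_derivative_nonzero[OF u0(1)] w_eps2[OF u0] by simp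
qed

lemma xi_in_Xi: assumes "u \<in> I1" shows "\<xi> u \<in> \<Xi> u"
  unfolding \<xi>_def Xi_eq
  using eps_products[OF assms] eps_derivative_products[OF assms] eps(1,2)[OF assms] C_facts(4)[OF assms]
  by (intro subspace_add subspace_scale wedge_space_intros) auto

text \<open>A basis \<open>q i = m(r i)\<close> of the span gives the conserved quantities \<open>m(r i) + t \<zeta>(u, r i)\<close>.\<close>

lemma constrained_elastic_span_m:
  assumes u0: "u0 \<in> I1" "b u0 \<noteq> 0" and dim: "dim (span (m ` I2)) = 3"
  shows "constrained_elastic B (perp_in B UNIV (L v0)) I1 C (span (m ` I2))"
proof -
  define U where "U = span (m ` I2)"
  define \<theta> where "\<theta> u X = X *\<^sub>R \<xi> u" for u X :: real
  obtain T where T: "T \<subseteq> m ` I2" "independent T" "m ` I2 \<subseteq> span T" "card T = dim (m ` I2)"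
    using basis_exists by metis
  then have card: "card T = 3" and fin: "finite T" using dim independent_imp_finite by auto
  have spanT: "span T = U"
    unfolding U_def using T(1,3) span_mono span_minimal[OF T(3)] by (metis subset_antisym subspace_span)
  obtain q where q: "bij_betw q {..<3::nat} T"
    using ex_bij_betw_nat_finite[OF fin] card by (auto simp: atLeast0LessThan)
  then have q_inj: "inj_on q {..<3}" and q_img: "q ` {..<3} = T" by (auto simp: bij_betw_def)
  have "\<exists>v. v \<in> I2 \<and> q i = m v" if "i < 3" for i
    using q_img T(1) that by blast
  then obtain r where r: "\<And>i. i < 3 \<Longrightarrow> r i \<in> I2 \<and> q i = m (r i)" by metis
  have Ul0: "U \<subseteq> perp_in B UNIV (L v0)"
    unfolding U_def perp_L0 using l0_m by (intro span_minimal) (auto simp: subspace_def B_simps)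
  have sm: "smooth_on I1 \<xi>"
    unfolding \<xi>_def by (intro smooth_on_add smooth_on_scaleR smooth_on_wedge op1 smooth_a smooth_b smooth_eps smooth_nu)
  have form: "\<theta> \<in> one_forms I1 \<Xi>"
    unfolding one_forms_def sections_def \<theta>_def
    using xi_in_Xi wedge_space_intros(2) unfolding f_wedge_f_perp_def
    by (auto intro!: linearI smooth_on_scaleR op1 sm subspace_scale simp: algebra_simps)
  have "quad I1 C \<theta> u0 1 1 \<noteq> 0"
  proof -
    note X = Xi_props[OF xi_in_Xi[OF u0(1)] u0(1)]
    have "B (\<epsilon>1 u0) (\<nu> u0) = 0" "B (\<epsilon>2 u0) (\<nu> u0) = 0"
      using eps_derivative_products(8)[OF u0(1)] eps(1,2)[OF u0(1)] B_sym[of _ "\<nu> u0"] by auto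
    then have "\<xi> u0 *v \<nu> u0 = - ((b u0 * g u0) *\<^sub>R \<epsilon>2 u0)"
      by (simp add: \<xi>_def mv_simps wedge_apply g_def)
    moreover have "quad I1 C \<theta> u0 1 1 = 1 * (h u0 * B e1 (\<xi> u0 *v \<nu> u0) + B e2 (\<xi> u0 *v \<nu> u0))"
      using X(2,5) by (intro quad_curve[OF u0(1)]) (auto simp: \<theta>_def)
    ultimately show ?thesis using g_pos[OF u0(1)] u0(2) by (simp add: B_simps eps[OF u0(1)])
  qed
  then have pol: "polarisation B (perp_in B UNIV (L v0)) I1 C (gauge_orbit B I1 C \<theta>)"
    unfolding polarisation_def quad_nonzero_def using form u0(1) by blast
  have "(\<lambda>_. 0) \<in> sections I1 (\<lambda>u. wedge_space B (C u) (C u))"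
    using subspace_0[OF wedge_space_intros(2)] by (simp add: sections_def)
  then have mem: "\<theta> \<in> gauge_orbit B I1 C \<theta>"
    unfolding gauge_orbit_def by (intro CollectI bexI[of _ "\<lambda>_. 0"]) auto
  have lcq: "linear_conserved_quantity (perp_in B UNIV (L v0)) I1 C \<theta> (\<lambda>_. q i) (\<lambda>u. \<zeta> (u, r i))"
    if i: "i < 3" for i
    unfolding linear_conserved_quantity_def
  proof (intro conjI allI ballI)
    have ri: "r i \<in> I2" "q i = m (r i)" using r[OF i] by auto
    show "(\<lambda>_. q i) \<in> sections I1 (\<lambda>_. perp_in B UNIV (L v0))"
      unfolding perp_L0 using l0_m ri by (simp add: sections_def)
    show "(\<lambda>u. \<zeta> (u, r i)) \<in> sections I1 C"
      using smooth_on_slices(1)[OF smooth_zeta op1 op2 ri(1)] zeta(1)[OF _ ri(1)] by (simp add: sections_def)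
    fix t u X assume u: "u \<in> I1"
    have "((\<lambda>w. q i + t *\<^sub>R \<zeta> (w, r i)) has_vector_derivative 0 + t *\<^sub>R - (\<xi> u *v q i)) (at u)"
      unfolding ri(2)
      by (intro has_vector_derivative_add has_vector_derivative_const
          scaleR_right_has_vector_derivative[OF zeta(2)[OF u ri(1)]])
    from D_curve[OF this, of X]
    show "D (\<lambda>w. q i + t *\<^sub>R \<zeta> (w, r i)) u X + t *\<^sub>R (\<theta> u X *v (q i + t *\<^sub>R \<zeta> (u, r i))) = 0"
      using Xi_props(2)[OF xi_in_Xi[OF u] u zeta(1)[OF u ri(1)]]
      by (simp add: \<theta>_def mv_simps)
  qed
  have sum_q: "(\<Sum>i<3. s i *\<^sub>R q i) = (\<Sum>z\<in>T. s (the_inv_into {..<3} q z) *\<^sub>R z)" for s :: "nat \<Rightarrow> real"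
    unfolding q_img[symmetric] sum.reindex[OF q_inj] using the_inv_into_f_f[OF q_inj]
    by (auto intro!: sum.cong)
  have indep: "\<forall>i<3. s i = 0" if "(\<Sum>i<3. s i *\<^sub>R q i) = 0" for s :: "nat \<Rightarrow> real"
  proof (intro allI impI)
    fix i :: nat assume i: "i < 3"
    then have "q i \<in> T" using q_img by blast
    then have "s (the_inv_into {..<3} q (q i)) = 0"
      using independentD[OF T(2) fin subset_refl, of "\<lambda>z. s (the_inv_into {..<3} q z)"] that sum_q by simp
    then show "s i = 0" using the_inv_into_f_f[OF q_inj, of i] i by simp
  qed
  have spanq: "{\<Sum>i<3. s i *\<^sub>R q i |s :: nat \<Rightarrow> real. True} = U"
  proof
    have "(\<Sum>i<3. s i *\<^sub>R q i) \<in> U" for s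
      unfolding spanT[symmetric] q_img[symmetric] by (intro span_sum span_scale span_base imageI)
    then show "{\<Sum>i<3. s i *\<^sub>R q i |s :: nat \<Rightarrow> real. True} \<subseteq> U" by blast
    show "U \<subseteq> {\<Sum>i<3. s i *\<^sub>R q i |s :: nat \<Rightarrow> real. True}"
    proof
      fix z assume "z \<in> U"
      then obtain t where "z = (\<Sum>y\<in>T. t y *\<^sub>R y)"
        using span_finite[OF fin] spanT by auto
      also have "\<dots> = (\<Sum>i<3. t (q i) *\<^sub>R q i)"
        unfolding q_img[symmetric] sum.reindex[OF q_inj] by simp
      finally show "z \<in> {\<Sum>i<3. s i *\<^sub>R q i |s :: nat \<Rightarrow> real. True}"
        by (intro CollectI exI[of _ "\<lambda>i. t (q i)"] conjI TrueI)
    qed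
  qed
  show ?thesis
    unfolding constrained_elastic_def U_def[symmetric]
  proof (intro conjI exI)
    show "subspace U" "dim U = 3" "U \<subseteq> perp_in B UNIV (L v0)"
      using dim Ul0 by (auto simp: U_def)
    show "polarisation B (perp_in B UNIV (L v0)) I1 C (gauge_orbit B I1 C \<theta>)" using pol .
    show "\<theta> \<in> gauge_orbit B I1 C \<theta>" using mem .
    show "\<forall>i<3. linear_conserved_quantity (perp_in B UNIV (L v0)) I1 C \<theta> (\<lambda>_. q i) (\<lambda>u. \<zeta> (u, r i))"
      using lcq by blast
    show "\<forall>s :: nat \<Rightarrow> real. (\<forall>u\<in>I1. (\<Sum>i<3. s i *\<^sub>R q i) = 0 \<and> (\<Sum>i<3. s i *\<^sub>R \<zeta> (u, r i)) = 0) \<longrightarrow>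
        (\<forall>i<3. s i = 0)"
      using indep u0(1) by blast
    show "\<forall>u\<in>I1. {\<Sum>i<3. s i *\<^sub>R q i |s :: nat \<Rightarrow> real. True} = U" using spanq by blast
  qed
qed

text \<open>The span of all \<open>m(v)\<close> contains \<open>e1, e2\<close>; if it has dimension at most 2 it is \<open>\<langle>e1, e2\<rangle>\<close>, which is
  orthogonal to \<open>\<nu>\<close>.\<close>

lemma spherical_or_constrained_elastic:
  assumes u0: "u0 \<in> I1" "b u0 \<noteq> 0"
  shows "spherical_leaves B \<Sigma> f T2 \<or>
    (\<exists>W. (\<forall>v\<in>I2. L v \<subseteq> {x + y |x y. x \<in> L v0 \<and> y \<in> W}) \<and>
      constrained_elastic B (perp_in B UNIV (L v0)) I1 C W)"
proof (cases "dim (span (m ` I2)) = 3")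
  case True
  define U where "U = span (m ` I2)"
  have "U \<subseteq> {x. B l0 x = 0}"
    unfolding U_def using l0_m by (intro span_minimal) (auto simp: subspace_def B_simps)
  moreover have "\<forall>v\<in>I2. m v \<in> U" by (auto simp: U_def span_base)
  ultimately have "\<forall>v\<in>I2. L v \<subseteq> {x + y |x y. x \<in> L v0 \<and> y \<in> U}"
    using L_in_sum_iff[of U] by (simp add: U_def)
  then show ?thesis using constrained_elastic_span_m[OF u0 True] unfolding U_def by blast
next
  case False
  define U where "U = span (m ` I2)"
  have U: "subspace U" "dim U \<le> 2" using False dim_m_le_3[OF u0] by (auto simp: U_def)
  have mU: "m v \<in> U" if "v \<in> I2" for v using that by (simp add: U_def span_base)
  have eU: "e1 \<in> U" "e2 \<in> U"
    using mU[OF v0] derivative_in_subspace[OF U(1) op2 v0 mU m_derivative_v0] by (auto simp: e1_def)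
  have e1n: "e2 \<noteq> 0" using eps(6)[OF u0(1)] by (auto simp: B_simps)
  have "e1 \<notin> span {e2}"
  proof
    assume "e1 \<in> span {e2}"
    then obtain r where "e1 = r *\<^sub>R e2" by (auto simp: span_singleton)
    then have "B e1 (\<epsilon>1 u0) = r * B e2 (\<epsilon>1 u0)" by (simp add: B_simps)
    then show False using eps[OF u0(1)] by simp
  qed
  then have "independent {e1, e2}" "card {e1, e2} = 2"
    using e1n by (auto simp: independent_insert card_insert_if span_base)
  then have "U \<subseteq> span {e1, e2}"
    using card_ge_dim_independent[of "{e1, e2}" U] U eU by auto
  moreover have "B z (\<nu> u) = 0" if "z \<in> span {e1, e2}" "u \<in> I1" for z u
  proof -
    have "span {e1, e2} \<subseteq> {z. B z (\<nu> u) = 0}"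
      using eps_derivative_products(4,6)[OF that(2)]
      by (intro span_minimal) (auto simp: subspace_def B_simps)
    then show ?thesis using that(1) by blast
  qed
  ultimately have "spherical_leaves B \<Sigma> f T2" unfolding spherical_T2_iff using mU by blast
  then show ?thesis ..
qed

end

context evolved_surface
begin

lemma spherical_or_constrained_elastic_if_lie_applicable:
  assumes "lie_applicable B \<Sigma> f"
  shows "spherical_leaves B \<Sigma> f T2 \<or>
    (\<exists>W. (\<forall>v\<in>I2. L v \<subseteq> {x + y |x y. x \<in> L v0 \<and> y \<in> W}) \<and>
      constrained_elastic B (perp_in B UNIV (L v0)) I1 C W)"
proof -
  obtain \<eta> where \<eta>: "\<eta> \<in> one_forms \<Sigma> (f_wedge_f_perp B UNIV f)"
    and flat: "\<And>p X Y. p \<in> \<Sigma> \<Longrightarrow> ext_deriv \<eta> p X Y = 0" and nz: "quad_nonzero \<Sigma> f \<eta>"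
    using assms unfolding lie_applicable_def by blast
  define H1 where "H1 p = \<eta> p (1, 0)" for p
  define H2 where "H2 p = \<eta> p (0, 1)" for p
  have smH: "smooth_on \<Sigma> H1" "smooth_on \<Sigma> H2"
    and mem: "\<And>p. p \<in> \<Sigma> \<Longrightarrow> H1 p \<in> f_wedge_f_perp B UNIV f p \<and> H2 p \<in> f_wedge_f_perp B UNIV f p"
    using \<eta> unfolding one_forms_def sections_def H1_def H2_def by blast+
  have lin: "\<eta> p X = fst X *\<^sub>R H1 p + snd X *\<^sub>R H2 p" if "p \<in> \<Sigma>" for p X
  proof -
    have l: "linear (\<eta> p)" using \<eta> that unfolding one_forms_def by blast
    have "X = fst X *\<^sub>R (1, 0) + snd X *\<^sub>R (0, 1)" by (simp add: prod_eq_iff)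
    then have "\<eta> p X = \<eta> p (fst X *\<^sub>R (1, 0) + snd X *\<^sub>R (0, 1))" by (rule arg_cong)
    also have "\<dots> = fst X *\<^sub>R H1 p + snd X *\<^sub>R H2 p"
      unfolding H1_def H2_def linear_add[OF l] linear_cmul[OF l] ..
    finally show ?thesis .
  qed
  define Z where "Z p = A (snd p) ** H1 p ** \<Psi> (snd p)" for p
  define Y where "Y p = A (snd p) ** H2 p ** \<Psi> (snd p)" for p
  have smZ: "smooth_on \<Sigma> Z" "smooth_on \<Sigma> Y"
    unfolding Z_def Y_def by (intro smooth_on_mm opS smooth_A_snd smooth_Psi_snd smH)+
  have conj_back: "\<Psi> v ** (A v ** H ** \<Psi> v) ** A v = H" if "v \<in> I2" for v H
    by (rule matrix_eqI) (simp add: matrix_vector_mul_assoc[symmetric] A_inv(4)[OF that])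
  have HZ: "H1 p = \<Psi> (snd p) ** Z p ** A (snd p)" "H2 p = \<Psi> (snd p) ** Y p ** A (snd p)"
    if "p \<in> \<Sigma>" for p using that conj_back by (auto simp: Z_def Y_def)
  have props: "B ((A v ** K ** \<Psi> v) *v x) y = - B x ((A v ** K ** \<Psi> v) *v y)"
    "x \<in> C u \<Longrightarrow> (A v ** K ** \<Psi> v) *v x = 0"
    "(\<And>y. y \<in> C u \<Longrightarrow> B x y = 0) \<Longrightarrow> (A v ** K ** \<Psi> v) *v x \<in> C u"
    if uv: "u \<in> I1" "v \<in> I2" and K: "K \<in> f_wedge_f_perp B UNIV f (u, v)" for u v K x y
  proof -
    have uv': "(u, v) \<in> \<Sigma>" using uv by simp
    have sub: "subspace (f (u, v))"
      using legendre uv' unfolding legendre_map_def subbundle_def by blast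
    have iso: "B y z = 0" if "y \<in> f (u, v)" "z \<in> f (u, v)" for y z
      using legendre uv' that unfolding legendre_map_def totally_isotropic_def by blast
    have perp: "B x y = 0" if "x \<in> f (u, v)" "y \<in> perp B (f (u, v))" for x y
      using that B_sym[of x y] by (auto simp: perp_in_def)
    note P = wedge_space_props[OF K[unfolded f_wedge_f_perp_def] sub perp]
    have mv: "(A v ** K ** \<Psi> v) *v x = A v *v (K *v (\<Psi> v *v x))" for x
      by (simp add: matrix_vector_mul_assoc[symmetric])
    show "B ((A v ** K ** \<Psi> v) *v x) y = - B x ((A v ** K ** \<Psi> v) *v y)"
      unfolding mv A_B(3)[OF uv(2)]
      using P(1)[where x = "\<Psi> v *v x" and y = "\<Psi> v *v y"] A_B(3)[OF uv(2), of "K *v (\<Psi> v *v y)" x]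
        B_sym[of x "A v *v (K *v (\<Psi> v *v y))"] B_sym[of "\<Psi> v *v x"] by simp
    show "(A v ** K ** \<Psi> v) *v x = 0" if "x \<in> C u"
    proof -
      have "\<Psi> v *v x \<in> f (u, v)" using that f_eq[OF uv] by simp
      then have "K *v (\<Psi> v *v x) = 0" using P(2) iso by blast
      then show ?thesis unfolding mv by simp
    qed
    show "(A v ** K ** \<Psi> v) *v x \<in> C u" if "\<And>y. y \<in> C u \<Longrightarrow> B x y = 0"
    proof -
      have "K *v (\<Psi> v *v x) \<in> f (u, v)"
        by (rule P(3)) (auto simp: f_eq[OF uv] A_B(2)[OF uv(2)] that)
      then show ?thesis unfolding mv by (rule A_f[OF uv])
    qed
  qed
  have closedH: "D H2 (u, v) (1, 0) = D H1 (u, v) (0, 1)" if "u \<in> I1" "v \<in> I2" for u v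
    using flat[of "(u, v)" "(1, 0)" "(0, 1)"] that
    by (simp add: ext_deriv_def H1_def[abs_def] H2_def[abs_def])
  have cf: "closed_form B I1 I2 v0 f s1 s2 T1 T2 L C A Z Y"
  proof unfold_locales
    show "smooth_on \<Sigma> Z" "smooth_on \<Sigma> Y" using smZ .
    fix u v x y assume uv: "u \<in> I1" "v \<in> I2"
    have K: "H1 (u, v) \<in> f_wedge_f_perp B UNIV f (u, v)" "H2 (u, v) \<in> f_wedge_f_perp B UNIV f (u, v)"
      using mem[of "(u, v)"] uv by auto
    show "B (Z (u, v) *v x) y = - B x (Z (u, v) *v y)" "B (Y (u, v) *v x) y = - B x (Y (u, v) *v y)"
      unfolding Z_def Y_def snd_conv by (rule props(1)[OF uv K(1)], rule props(1)[OF uv K(2)])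
    show "x \<in> C u \<Longrightarrow> Z (u, v) *v x = 0" "x \<in> C u \<Longrightarrow> Y (u, v) *v x = 0"
      unfolding Z_def Y_def snd_conv by (rule props(2)[OF uv K(1)], assumption) (rule props(2)[OF uv K(2)])
    show "(\<And>y. y \<in> C u \<Longrightarrow> B x y = 0) \<Longrightarrow> Z (u, v) *v x \<in> C u"
      "(\<And>y. y \<in> C u \<Longrightarrow> B x y = 0) \<Longrightarrow> Y (u, v) *v x \<in> C u"
      unfolding Z_def Y_def snd_conv by (rule props(3)[OF uv K(1)], blast) (rule props(3)[OF uv K(2)])
    have cancel: "M = N" if "\<Psi> v ** M ** A v = \<Psi> v ** N ** A v" for M N
    proof -
      have "A v ** (\<Psi> v ** M ** A v) ** \<Psi> v = M" for M
        by (rule matrix_eqI) (simp add: matrix_vector_mul_assoc[symmetric] A_inv(3)[OF uv(2)])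
      then show ?thesis using that by metis
    qed
    show "D Y (u, v) (1, 0) = D Z (u, v) (0, 1) + J v ** Z (u, v) - Z (u, v) ** J v"
      by (rule cancel)
        (use closedH[OF uv] conj_derivative(1)[OF smZ(2) HZ(2) uv] conj_derivative(2)[OF smZ(1) HZ(1) uv]
          in simp)
  qed
  interpret F: closed_form B I1 I2 v0 f s1 s2 T1 T2 L C A Z Y using cf .
  have "\<exists>u\<in>I1. F.b u \<noteq> 0"
  proof (rule ccontr)
    assume "\<not> ?thesis"
    then have zero: "\<And>u. u \<in> I1 \<Longrightarrow> F.b u = 0" by blast
    have "quad \<Sigma> f \<eta> (u, v) X W = 0" if "u \<in> I1" "v \<in> I2" for u v X W
      using F.quad_zero[OF zero that, of \<eta> X W] lin[of "(u, v)" X] HZ[of "(u, v)"] that by simp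
    then show False using nz unfolding quad_nonzero_def by auto
  qed
  then show ?thesis using F.spherical_or_constrained_elastic by blast
qed

end

theorem theorem6p3:
  fixes B :: "real^6 \<Rightarrow> real^6 \<Rightarrow> real"
    and I1 I2 :: "real set" and v0 :: real
    and f s1 s2 :: "real \<times> real \<Rightarrow> (real^6) set"
    and T1 T2 :: "real \<times> real \<Rightarrow> (real \<times> real) set"
    and L C :: "real \<Rightarrow> (real^6) set"
    and A :: "real \<Rightarrow> real^6^6"
  assumes "has_signature B 4 2"
    and "open_interval I1" and "open_interval I2" and "v0 \<in> I2"
    and legendre: "legendre_map B UNIV (I1 \<times> I2) f"
    and umbilic_free: "curvature_data (I1 \<times> I2) f s1 s2 T1 T2"
    and curvature_line_coordinates:
      "(\<lambda>_. (1, 0)) \<in> sections (I1 \<times> I2) T1" "(\<lambda>_. (0, 1)) \<in> sections (I1 \<times> I2) T2"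
    and regular: "immersed (I1 \<times> I2) s1" "immersed (I1 \<times> I2) s2"
    and spherical: "spherical_leaves B (I1 \<times> I2) f T1"
    and "spacelike_line_map B I2 L"
    and "spherical_evolution_map B I2 L v0 A"
    and "legendre_map B (perp_in B UNIV (L v0)) I1 C"
    and "\<And>u v. u \<in> I1 \<Longrightarrow> v \<in> I2 \<Longrightarrow> f (u, v) = (\<lambda>x. matrix_inv (A v) *v x) ` C u"
  shows "lie_applicable B (I1 \<times> I2) f \<longleftrightarrow>
    spherical_leaves B (I1 \<times> I2) f T2 \<or>
    (\<exists>W0. (\<forall>v\<in>I2. L v \<subseteq> {x + y |x y. x \<in> L v0 \<and> y \<in> W0}) \<and>
          constrained_elastic B (perp_in B UNIV (L v0)) I1 C W0)"
proof -
  interpret evolved_surface B I1 I2 v0 f s1 s2 T1 T2 L C A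
    by unfold_locales (fact assms)+
  show ?thesis
  proof (intro iffI spherical_or_constrained_elastic_if_lie_applicable)
    assume "spherical_leaves B (I1 \<times> I2) f T2 \<or>
      (\<exists>W. (\<forall>v\<in>I2. L v \<subseteq> {x + y |x y. x \<in> L v0 \<and> y \<in> W}) \<and>
        constrained_elastic B (perp_in B UNIV (L v0)) I1 C W)"
    then show "lie_applicable B (I1 \<times> I2) f"
    proof
      assume "\<exists>W. (\<forall>v\<in>I2. L v \<subseteq> {x + y |x y. x \<in> L v0 \<and> y \<in> W}) \<and>
        constrained_elastic B (perp_in B UNIV (L v0)) I1 C W"
      then obtain W where L: "\<forall>v\<in>I2. L v \<subseteq> {x + y |x y. x \<in> L v0 \<and> y \<in> W}"
        and W: "constrained_elastic B (perp_in B UNIV (L v0)) I1 C W" by blast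
      have "subspace W" "W \<subseteq> {x. B l0 x = 0}"
        using W unfolding constrained_elastic_def perp_L0 by blast+
      then have "\<forall>v\<in>I2. m v \<in> W" using L_in_sum_iff L by blast
      then show ?thesis using lie_applicable_if_constrained_elastic[OF W] by blast
    qed (rule lie_applicable_if_spherical)
  qed
qed

end
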